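(* Let $Y,Z$ be complex Banach spaces and let $T:Y\to Z$ be a bounded $\mathbb C$-linear operator. Let $T_{\mathbb R}:Y_{\mathbb R}\to Z_{\mathbb R}$ be $T$ regarded as an $\mathbb R$-linear operator between the underlying real spaces. Then: (1) $T$ is inessential as a complex operator if and only if $T_{\mathbb R}$ is inessential as a real operator; (2) $T$ is strictly singular as a complex operator if and only if $T_{\mathbb R}$ is strictly singular as a real operator; (3) $T$ is strictly cosingular as a complex operator if and only if $T_{\mathbb R}$ is strictly cosingular as a real operator; (4) for every self-conjugate complex space ideal $A$, $T$ is $A$-factorable as a complex operator (i.e. $T$ factors through some $X\in A$ by bounded $\mathbb C$-linear operators) if and only if $T_{\mathbb R}$ is $A$-factorable as a real operator (i.e. $T_{\mathbb R}$ factors through $X_{\mathbb R}$, for some $X\in A$, by bounded $\mathbb R$-linear operators).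
   Context: Operators are bounded linear operators between Banach spaces over the scalar field under consideration ($\mathbb R$ or $\mathbb C$); $L(X,Y)$ is the set of operators from $X$ to $Y$. All notions below are taken over the relevant field (subspaces and operators are real in the real case, complex in the complex case). An operator $T\in L(X,Y)$ is inessential if $Id_X-UT$ is Fredholm for every $U\in L(Y,X)$. It is strictly singular if its restriction to a closed infinite-dimensional subspace of $X$ is never an isomorphism onto its image. It is strictly cosingular if, for every closed infinite-codimensional subspace $Z$ of $Y$ with quotient map $Q:Y\to Y/Z$, the operator $QT$ is not surjective. For a complex Banach space $X$, $X_{\mathbb R}$ is $X$ regarded as a real Banach space, and $\overline X$ is the conjugate space: the same space with scalar multiplication $\lambda\cdot x:=\overline\lambda x$. A complex space ideal is a class $A$ of complex Banach spaces, stable under isomorphism, containing the finite-dimensional spaces and stable under taking (finite) direct sums and complemented subspaces. It is self-conjugate if $X\in A\Leftrightarrow \overline X\in A$. An operator $T\in L(Y,Z)$ factors through $X$ if $T=UV$ with $V\in L(Y,X)$ and $U\in L(X,Z)$. *)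

theory Defs
  imports "HOL-Analysis.Analysis"
begin

section \<open>Complex Banach spaces as a type class\<close>

text \<open>The class extends \<open>banach\<close>, so that a complex Banach space \<open>'a\<close> carries its
  underlying real Banach space: \<open>scaleC\<close> is its complex and \<open>scaleR\<close> its real structure.\<close>

class complex_banach = banach +
  fixes scaleC :: "complex \<Rightarrow> 'a \<Rightarrow> 'a"  (infixr \<open>*\<^sub>C\<close> 75)
  assumes scaleC_add_right: "c *\<^sub>C (x + y) = c *\<^sub>C x + c *\<^sub>C y"
    and scaleC_add_left: "(b + c) *\<^sub>C x = b *\<^sub>C x + c *\<^sub>C x"
    and scaleC_scaleC: "b *\<^sub>C c *\<^sub>C x = (b * c) *\<^sub>C x"
    and scaleC_of_real: "complex_of_real r *\<^sub>C x = r *\<^sub>R x"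
    and norm_scaleC: "norm (c *\<^sub>C x) = cmod c * norm x"

instantiation complex :: complex_banach
begin

definition scaleC_complex :: "complex \<Rightarrow> complex \<Rightarrow> complex"
  where "scaleC_complex c x = c * x"

instance
  by standard
    (simp_all add: scaleC_complex_def algebra_simps norm_mult scaleR_conv_of_real)

end

lemma vector_space_scaleC:
  "vector_space (scaleC :: complex \<Rightarrow> 'a \<Rightarrow> 'a::complex_banach)"
proof
  show "1 *\<^sub>C x = x" for x :: 'a
    using scaleC_of_real[of 1 x] by simp
qed (simp_all add: scaleC_add_right scaleC_add_left scaleC_scaleC)

section \<open>Operators\<close>

text \<open>The notions below are parametrised by the scalar multiplications of the spaces involved.
  With \<open>scaleC\<close> they are the complex notions and with \<open>scaleR\<close> the real ones.\<close>

definition bounded_op ::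
  "('k::field \<Rightarrow> 'a \<Rightarrow> 'a) \<Rightarrow> ('k \<Rightarrow> 'b \<Rightarrow> 'b) \<Rightarrow>
    ('a::real_normed_vector \<Rightarrow> 'b::real_normed_vector) \<Rightarrow> bool"
  where "bounded_op s1 s2 T \<longleftrightarrow>
    Vector_Spaces.linear s1 s2 T \<and> (\<exists>K. \<forall>x. norm (T x) \<le> norm x * K)"

lemma bounded_op_scaleR: "bounded_op scaleR scaleR T \<longleftrightarrow> bounded_linear T"
  unfolding bounded_op_def bounded_linear_def bounded_linear_axioms_def
  by (simp add: linear_def)

definition finite_dim :: "('k::field \<Rightarrow> 'a \<Rightarrow> 'a::ab_group_add) \<Rightarrow> 'a set \<Rightarrow> bool"
  where "finite_dim s S \<longleftrightarrow> (\<exists>B. finite B \<and> module.span s B = S)"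

definition finite_codim :: "('k::field \<Rightarrow> 'a \<Rightarrow> 'a::ab_group_add) \<Rightarrow> 'a set \<Rightarrow> bool"
  where "finite_codim s S \<longleftrightarrow>
    (\<exists>B. finite B \<and> {x + y |x y. x \<in> S \<and> y \<in> module.span s B} = UNIV)"

definition fredholm ::
  "('k::field \<Rightarrow> 'a \<Rightarrow> 'a) \<Rightarrow> ('k \<Rightarrow> 'b \<Rightarrow> 'b) \<Rightarrow>
    ('a::real_normed_vector \<Rightarrow> 'b::real_normed_vector) \<Rightarrow> bool"
  where "fredholm s1 s2 T \<longleftrightarrow>
    bounded_op s1 s2 T \<and> finite_dim s1 {x. T x = 0} \<and>
    closed (range T) \<and> finite_codim s2 (range T)"

definition inessential ::
  "('k::field \<Rightarrow> 'a \<Rightarrow> 'a) \<Rightarrow> ('k \<Rightarrow> 'b \<Rightarrow> 'b) \<Rightarrow>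
    ('a::real_normed_vector \<Rightarrow> 'b::real_normed_vector) \<Rightarrow> bool"
  where "inessential s1 s2 T \<longleftrightarrow>
    (\<forall>U. bounded_op s2 s1 U \<longrightarrow> fredholm s1 s1 (\<lambda>x. x - U (T x)))"

definition strictly_singular ::
  "('k::field \<Rightarrow> 'a \<Rightarrow> 'a) \<Rightarrow> ('a::real_normed_vector \<Rightarrow> 'b::real_normed_vector) \<Rightarrow> bool"
  where "strictly_singular s1 T \<longleftrightarrow>
    (\<forall>S. module.subspace s1 S \<and> closed S \<and> \<not> finite_dim s1 S \<longrightarrow>
      \<not> (\<exists>g. homeomorphism S (T ` S) T g))"

definition quotient_map :: "'a::ab_group_add set \<Rightarrow> 'a \<Rightarrow> 'a set"
  where "quotient_map Z y = (\<lambda>z. y + z) ` Z"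

text \<open>The quotient space of the codomain by \<open>Z\<close> is \<open>range (quotient_map Z)\<close>, the set of
  cosets of \<open>Z\<close>.\<close>

definition strictly_cosingular ::
  "('k::field \<Rightarrow> 'b \<Rightarrow> 'b) \<Rightarrow> ('a::real_normed_vector \<Rightarrow> 'b::real_normed_vector) \<Rightarrow> bool"
  where "strictly_cosingular s2 T \<longleftrightarrow>
    (\<forall>Z. module.subspace s2 Z \<and> closed Z \<and> \<not> finite_codim s2 Z \<longrightarrow>
      range (\<lambda>x. quotient_map Z (T x)) \<noteq> range (quotient_map Z))"

section \<open>Banach spaces as records, and space ideals\<close>

text \<open>A class of Banach spaces cannot be a predicate on types. Its members are therefore
  structures with an explicit carrier inside a type \<open>'a\<close>, which plays the role of the universe;
  the operations are unconstrained outside the carrier.\<close>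

record ('k, 'a) nspace =
  vcarrier :: "'a set"
  vadd :: "'a \<Rightarrow> 'a \<Rightarrow> 'a"
  vzero :: 'a
  vscale :: "'k \<Rightarrow> 'a \<Rightarrow> 'a"
  vnorm :: "'a \<Rightarrow> real"

definition vdist :: "('k::real_normed_field, 'a) nspace \<Rightarrow> 'a \<Rightarrow> 'a \<Rightarrow> real"
  where "vdist V x y = vnorm V (vadd V x (vscale V (- 1) y))"

locale banach_space =
  fixes V :: "('k::real_normed_field, 'a) nspace"
  assumes zero_closed: "vzero V \<in> vcarrier V"
    and add_closed: "\<lbrakk>x \<in> vcarrier V; y \<in> vcarrier V\<rbrakk> \<Longrightarrow> vadd V x y \<in> vcarrier V"
    and scale_closed: "x \<in> vcarrier V \<Longrightarrow> vscale V c x \<in> vcarrier V"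
    and add_assoc: "\<lbrakk>x \<in> vcarrier V; y \<in> vcarrier V; z \<in> vcarrier V\<rbrakk> \<Longrightarrow>
      vadd V (vadd V x y) z = vadd V x (vadd V y z)"
    and add_commute: "\<lbrakk>x \<in> vcarrier V; y \<in> vcarrier V\<rbrakk> \<Longrightarrow> vadd V x y = vadd V y x"
    and add_zero: "x \<in> vcarrier V \<Longrightarrow> vadd V (vzero V) x = x"
    and add_inverse: "x \<in> vcarrier V \<Longrightarrow> \<exists>y\<in>vcarrier V. vadd V y x = vzero V"
    and scale_add_right: "\<lbrakk>x \<in> vcarrier V; y \<in> vcarrier V\<rbrakk> \<Longrightarrow>
      vscale V c (vadd V x y) = vadd V (vscale V c x) (vscale V c y)"
    and scale_add_left: "x \<in> vcarrier V \<Longrightarrow>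
      vscale V (b + c) x = vadd V (vscale V b x) (vscale V c x)"
    and scale_scale: "x \<in> vcarrier V \<Longrightarrow> vscale V b (vscale V c x) = vscale V (b * c) x"
    and scale_one: "x \<in> vcarrier V \<Longrightarrow> vscale V 1 x = x"
    and norm_eq_zero: "x \<in> vcarrier V \<Longrightarrow> vnorm V x = 0 \<longleftrightarrow> x = vzero V"
    and norm_triangle: "\<lbrakk>x \<in> vcarrier V; y \<in> vcarrier V\<rbrakk> \<Longrightarrow>
      vnorm V (vadd V x y) \<le> vnorm V x + vnorm V y"
    and norm_scale: "x \<in> vcarrier V \<Longrightarrow> vnorm V (vscale V c x) = norm c * vnorm V x"
    and complete: "\<lbrakk>\<And>n::nat. \<sigma> n \<in> vcarrier V;
        \<And>e. e > 0 \<Longrightarrow> \<exists>N. \<forall>m\<ge>N. \<forall>n\<ge>N. vdist V (\<sigma> m) (\<sigma> n) < e\<rbrakk> \<Longrightarrow>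
      \<exists>x\<in>vcarrier V. (\<lambda>n. vdist V (\<sigma> n) x) \<longlonglongrightarrow> 0"

definition nspace_op ::
  "('k, 'a) nspace \<Rightarrow> ('k, 'b) nspace \<Rightarrow> ('a \<Rightarrow> 'b) \<Rightarrow> bool"
  where "nspace_op V W f \<longleftrightarrow>
    (\<forall>x\<in>vcarrier V. f x \<in> vcarrier W) \<and>
    (\<forall>x\<in>vcarrier V. \<forall>y\<in>vcarrier V. f (vadd V x y) = vadd W (f x) (f y)) \<and>
    (\<forall>c. \<forall>x\<in>vcarrier V. f (vscale V c x) = vscale W c (f x)) \<and>
    (\<exists>K. \<forall>x\<in>vcarrier V. vnorm W (f x) \<le> vnorm V x * K)"

definition nspace_isomorphic :: "('k, 'a) nspace \<Rightarrow> ('k, 'b) nspace \<Rightarrow> bool"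
  where "nspace_isomorphic V W \<longleftrightarrow>
    (\<exists>f g. nspace_op V W f \<and> nspace_op W V g \<and>
      (\<forall>x\<in>vcarrier V. g (f x) = x) \<and> (\<forall>y\<in>vcarrier W. f (g y) = y))"

definition nsubspace :: "('k, 'a) nspace \<Rightarrow> 'a set \<Rightarrow> bool"
  where "nsubspace V M \<longleftrightarrow>
    M \<subseteq> vcarrier V \<and> vzero V \<in> M \<and>
    (\<forall>x\<in>M. \<forall>y\<in>M. vadd V x y \<in> M) \<and> (\<forall>c. \<forall>x\<in>M. vscale V c x \<in> M)"

text \<open>Some finite set spans the space: the only subspace containing it is the whole space.\<close>

definition nspace_finite_dim :: "('k, 'a) nspace \<Rightarrow> bool"
  where "nspace_finite_dim V \<longleftrightarrow>
    (\<exists>B. finite B \<and> B \<subseteq> vcarrier V \<and> (\<forall>M. nsubspace V M \<and> B \<subseteq> M \<longrightarrow> M = vcarrier V))"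

definition complemented :: "('k, 'a) nspace \<Rightarrow> 'a set \<Rightarrow> bool"
  where "complemented V M \<longleftrightarrow>
    (\<exists>P. nspace_op V V P \<and> (\<forall>x\<in>vcarrier V. P (P x) = P x) \<and> P ` vcarrier V = M)"

definition direct_sum :: "('k, 'a) nspace \<Rightarrow> ('k, 'b) nspace \<Rightarrow> ('k, 'a \<times> 'b) nspace"
  where "direct_sum V W = \<lparr>
    vcarrier = vcarrier V \<times> vcarrier W,
    vadd = (\<lambda>(x, y) (x', y'). (vadd V x x', vadd W y y')),
    vzero = (vzero V, vzero W),
    vscale = (\<lambda>c (x, y). (vscale V c x, vscale W c y)),
    vnorm = (\<lambda>(x, y). vnorm V x + vnorm W y)\<rparr>"

definition conj_space :: "(complex, 'a) nspace \<Rightarrow> (complex, 'a) nspace"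
  where "conj_space V = V\<lparr>vscale := (\<lambda>c. vscale V (cnj c))\<rparr>"

definition real_space :: "(complex, 'a) nspace \<Rightarrow> (real, 'a) nspace"
  where "real_space V = \<lparr>
    vcarrier = vcarrier V, vadd = vadd V, vzero = vzero V,
    vscale = (\<lambda>r. vscale V (complex_of_real r)), vnorm = vnorm V\<rparr>"

text \<open>A direct sum of members of \<open>A\<close> lives in \<open>'a \<times> 'a\<close>; stability under direct sums
  is expressed by its isomorphic copies in \<open>'a\<close>. Such copies exist whenever \<open>'a\<close> is infinite,
  hence whenever \<open>'a\<close> carries a nonzero complex Banach space.\<close>

definition complex_space_ideal :: "(complex, 'a) nspace set \<Rightarrow> bool"
  where "complex_space_ideal A \<longleftrightarrow>
    (\<forall>X\<in>A. banach_space X) \<and>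
    (\<forall>X\<in>A. \<forall>W. banach_space W \<and> nspace_isomorphic W X \<longrightarrow> W \<in> A) \<and>
    (\<forall>X. banach_space X \<and> nspace_finite_dim X \<longrightarrow> X \<in> A) \<and>
    (\<forall>X\<in>A. \<forall>Y\<in>A. \<forall>W. banach_space W \<and> nspace_isomorphic W (direct_sum X Y) \<longrightarrow> W \<in> A) \<and>
    (\<forall>X\<in>A. \<forall>M. complemented X M \<longrightarrow> X\<lparr>vcarrier := M\<rparr> \<in> A)"

definition self_conjugate :: "(complex, 'a) nspace set \<Rightarrow> bool"
  where "self_conjugate A \<longleftrightarrow> (\<forall>X. banach_space X \<longrightarrow> (X \<in> A \<longleftrightarrow> conj_space X \<in> A))"

definition space_of :: "('k \<Rightarrow> 'a \<Rightarrow> 'a) \<Rightarrow> ('k, 'a::real_normed_vector) nspace"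
  where "space_of s = \<lparr>vcarrier = UNIV, vadd = (+), vzero = 0, vscale = s, vnorm = norm\<rparr>"

lemma nspace_op_space_of:
  assumes "vector_space s1" "vector_space s2"
  shows "nspace_op (space_of s1) (space_of s2) f \<longleftrightarrow> bounded_op s1 s2 f"
  using assms
  by (auto simp: nspace_op_def space_of_def bounded_op_def Vector_Spaces.linear_def
      module_hom_def module_hom_axioms_def vector_space_def module_def)

lemma real_space_space_of_scaleC: "real_space (space_of scaleC) = space_of scaleR"
  by (simp add: real_space_def space_of_def scaleC_of_real fun_eq_iff)

lemma banach_space_space_of_scaleC:
  "banach_space (space_of (scaleC :: complex \<Rightarrow> 'a \<Rightarrow> 'a::complex_banach))"
proof -
  interpret C: vector_space "scaleC :: complex \<Rightarrow> 'a \<Rightarrow> 'a"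
    by (rule vector_space_scaleC)
  have d: "vdist (space_of scaleC) x y = dist x y" for x y :: 'a
    by (simp add: vdist_def space_of_def dist_norm)
  show ?thesis
  proof
    fix \<sigma> :: "nat \<Rightarrow> 'a"
    assume "\<exists>N. \<forall>m\<ge>N. \<forall>n\<ge>N. vdist (space_of scaleC) (\<sigma> m) (\<sigma> n) < e" if "e > 0" for e
    then have "Cauchy \<sigma>"
      unfolding Cauchy_def d by blast
    then obtain x where "\<sigma> \<longlonglongrightarrow> x"
      using Cauchy_convergent_iff convergent_def by blast
    then show "\<exists>x\<in>vcarrier (space_of scaleC). (\<lambda>n. vdist (space_of scaleC) (\<sigma> n) x) \<longlonglongrightarrow> 0"
      unfolding d by (auto simp: space_of_def tendsto_dist_iff[symmetric])
  qed (auto simp: space_of_def norm_scaleC norm_triangle_ineq algebra_simps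
      C.scale_right_distrib C.scale_left_distrib intro: exI[of _ "- _"])
qed

definition factors_through ::
  "('k, 'u) nspace \<Rightarrow> ('k \<Rightarrow> 'a \<Rightarrow> 'a) \<Rightarrow> ('k \<Rightarrow> 'b \<Rightarrow> 'b) \<Rightarrow>
    ('a::real_normed_vector \<Rightarrow> 'b::real_normed_vector) \<Rightarrow> bool"
  where "factors_through X s1 s2 T \<longleftrightarrow>
    (\<exists>V U. nspace_op (space_of s1) X V \<and> nspace_op X (space_of s2) U \<and> T = U \<circ> V)"

end

theory Submission
  imports Defs
begin

text \<open>
  Multiplication by \<open>\<i>\<close> splits a bounded real operator between complex spaces into a complex
  linear and an antilinear part. An antilinear operator is a complex linear operator into, or out
  of, the conjugate space, and the composition of two antilinear operators is complex linear. These
  two remarks carry all four equivalences. For inessential, strictly singular and strictly cosingular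
  operators, the implication from the real to the complex notion holds because complex operators and
  complex subspaces are in particular real ones and because dimension and codimension of a complex
  subspace are finite over \<open>\<complex>\<close> if and only if they are finite over \<open>\<real>\<close>. For factorizations it is
  the implication from complex to real that is immediate. The converse implications
  need the arguments that follow.

  \<^emph>\<open>Inessential operators.\<close> Let \<open>U = U\<^sub>0 + U\<^sub>1\<close> be the splitting of a real operator \<open>U\<close>. Then \<open>S = 1 - U\<^sub>0 T\<close> is
  Fredholm, so it has an inverse modulo operators of finite rank, which may be taken complex linear,
  say \<open>W\<close>. Modulo finite rank, \<open>1 - U T\<close> is \<open>S (1 - R)\<close> with \<open>R = W U\<^sub>1 T\<close> antilinear. Now \<open>R\<^sup>2\<close> is
  of the form \<open>U' T\<close> with \<open>U'\<close> complex linear, hence \<open>(1 - R) (1 + R) = 1 - R\<^sup>2\<close> is Fredholm, and so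
  are \<open>1 - R\<close> and \<open>1 - U T\<close>. Fredholm operators are treated as the operators that are invertible
  modulo finite rank (\<open>parametrix_exists\<close>, \<open>fredholm_if_essentially_invertible\<close>).

  \<^emph>\<open>Strictly singular operators.\<close> Suppose that \<open>T\<close> is bounded below on a closed real subspace \<open>S\<close>. The pairs
  \<open>(s + \<i> s', s - \<i> s')\<close> with \<open>s, s' \<in> S\<close> form a closed complex subspace \<open>D\<close> of the direct sum of
  \<open>Y\<close> and its conjugate space, and \<open>T \<oplus> T\<close> is bounded below on \<open>D\<close>. If \<open>D\<close> is infinite-dimensional
  and \<open>T\<close> is strictly singular over \<open>\<complex>\<close>, then the first coordinate of \<open>T \<oplus> T\<close> has small norm on an
  infinite-dimensional closed complex subspace \<open>M\<close> of \<open>D\<close> (\<open>exists_subspace_with_small_norm\<close>), so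
  that the second coordinate must be bounded below on \<open>M\<close>, a contradiction.

  \<^emph>\<open>Strictly cosingular operators.\<close> Dually, suppose that \<open>T\<close> is onto modulo a closed real subspace \<open>W\<close>
  of infinite codimension. Then \<open>T \<oplus> T\<close> is onto
  modulo the complex subspace \<open>K\<close> of the direct sum of \<open>Z\<close> and its conjugate that is formed from \<open>W\<close>
  in the same way. If \<open>T\<close> is strictly cosingular over \<open>\<complex>\<close>, the range of the first coordinate becomes
  almost negligible modulo a larger closed complex subspace \<open>M\<close> of infinite codimension
  (\<open>exists_subspace_approximating_range\<close>), so that the second coordinate alone is onto modulo \<open>M\<close>,
  a contradiction.

  \<^emph>\<open>Factorizations.\<close> If \<open>T = U V\<close> with real \<open>U\<close> and \<open>V\<close>, then comparing complex linear parts gives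
  \<open>T = U\<^sub>0 V\<^sub>0 + U\<^sub>1 V\<^sub>1\<close>, a complex factorization through the direct sum of \<open>X\<close> and its conjugate.

  The analytic tools are the Hahn-Banach theorem, which supplies projections of finite rank and
  functionals, and the open mapping theorem.
\<close>

section \<open>Successive approximation and open mappings\<close>

text \<open>Successive approximation: the error is at least halved at each step, so the corrections form an
  absolutely convergent series. The closed subspace \<open>M\<close> plays the role of a quotient of the
  codomain: the conclusion says that \<open>f\<close> followed by the quotient map by \<open>M\<close> maps \<open>D\<close> onto.\<close>

lemma onto_if_approximately_onto:
  fixes f :: "'a::banach \<Rightarrow> 'b::real_normed_vector"
  assumes f: "bounded_linear f"
    and D: "closed D" "subspace D" and M: "closed M" "subspace M"
    and approx: "\<And>x. \<exists>y\<in>D. \<exists>m\<in>M. norm y \<le> L * norm x \<and> norm (x - f y - m) \<le> norm x / 2"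
  shows "\<exists>y\<in>D. x - f y \<in> M \<and> norm y \<le> 2 * L * norm x"
proof -
  obtain g h where g: "\<And>x. g x \<in> D" and h: "\<And>x. h x \<in> M"
    and gn: "\<And>x. norm (g x) \<le> L * norm x" and gh: "\<And>x. norm (x - f (g x) - h x) \<le> norm x / 2"
    using approx by metis
  interpret f: bounded_linear f by (rule f)
  define r where "r n = ((\<lambda>z. z - f (g z) - h z) ^^ n) x" for n
  have r0: "r 0 = x" and rS: "r (Suc n) = r n - f (g (r n)) - h (r n)" for n
    by (simp_all add: r_def)
  have rn: "norm (r n) \<le> norm x * (1 / 2) ^ n" for n
  proof (induction n)
    case (Suc n)
    have "norm (r (Suc n)) \<le> norm (r n) / 2"
      unfolding rS by (rule gh)
    also have "\<dots> \<le> norm x * (1 / 2) ^ Suc n"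
      using Suc by simp
    finally show ?case .
  qed (simp add: r0)
  define y where "y = (\<Sum>n. g (r n))"
  \<comment> \<open>A negative \<open>L\<close> is possible if the codomain is zero.\<close>
  have Lnn: "0 \<le> L \<or> x = 0"
    using gn[of x] norm_ge_zero[of "g x"] by (smt (verit) mult_neg_pos zero_less_norm_iff)
  have bd: "norm (g (r n)) \<le> L * norm x * (1 / 2) ^ n" for n
  proof (cases "x = 0")
    case True
    then have "r n = 0"
      using rn[of n] by simp
    then show ?thesis
      using gn[of 0] True by simp
  next
    case False
    then have "L * norm (r n) \<le> L * (norm x * (1 / 2) ^ n)"
      using Lnn rn[of n] by (intro mult_left_mono) auto
    then show ?thesis
      using gn[of "r n"] by (simp add: mult.assoc)
  qed
  have geo: "(\<lambda>n. L * norm x * (1 / 2) ^ n) sums (L * norm x * 2)"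
    using sums_mult[OF geometric_sums[of "1/2 :: real"], of "L * norm x"] by simp
  have sumg: "summable (\<lambda>n. g (r n))"
    by (rule summable_comparison_test[OF _ sums_summable[OF geo]]) (use bd in blast)
  have "norm y \<le> (\<Sum>n. norm (g (r n)))"
    unfolding y_def
    by (rule summable_norm, rule summable_comparison_test[OF _ sums_summable[OF geo]])
      (use bd in auto)
  also have "\<dots> \<le> (\<Sum>n. L * norm x * (1 / 2) ^ n)"
    by (rule suminf_le[OF bd _ sums_summable[OF geo]],
        rule summable_comparison_test[OF _ sums_summable[OF geo]]) (use bd in auto)
  also have "\<dots> = 2 * L * norm x"
    using sums_unique[OF geo] by simp
  finally have ny: "norm y \<le> 2 * L * norm x" .
  have lim: "(\<lambda>n. \<Sum>i<n. g (r i)) \<longlonglongrightarrow> y"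
    unfolding y_def by (rule summable_LIMSEQ[OF sumg])
  have "(\<Sum>i<n. g (r i)) \<in> D" for n
    by (intro subspace_sum D g)
  then have yD: "y \<in> D"
    using closed_sequentially[OF D(1) _ lim] by blast
  have part: "x - f (\<Sum>i<n. g (r i)) - r n = (\<Sum>i<n. h (r i))" for n
  proof (induction n)
    case (Suc n)
    then show ?case
      by (simp add: rS f.add algebra_simps)
  qed (simp add: r0)
  have "r \<longlonglongrightarrow> 0"
  proof (rule Lim_null_comparison)
    show "\<forall>\<^sub>F n in sequentially. norm (r n) \<le> norm x * (1 / 2) ^ n"
      using rn by simp
    show "(\<lambda>n. norm x * (1 / 2) ^ n) \<longlonglongrightarrow> 0"
      by (intro tendsto_mult_right_zero LIMSEQ_power_zero) simp
  qed
  then have "(\<lambda>n. x - f (\<Sum>i<n. g (r i)) - r n) \<longlonglongrightarrow> x - f y - 0"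
    by (intro tendsto_diff tendsto_const f.tendsto lim)
  moreover have "x - f (\<Sum>i<n. g (r i)) - r n \<in> M" for n
    unfolding part by (intro subspace_sum M h)
  ultimately have "x - f y \<in> M"
    using closed_sequentially[OF M(1), of "\<lambda>n. x - f (\<Sum>i<n. g (r i)) - r n"] by auto
  then show ?thesis
    using yD ny by blast
qed

text \<open>By Baire's theorem, the closure of the image of some ball of \<open>D\<close> has an interior point. Differences
  of elements of that ball then solve \<open>f y = x\<close> up to an error of at most half the norm of \<open>x\<close>, and
  successive approximation does the rest.\<close>

lemma open_mapping:
  fixes f :: "'a::banach \<Rightarrow> 'b::banach"
  assumes f: "bounded_linear f" and D: "closed D" "subspace D" and onto: "f ` D = UNIV"
  obtains L where "L \<ge> 0" "\<And>x. \<exists>y\<in>D. f y = x \<and> norm y \<le> L * norm x"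
proof -
  interpret f: bounded_linear f by (rule f)
  define F where "F n = closure (f ` (D \<inter> cball 0 (real n)))" for n :: nat
  have "\<exists>n. interior (F n) \<noteq> {}"
  proof (rule ccontr)
    assume "\<not> ?thesis"
    then have "euclidean interior_of \<Union>(range F) = {}"
      by (intro Baire_category_alt) (auto simp: completely_metrizable_space_euclidean F_def)
    moreover have "x \<in> \<Union>(range F)" for x
    proof -
      obtain y where y: "y \<in> D" "x = f y"
        using onto by (metis UNIV_I imageE)
      obtain n where "norm y \<le> real n"
        using real_arch_simple by blast
      then show ?thesis
        using y closure_subset unfolding F_def by fastforce
    qed
    ultimately show False
      by (metis UNIV_I UNIV_eq_I empty_iff euclidean_interior_of interior_UNIV)
  qed
  then obtain n x0 where "x0 \<in> interior (F n)"
    by blast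
  then obtain r where r: "r > 0" "ball x0 r \<subseteq> F n"
    by (meson mem_interior)
  define L where "L = 4 * real n / r"
  have approx: "\<exists>y\<in>D. \<exists>m\<in>{0}. norm y \<le> L * norm x \<and> norm (x - f y - m) \<le> norm x / 2" for x
  proof (cases "x = 0")
    case True
    then show ?thesis
      by (intro bexI[of _ 0]) (auto simp: f.zero D subspace_0)
  next
    case False
    \<comment> \<open>The vector \<open>x\<close> is scaled so that \<open>x0\<close> and \<open>x0 + t x\<close> both lie in the ball.\<close>
    define t where "t = r / (2 * norm x)"
    have t: "t > 0"
      using False r by (simp add: t_def)
    have tx: "norm (t *\<^sub>R x) = r / 2"
      using False r by (simp add: t_def)
    have "x0 + t *\<^sub>R x \<in> F n" "x0 \<in> F n"
      using r tx by (auto simp: dist_norm intro!: subsetD[OF r(2)])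
    moreover have "\<exists>y. y \<in> D \<and> norm y \<le> n \<and> dist (f y) z < r / 8" if z: "z \<in> F n" for z
    proof -
      have "r / 8 > 0"
        using r by simp
      then obtain w where "w \<in> f ` (D \<inter> cball 0 (real n))" "dist w z < r / 8"
        using z unfolding F_def closure_approachable by blast
      then show ?thesis
        by auto
    qed
    ultimately obtain y1 y2
      where y1: "y1 \<in> D" "norm y1 \<le> n" "dist (f y1) (x0 + t *\<^sub>R x) < r / 8"
        and y2: "y2 \<in> D" "norm y2 \<le> n" "dist (f y2) x0 < r / 8"
      by blast
    define y where "y = (1 / t) *\<^sub>R (y1 - y2)"
    have "y \<in> D"
      unfolding y_def by (intro subspace_scale subspace_diff D y1 y2)
    moreover have "norm y \<le> L * norm x"
    proof -
      have "norm y = norm (y1 - y2) / t"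
        using t by (simp add: y_def)
      also have "\<dots> \<le> (real n + real n) / t"
        using t y1 y2 norm_triangle_ineq4[of y1 y2] by (intro divide_right_mono) auto
      also have "\<dots> = L * norm x"
        using False r by (simp add: t_def L_def)
      finally show ?thesis .
    qed
    moreover have "norm (x - f y - 0) \<le> norm x / 2"
    proof -
      have "x - f y = (1 / t) *\<^sub>R ((x0 + t *\<^sub>R x - f y1) + (f y2 - x0))"
        using t by (simp add: y_def f.scaleR f.diff algebra_simps)
      then have "norm (x - f y) = norm ((x0 + t *\<^sub>R x - f y1) + (f y2 - x0)) / t"
        using t by simp
      also have "\<dots> \<le> (r / 8 + r / 8) / t"
      proof (intro divide_right_mono)
        show "norm ((x0 + t *\<^sub>R x - f y1) + (f y2 - x0)) \<le> r / 8 + r / 8"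
          using y1(3) y2(3) norm_triangle_ineq[of "x0 + t *\<^sub>R x - f y1" "f y2 - x0"]
          by (simp add: dist_norm norm_minus_commute)
      qed (use t in simp)
      also have "\<dots> = norm x / 2"
        using False r by (simp add: t_def)
      finally show ?thesis
        by simp
    qed
    ultimately show ?thesis
      by blast
  qed
  have "\<exists>y\<in>D. f y = x \<and> norm y \<le> (2 * L) * norm x" for x
    using onto_if_approximately_onto[OF f D _ _ approx, of x] by (auto simp: mult.assoc)
  moreover have "2 * L \<ge> 0"
    using r by (simp add: L_def)
  ultimately show ?thesis
    using that by blast
qed

section \<open>The Hahn-Banach theorem\<close>

definition sublinear :: "('a::real_vector \<Rightarrow> real) \<Rightarrow> bool"
  where "sublinear q \<longleftrightarrow>
    (\<forall>x y. q (x + y) \<le> q x + q y) \<and> (\<forall>r\<ge>0. \<forall>x. q (r *\<^sub>R x) = r * q x)"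

lemma sublinear_add: "sublinear q \<Longrightarrow> q (x + y) \<le> q x + q y"
  and sublinear_scale: "sublinear q \<Longrightarrow> r \<ge> 0 \<Longrightarrow> q (r *\<^sub>R x) = r * q x"
  by (auto simp: sublinear_def)

lemma sublinear_zero: "sublinear q \<Longrightarrow> q 0 = 0"
  using sublinear_scale[of q 0 0] by simp

lemma sublinear_minus: "sublinear q \<Longrightarrow> - q (- x) \<le> q x"
  using sublinear_add[of q x "- x"] sublinear_zero[of q] by simp

lemma sublinearI:
  assumes add: "\<And>x y. q (x + y) \<le> q x + q y" and zero: "q 0 = 0"
    and scale: "\<And>r x. r > 0 \<Longrightarrow> q (r *\<^sub>R x) \<le> r * q x"
  shows "sublinear q"
proof -
  have "q (r *\<^sub>R x) = r * q x" if "r \<ge> 0" for r x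
  proof (cases "r = 0")
    case False
    with that have r: "r > 0"
      by simp
    have "q x \<le> (1 / r) * q (r *\<^sub>R x)"
      using scale[of "1 / r" "r *\<^sub>R x"] r by simp
    then have "r * q x \<le> q (r *\<^sub>R x)"
      using r by (simp add: field_simps)
    then show ?thesis
      using scale[OF r, of x] by simp
  qed (simp add: zero)
  then show ?thesis
    using add by (simp add: sublinear_def)
qed

text \<open>A tilt of \<open>q\<close> is a sublinear functional below \<open>q\<close> whose value at \<open>- y\<close> is at most \<open>- q y\<close>. A
  minimal sublinear functional agrees with all its tilts, and this makes it additive.\<close>

definition tilt :: "('a::real_vector \<Rightarrow> real) \<Rightarrow> 'a \<Rightarrow> 'a \<Rightarrow> real"
  where "tilt q y x = (INF t\<in>{0..}. q (x + t *\<^sub>R y) - t * q y)"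

lemma
  assumes q: "sublinear q"
  shows sublinear_tilt: "sublinear (tilt q y)"
    and tilt_le: "t \<ge> 0 \<Longrightarrow> tilt q y x \<le> q (x + t *\<^sub>R y) - t * q y"
proof -
  have lower: "- q (- x) \<le> q (x + t *\<^sub>R y) - t * q y" if "t \<ge> 0" for t x
    using sublinear_add[OF q, of "- x" "x + t *\<^sub>R y"] sublinear_scale[OF q that, of y] by simp
  have bdd: "bdd_below ((\<lambda>t. q (x + t *\<^sub>R y) - t * q y) ` {0..})" for x
    using lower by (intro bdd_belowI2[where m = "- q (- x)"]) auto
  show le: "tilt q y x \<le> q (x + t *\<^sub>R y) - t * q y" if "t \<ge> 0" for t x
    unfolding tilt_def by (rule cINF_lower[OF bdd]) (use that in simp)
  have ge: "c \<le> tilt q y x" if "\<And>t. t \<ge> 0 \<Longrightarrow> c \<le> q (x + t *\<^sub>R y) - t * q y" for c x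
    unfolding tilt_def by (rule cINF_greatest) (use that in auto)
  show "sublinear (tilt q y)"
  proof (rule sublinearI)
    fix x x'
    have 1: "tilt q y (x + x') \<le> (q (x + t *\<^sub>R y) - t * q y) + (q (x' + u *\<^sub>R y) - u * q y)"
      if "t \<ge> 0" "u \<ge> 0" for t u
      using le[of "t + u" "x + x'"] sublinear_add[OF q, of "x + t *\<^sub>R y" "x' + u *\<^sub>R y"] that
      by (simp add: algebra_simps)
    have "tilt q y (x + x') - (q (x + t *\<^sub>R y) - t * q y) \<le> tilt q y x'" if "t \<ge> 0" for t
      by (rule ge) (use 1[OF that] in fastforce)
    then have "tilt q y (x + x') - tilt q y x' \<le> tilt q y x"
      by (intro ge) fastforce
    then show "tilt q y (x + x') \<le> tilt q y x + tilt q y x'"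
      by simp
  next
    have "tilt q y 0 \<le> 0"
      using le[of 0 0] sublinear_zero[OF q] by simp
    moreover have "0 \<le> tilt q y 0"
      using lower[of _ 0] sublinear_zero[OF q] by (intro ge) simp
    ultimately show "tilt q y 0 = 0"
      by simp
  next
    fix r :: real and x
    assume r: "r > 0"
    have "(1 / r) * tilt q y (r *\<^sub>R x) \<le> tilt q y x"
    proof (rule ge)
      fix t :: real
      assume t: "t \<ge> 0"
      have "tilt q y (r *\<^sub>R x) \<le> q (r *\<^sub>R (x + t *\<^sub>R y)) - r * t * q y"
        using le[of "r * t" "r *\<^sub>R x"] r t by (simp add: algebra_simps)
      also have "\<dots> = r * (q (x + t *\<^sub>R y) - t * q y)"
        using sublinear_scale[OF q, of r "x + t *\<^sub>R y"] r by (simp add: algebra_simps)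
      finally show "(1 / r) * tilt q y (r *\<^sub>R x) \<le> q (x + t *\<^sub>R y) - t * q y"
        using r by (simp add: field_simps)
    qed
    then show "tilt q y (r *\<^sub>R x) \<le> r * tilt q y x"
      using r by (simp add: field_simps)
  qed
qed

text \<open>Zorn's lemma applies because the values \<open>q x\<close> for \<open>q\<close> in a chain are bounded below by
  \<open>- p (- x)\<close>, so that the pointwise infimum of the chain exists; it is again sublinear.\<close>

lemma minimal_sublinear_exists:
  assumes p: "sublinear p"
  obtains m where "sublinear m" "m \<le> p" "\<And>q. sublinear q \<Longrightarrow> q \<le> m \<Longrightarrow> q = m"
proof -
  define A where "A = {q. sublinear q \<and> q \<le> p}"
  have "\<exists>m\<in>A. \<forall>q\<in>A. q \<le> m \<longrightarrow> q = m"
  proof (rule predicate_Zorn[where P = "\<lambda>a b. b \<le> a"])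
    show "partial_order_on A (relation_of (\<lambda>a b. b \<le> a) A)"
      by (rule partial_order_on_relation_ofI) auto
    fix C
    assume C: "C \<in> Chains (relation_of (\<lambda>a b. b \<le> a) A)"
    have CA: "C \<subseteq> A"
      by (rule Chains_relation_of[OF C])
    have ch: "a \<le> b \<or> b \<le> a" if "a \<in> C" "b \<in> C" for a b
      using C that by (auto simp: Chains_def relation_of_def)
    show "\<exists>u\<in>A. \<forall>a\<in>C. u \<le> a"
    proof (cases "C = {}")
      case True
      then show ?thesis
        using p by (auto simp: A_def)
    next
      case False
      define u where "u x = (INF q\<in>C. q x)" for x
      have lower: "- p (- x) \<le> q x" if "q \<in> C" for q x
      proof -
        have "q (- x) \<le> p (- x)" "sublinear q"
          using that CA by (auto simp: A_def le_fun_def)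
        then show ?thesis
          using sublinear_minus[of q x] by linarith
      qed
      have bdd: "bdd_below ((\<lambda>q. q x) ` C)" for x
        using lower by (rule bdd_belowI2)
      have le: "u x \<le> q x" if "q \<in> C" for q x
        unfolding u_def by (rule cINF_lower[OF bdd that])
      have ge: "c \<le> u x" if "\<And>q. q \<in> C \<Longrightarrow> c \<le> q x" for c x
        unfolding u_def by (rule cINF_greatest[OF False that])
      have sC: "sublinear q" if "q \<in> C" for q
        using that CA by (auto simp: A_def)
      have "sublinear u"
      proof (rule sublinearI)
        fix x y
        have 1: "u (x + y) \<le> a x + b y" if "a \<in> C" "b \<in> C" for a b
          using ch[OF that]
        proof
          assume "a \<le> b"
          then show ?thesis
            using le[OF that(1), of "x + y"] sublinear_add[OF sC[OF that(1)], of x y]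
            by (smt (verit) le_funD)
        next
          assume "b \<le> a"
          then show ?thesis
            using le[OF that(2), of "x + y"] sublinear_add[OF sC[OF that(2)], of x y]
            by (smt (verit) le_funD)
        qed
        have "u (x + y) - a x \<le> u y" if "a \<in> C" for a
          by (rule ge) (use 1[OF that] in fastforce)
        then have "u (x + y) - u y \<le> u x"
          by (intro ge) fastforce
        then show "u (x + y) \<le> u x + u y"
          by simp
      next
        obtain q where q: "q \<in> C"
          using False by blast
        have "u 0 \<le> 0"
          using le[OF q, of 0] sublinear_zero[OF sC[OF q]] by simp
        moreover have "0 \<le> u 0"
          by (rule ge) (simp add: sublinear_zero sC)
        ultimately show "u 0 = 0"
          by simp
      next
        fix r :: real and x
        assume r: "r > 0"
        have "(1 / r) * u (r *\<^sub>R x) \<le> u x"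
        proof (rule ge)
          fix q
          assume q: "q \<in> C"
          show "(1 / r) * u (r *\<^sub>R x) \<le> q x"
            using le[OF q, of "r *\<^sub>R x"] sublinear_scale[OF sC[OF q], of r x] r
            by (simp add: field_simps)
        qed
        then show "u (r *\<^sub>R x) \<le> r * u x"
          using r by (simp add: field_simps)
      qed
      moreover have "u \<le> p"
      proof (rule le_funI)
        fix x
        obtain q where q: "q \<in> C"
          using False by blast
        then have "q x \<le> p x"
          using CA by (auto simp: A_def le_fun_def)
        then show "u x \<le> p x"
          using le[OF q, of x] by linarith
      qed
      ultimately show ?thesis
        using le by (intro bexI[of _ u]) (auto simp: A_def le_fun_def)
    qed
  qed
  then obtain m where m: "sublinear m" "m \<le> p" "\<And>q. sublinear q \<Longrightarrow> q \<le> p \<Longrightarrow> q \<le> m \<Longrightarrow> q = m"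
    by (auto simp: A_def)
  then show ?thesis
    using that order_trans by meson
qed

text \<open>A minimal sublinear functional is linear. Minimizing below the tilt of \<open>p\<close> along \<open>a\<close> rather than
  below \<open>p\<close> forces \<open>f (- a) \<le> - p a\<close>, and therefore the value \<open>p a\<close> at \<open>a\<close>.\<close>

theorem Hahn_Banach_sublinear:
  fixes p :: "'a::real_vector \<Rightarrow> real" and a :: 'a
  assumes p: "sublinear p"
  obtains f where "linear f" "\<And>x. f x \<le> p x" "f a = p a"
proof -
  obtain f where f: "sublinear f" "f \<le> tilt p a"
    and min: "\<And>q. sublinear q \<Longrightarrow> q \<le> f \<Longrightarrow> q = f"
    using minimal_sublinear_exists[OF sublinear_tilt[OF p, of a]] by metis
  have tf: "tilt f y = f" for y
    using tilt_le[OF f(1), of 0] by (intro min sublinear_tilt f le_funI) simp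
  have add: "f (x + y) = f x + f y" for x y
    using tilt_le[OF f(1), of 1 y x] sublinear_add[OF f(1), of x y] by (simp add: tf)
  have neg: "f (- x) = - f x" for x
    using add[of x "- x"] sublinear_zero[OF f(1)] by simp
  have "linear f"
  proof (rule linearI)
    fix r x
    show "f (r *\<^sub>R x) = r *\<^sub>R f x"
    proof (cases "r \<ge> 0")
      case False
      then have "f ((- r) *\<^sub>R x) = (- r) * f x"
        by (intro sublinear_scale f) simp
      then show ?thesis
        using neg[of "r *\<^sub>R x"] by simp
    qed (simp add: sublinear_scale f)
  qed (rule add)
  moreover have fp: "f x \<le> p x" for x
    using le_funD[OF f(2), of x] tilt_le[OF p, of 0 a x] by simp
  moreover have "f (- a) \<le> - p a"
    using le_funD[OF f(2), of "- a"] tilt_le[OF p, of 1 a "- a"] sublinear_zero[OF p] by simp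
  then have "f a = p a"
    using fp[of a] neg[of a] by simp
  ultimately show ?thesis
    using that by blast
qed

corollary Hahn_Banach_norm:
  fixes a :: "'a::real_normed_vector"
  obtains f where "bounded_linear f" "\<And>x. \<bar>f x\<bar> \<le> norm x" "f a = norm a"
proof -
  have "sublinear (norm :: 'a \<Rightarrow> real)"
    by (auto simp: sublinear_def norm_triangle_ineq)
  then obtain f where f: "linear f" "\<And>x. f x \<le> norm x" "f a = norm a"
    by (rule Hahn_Banach_sublinear[where a = a]) blast
  have bd: "\<bar>f x\<bar> \<le> norm x" for x
    using f(2)[of x] f(2)[of "- x"] linear_neg[OF f(1), of x] by simp
  have "bounded_linear f"
    by (rule bounded_linear_intro[where K = 1])
      (use f bd in \<open>auto simp: linear_add linear_scale\<close>)
  then show ?thesis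
    using that bd f(3) by blast
qed

text \<open>One vector \<open>b\<close> is added at a time: a functional that does not vanish at \<open>y = b - P b\<close> extends the
  projection \<open>P\<close> by the direction \<open>y\<close>.\<close>

lemma finite_dim_projection:
  fixes B :: "'a::real_normed_vector set"
  assumes "finite B"
  shows "\<exists>P. bounded_linear P \<and> range P \<subseteq> span B \<and> (\<forall>x\<in>span B. P x = x)"
  using assms
proof (induction B)
  case empty
  show ?case
    by (intro exI[of _ "\<lambda>x. 0"]) (auto simp: bounded_linear_zero)
next
  case (insert b B)
  then obtain P where P: "bounded_linear P" "\<And>x. P x \<in> span B" "\<And>x. x \<in> span B \<Longrightarrow> P x = x"
    by (metis rangeI subsetD)
  interpret P: bounded_linear P by (rule P(1))
  have sub: "span B \<subseteq> span (insert b B)"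
    by (rule span_mono) blast
  define y where "y = b - P b"
  have y: "y \<in> span (insert b B)"
    unfolding y_def using subsetD[OF sub P(2)] by (intro span_diff) (auto intro: span_base)
  have Py: "P y = 0"
    using P by (simp add: y_def P.diff)
  show ?case
  proof (cases "y = 0")
    case True
    then have "b \<in> span B"
      using P(2)[of b] by (simp add: y_def)
    then have "span (insert b B) = span B"
      by (rule span_redundant)
    then show ?thesis
      using P by auto
  next
    case False
    obtain f where f: "bounded_linear f" "f y = norm y"
      using Hahn_Banach_norm by blast
    interpret f: bounded_linear f by (rule f(1))
    define Q where "Q x = P x + (f (x - P x) / norm y) *\<^sub>R y" for x
    have "bounded_linear (\<lambda>x. x - P x)"
      by (intro bounded_linear_sub bounded_linear_ident P)
    then have "bounded_linear (\<lambda>x. f (x - P x) / norm y)"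
      using bounded_linear_compose[OF bounded_linear_divide
          bounded_linear_compose[OF f(1)]] by blast
    then have "bounded_linear Q"
      unfolding Q_def
      by (intro bounded_linear_add P bounded_linear_compose[OF bounded_linear_scaleR_left])
    moreover have "Q x \<in> span (insert b B)" for x
      unfolding Q_def using y subsetD[OF sub P(2)] by (intro span_add span_scale) auto
    moreover have "Q x = x" if x: "x \<in> span (insert b B)" for x
    proof -
      obtain k where k: "x - k *\<^sub>R b \<in> span B"
        using x span_breakdown_eq by blast
      define v where "v = x - k *\<^sub>R b + k *\<^sub>R P b"
      have xv: "x = v + k *\<^sub>R y"
        by (simp add: v_def y_def algebra_simps)
      have "v \<in> span B"
        unfolding v_def using k P(2) by (intro span_add span_scale) auto
      then have "P x = v"
        using P(3) Py by (simp add: xv P.add P.scaleR)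
      then show ?thesis
        using False by (simp add: Q_def xv f.scaleR f(2))
    qed
    ultimately show ?thesis
      by blast
  qed
qed

section \<open>Complex structures on real Banach spaces\<close>

text \<open>Complex scalar multiplication is a parameter here because two kinds of multiplication are used: the
  one of the type class, and the one on pairs that is conjugated in the second component.\<close>

locale complex_structure =
  fixes s :: "complex \<Rightarrow> 'a::banach \<Rightarrow> 'a"
  assumes add_right: "s c (x + y) = s c x + s c y"
    and add_left: "s (b + c) x = s b x + s c x"
    and assoc: "s b (s c x) = s (b * c) x"
    and of_real: "s (complex_of_real r) x = r *\<^sub>R x"
    and norm_s: "norm (s c x) = cmod c * norm x"
begin

sublocale C: vector_space s
  by unfold_locales (use of_real[of 1] in \<open>simp_all add: add_right add_left assoc\<close>)

lemma decompose: "s c x = Re c *\<^sub>R x + Im c *\<^sub>R s \<i> x"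
proof -
  have "s c x = s (complex_of_real (Re c) + complex_of_real (Im c) * \<i>) x"
    by (simp add: complex_eq_iff)
  also have "\<dots> = Re c *\<^sub>R x + Im c *\<^sub>R s \<i> x"
    by (simp only: add_left assoc[symmetric] of_real)
  finally show ?thesis .
qed

lemma i_i: "s \<i> (s \<i> x) = - x"
  by (simp add: assoc decompose[of "-1"])

lemma scaleR_s: "r *\<^sub>R s c x = s c (r *\<^sub>R x)"
  by (simp add: of_real[symmetric] assoc mult.commute)

lemma bounded_linear_s: "bounded_linear (s c)"
  by (rule bounded_linear_intro[where K = "cmod c"])
    (simp_all add: add_right scaleR_s norm_s mult.commute)

lemma bounded_linear_s_left: "bounded_linear (\<lambda>c. s c x)"
  by (rule bounded_linear_intro[where K = "norm x"])
    (simp_all add: add_left norm_s of_real[symmetric] assoc scaleR_conv_of_real)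

lemma subspace_complex_iff: "C.subspace S \<longleftrightarrow> subspace S \<and> (\<forall>x\<in>S. s \<i> x \<in> S)"
proof
  assume S: "C.subspace S"
  show "subspace S \<and> (\<forall>x\<in>S. s \<i> x \<in> S)"
    using C.subspace_scale[OF S] C.subspace_add[OF S] C.subspace_0[OF S]
    by (auto simp: subspace_def of_real[symmetric])
next
  assume S: "subspace S \<and> (\<forall>x\<in>S. s \<i> x \<in> S)"
  then have "s c x \<in> S" if "x \<in> S" for c x
    using that by (subst decompose) (simp add: subspace_add subspace_scale)
  then show "C.subspace S"
    using S by (simp add: C.subspace_def subspace_0 subspace_add)
qed

lemma span_complex: "C.span B = span (B \<union> s \<i> ` B)"
proof
  have "s \<i> x \<in> span (B \<union> s \<i> ` B)" if "x \<in> span (B \<union> s \<i> ` B)" for x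
    using that
  proof (induction rule: span_induct_alt)
    case base
    show ?case
      using C.scale_zero_right[of \<i>] span_zero by simp
  next
    case (step c x y)
    from step(1) have "s \<i> x \<in> span (B \<union> s \<i> ` B)"
      by (auto simp: i_i intro!: span_neg intro: span_base)
    then show ?case
      using step by (auto simp: add_right scaleR_s[symmetric] intro!: span_add span_scale)
  qed
  then show "C.span B \<subseteq> span (B \<union> s \<i> ` B)"
    by (intro C.span_minimal) (auto simp: subspace_complex_iff intro: span_base)
  have "subspace (C.span B)"
    using C.subspace_span[of B] by (simp add: subspace_complex_iff)
  then show "span (B \<union> s \<i> ` B) \<subseteq> C.span B"
    by (intro span_minimal) (auto intro: C.span_base C.span_scale)
qed

lemma finite_span_complex:
  assumes "finite B"
  obtains B' where "finite B'" "C.span B = span B'"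
  using that[of "B \<union> s \<i> ` B"] assms span_complex by simp

lemma span_subset_complex: "span B \<subseteq> C.span B"
  by (metis span_complex span_mono sup_ge1)

end

lemma (in vector_space) finite_dimI:
  assumes "subspace S" "finite B" "S \<subseteq> span B"
  shows "finite_dim scale S"
proof -
  obtain C where C: "C \<subseteq> S" "independent C" "S \<subseteq> span C"
    by (rule maximal_independent_subset)
  then have "finite C"
    using independent_span_bound[OF assms(2)] assms(3) by blast
  moreover have "span C = S"
    using C assms(1) span_minimal by blast
  ultimately show ?thesis
    unfolding finite_dim_def by blast
qed

lemma finite_dim_scaleR_iff: "finite_dim scaleR S \<longleftrightarrow> (\<exists>B. finite B \<and> span B = S)"
  by (simp add: finite_dim_def span_raw_def)

lemma finite_dim_scaleRI: "subspace S \<Longrightarrow> finite B \<Longrightarrow> S \<subseteq> span B \<Longrightarrow> finite_dim scaleR S"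
  using real_vector.finite_dimI[of S B] by (simp add: span_raw_def subspace_raw_def)

lemma finite_codim_iff:
  "finite_codim s S \<longleftrightarrow> (\<exists>B. finite B \<and> (\<forall>z. \<exists>x\<in>S. \<exists>y\<in>module.span s B. z = x + y))"
proof -
  have "{x + y |x y. x \<in> S \<and> y \<in> V} = UNIV \<longleftrightarrow> (\<forall>z. \<exists>x\<in>S. \<exists>y\<in>V. z = x + y)" for V
    by blast
  then show ?thesis
    by (simp add: finite_codim_def)
qed

lemma finite_codim_scaleR_iff:
  "finite_codim scaleR S \<longleftrightarrow> (\<exists>B. finite B \<and> (\<forall>z. \<exists>x\<in>S. \<exists>y\<in>span B. z = x + y))"
  by (simp add: finite_codim_iff span_raw_def)

context complex_structure
begin

lemma finite_dim_complex_iff: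
  assumes S: "C.subspace S"
  shows "finite_dim s S \<longleftrightarrow> finite_dim scaleR S"
proof
  assume "finite_dim s S"
  then show "finite_dim scaleR S"
    unfolding finite_dim_scaleR_iff by (metis finite_dim_def finite_span_complex)
next
  assume "finite_dim scaleR S"
  then obtain B where "finite B" "span B = S"
    by (auto simp: finite_dim_scaleR_iff)
  then show "finite_dim s S"
    using span_subset_complex by (intro C.finite_dimI[OF S]) auto
qed

lemma finite_codim_complex_iff: "finite_codim s S \<longleftrightarrow> finite_codim scaleR S"
proof
  assume "finite_codim s S"
  then obtain B where B: "finite B" "\<forall>z. \<exists>x\<in>S. \<exists>y\<in>C.span B. z = x + y"
    by (auto simp: finite_codim_iff)
  moreover obtain B' where "finite B'" "C.span B = span B'"
    by (rule finite_span_complex[OF B(1)])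
  ultimately show "finite_codim scaleR S"
    by (auto simp: finite_codim_scaleR_iff)
next
  assume "finite_codim scaleR S"
  then obtain B where B: "finite B" "\<forall>z. \<exists>x\<in>S. \<exists>y\<in>span B. z = x + y"
    by (auto simp: finite_codim_scaleR_iff)
  have "\<exists>x\<in>S. \<exists>y\<in>C.span B. z = x + y" for z
    using B(2) span_subset_complex[of B] by blast
  with B(1) show "finite_codim s S"
    by (auto simp: finite_codim_iff)
qed

text \<open>The complex linear functional with real part \<open>f\<close> is \<open>f v - \<i> f (\<i> v)\<close>.\<close>

lemma complex_functional_of_real:
  assumes f: "bounded_linear f" and K: "\<And>v. \<bar>f v\<bar> \<le> K * norm v"
  obtains g where "bounded_linear g" "\<And>c v. g (s c v) = c * g v"
    "\<And>v. Re (g v) = f v" "\<And>v. Im (g v) = - f (s \<i> v)" "\<And>v. cmod (g v) \<le> 2 * K * norm v"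
proof
  interpret f: bounded_linear f by (rule f)
  define g where "g v = Complex (f v) (- f (s \<i> v))" for v
  have bd: "cmod (g v) \<le> 2 * K * norm v" for v
    using K[of v] K[of "s \<i> v"] cmod_le[of "g v"] by (simp add: g_def norm_s)
  have mult: "g (s c v) = c * g v" for c v
  proof -
    have "f (s c v) = Re c * f v + Im c * f (s \<i> v)" for c
      by (subst decompose) (simp add: f.add f.scaleR)
    from this[of c] this[of "\<i> * c"] show ?thesis
      by (simp add: g_def complex_eq_iff)
  qed
  have "g (r *\<^sub>R v) = r *\<^sub>R g v" for r v
    by (metis mult of_real scaleR_conv_of_real)
  moreover have "g (v + w) = g v + g w" for v w
    by (simp add: g_def f.add add_right complex_eq_iff)
  ultimately show "bounded_linear g"
    using bd by (intro bounded_linear_intro[where K = "2 * K"]) (simp_all add: mult.commute)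
  show "\<And>c v. g (s c v) = c * g v" "\<And>v. cmod (g v) \<le> 2 * K * norm v"
    "\<And>v. Re (g v) = f v" "\<And>v. Im (g v) = - f (s \<i> v)"
    by (simp_all add: mult bd) (simp_all add: g_def)
qed

text \<open>The complexified norming functional of \<open>x\<close> is divided by its value at \<open>x\<close>, which has modulus at
  least \<open>norm x\<close>.\<close>

lemma complex_coordinate_functional:
  assumes x: "x \<noteq> 0"
  obtains g where "bounded_linear g" "\<And>c v. g (s c v) = c * g v" "g x = 1"
    "\<And>v. cmod (g v) \<le> 2 * norm v / norm x"
proof -
  obtain f where f: "bounded_linear f" "\<And>v. \<bar>f v\<bar> \<le> norm v" "f x = norm x"
    using Hahn_Banach_norm by blast
  then have "\<bar>f v\<bar> \<le> 1 * norm v" for v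
    by simp
  from complex_functional_of_real[OF f(1) this]
  obtain g where g: "bounded_linear g" "\<And>c v. g (s c v) = c * g v"
    "\<And>v. Re (g v) = f v" "\<And>v. Im (g v) = - f (s \<i> v)" "\<And>v. cmod (g v) \<le> 2 * 1 * norm v"
    by blast
  have gx: "norm x \<le> cmod (g x)"
    using complex_Re_le_cmod[of "g x"] g(3)[of x] f(3) by simp
  have nx: "norm x > 0"
    using x by simp
  then have gx0: "g x \<noteq> 0"
    using gx by auto
  show ?thesis
  proof
    show "bounded_linear (\<lambda>v. g v / g x)"
      by (rule bounded_linear_compose[OF bounded_linear_divide g(1)])
    show "cmod (g v / g x) \<le> 2 * norm v / norm x" for v
    proof -
      have "cmod (g v) / cmod (g x) \<le> (2 * norm v) / norm x"
        by (rule frac_le) (use g(5) gx nx in auto)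
      then show ?thesis
        by (simp add: norm_divide)
    qed
  qed (use g(2) gx0 in auto)
qed

end

lemma complex_structure_scaleC: "complex_structure (scaleC :: complex \<Rightarrow> 'a::complex_banach \<Rightarrow> 'a)"
  by unfold_locales
    (simp_all add: scaleC_add_right scaleC_add_left scaleC_scaleC scaleC_of_real norm_scaleC)

lemma ii_scaleC: "\<i> *\<^sub>C \<i> *\<^sub>C x = - x"
  using complex_structure.i_i[OF complex_structure_scaleC] .

lemma minus_scaleC: "(- c) *\<^sub>C x = - (c *\<^sub>C x)" "c *\<^sub>C (- x) = - (c *\<^sub>C x)"
  "c *\<^sub>C (x - y) = c *\<^sub>C x - c *\<^sub>C y" "c *\<^sub>C (0 :: 'a) = 0"
  for x y :: "'a::complex_banach"
proof -
  interpret vector_space "scaleC :: complex \<Rightarrow> 'a \<Rightarrow> 'a"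
    by (rule vector_space_scaleC)
  show "(- c) *\<^sub>C x = - (c *\<^sub>C x)" "c *\<^sub>C (- x) = - (c *\<^sub>C x)"
    "c *\<^sub>C (x - y) = c *\<^sub>C x - c *\<^sub>C y" "c *\<^sub>C (0 :: 'a) = 0"
    by (simp_all add: scale_minus_left scale_minus_right scale_right_diff_distrib)
qed

lemma scaleC_scaleR: "c *\<^sub>C (r *\<^sub>R x) = r *\<^sub>R (c *\<^sub>C x)"
  using complex_structure.scaleR_s[OF complex_structure_scaleC] by metis

lemma bounded_linear_scaleC: "bounded_linear (scaleC c :: 'a \<Rightarrow> 'a::complex_banach)"
  using complex_structure.bounded_linear_s[OF complex_structure_scaleC] .

lemma linear_complex_iff:
  assumes "complex_structure s1" "complex_structure s2"
  shows "Vector_Spaces.linear s1 s2 f \<longleftrightarrow> linear f \<and> (\<forall>x. f (s1 \<i> x) = s2 \<i> (f x))"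
proof -
  interpret c1: complex_structure s1 by (rule assms)
  interpret c2: complex_structure s2 by (rule assms)
  have "Vector_Spaces.linear s1 s2 f \<longleftrightarrow>
      (\<forall>x y. f (x + y) = f x + f y) \<and> (\<forall>c x. f (s1 c x) = s2 c (f x))"
    by (simp add: Vector_Spaces.linear_def module_hom_def module_hom_axioms_def
        c1.C.vector_space_axioms c2.C.vector_space_axioms c1.C.module_axioms c2.C.module_axioms)
  also have "\<dots> \<longleftrightarrow> linear f \<and> (\<forall>x. f (s1 \<i> x) = s2 \<i> (f x))" (is "?l \<longleftrightarrow> ?r")
  proof
    assume ?l
    then show ?r
      by (auto intro!: linearI simp: c1.of_real[symmetric] c2.of_real[symmetric])
  next
    assume r: ?r
    then have "f (s1 c x) = s2 c (f x)" for c x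
      by (simp add: c1.decompose[of c] c2.decompose[of c] linear_add linear_scale)
    with r show ?l
      by (simp add: linear_add)
  qed
  finally show ?thesis .
qed

text \<open>This is the form in which complex operators are handled: as real operators that commute with
  multiplication by \<open>\<i>\<close>.\<close>

lemma bounded_op_complex_iff:
  assumes "complex_structure s1" "complex_structure s2"
  shows "bounded_op s1 s2 f \<longleftrightarrow> bounded_linear f \<and> (\<forall>x. f (s1 \<i> x) = s2 \<i> (f x))"
  unfolding bounded_op_def linear_complex_iff[OF assms] bounded_linear_def
    bounded_linear_axioms_def
  by auto

section \<open>Increasing chains of projections\<close>

text \<open>The subspaces of infinite dimension or codimension below arise as limits of increasing sequences of
  projections of finite rank. Independent sets of any size in the ranges witness that the limit is
  infinite.\<close>

lemma (in vector_space) independent_in_projection_chain: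
  assumes lin: "\<And>n. Vector_Spaces.linear scale scale (P n)"
    and chain: "\<And>n x. P (Suc n) (P n x) = P n x"
    and strict: "\<And>n. \<exists>x. P (Suc n) x = x \<and> P n x \<noteq> x"
    and idem: "\<And>n x. P n (P n x) = P n x"
  shows "\<exists>C. C \<subseteq> range (P n) \<and> independent C \<and> finite C \<and> card C = n"
proof (induction n)
  case 0
  show ?case
    by (intro exI[of _ "{}"]) (simp add: independent_empty)
next
  case (Suc n)
  then obtain C where C: "C \<subseteq> range (P n)" "independent C" "finite C" "card C = n"
    by blast
  interpret Pn: Vector_Spaces.linear scale scale "P n" by (rule lin)
  obtain x where x: "P (Suc n) x = x" "P n x \<noteq> x"
    using strict by blast
  have "span C \<subseteq> range (P n)"
    by (rule span_minimal[OF C(1)]) (rule Pn.subspace_image[OF subspace_UNIV])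
  then have "x \<notin> span C"
    using x idem by auto
  then have "independent (insert x C)" "x \<notin> C"
    using C independent_insertI span_base by auto
  moreover have "insert x C \<subseteq> range (P (Suc n))"
  proof
    fix y
    assume "y \<in> insert x C"
    then have "P (Suc n) y = y"
      using C(1) chain x(1) by auto
    then show "y \<in> range (P (Suc n))"
      by (metis rangeI)
  qed
  ultimately show ?case
    using C by (intro exI[of _ "insert x C"]) auto
qed

section \<open>Pairs in a space and its conjugate\<close>

text \<open>The complex structure of the direct sum of a space and its conjugate.\<close>

definition conj_pair_scale :: "complex \<Rightarrow> 'a::complex_banach \<times> 'a \<Rightarrow> 'a \<times> 'a"
  where "conj_pair_scale c x = (c *\<^sub>C fst x, cnj c *\<^sub>C snd x)"

lemma complex_structure_conj_pair: "complex_structure conj_pair_scale"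
proof
  show "norm (conj_pair_scale c x) = cmod c * norm x" for c and x :: "'a \<times> 'a"
  proof -
    have "norm (conj_pair_scale c x) = sqrt ((cmod c)\<^sup>2 * ((norm (fst x))\<^sup>2 + (norm (snd x))\<^sup>2))"
      by (simp add: conj_pair_scale_def norm_Pair norm_scaleC power_mult_distrib distrib_left)
    then show ?thesis
      by (simp add: real_sqrt_mult norm_prod_def)
  qed
qed (simp_all add: conj_pair_scale_def scaleC_add_right scaleC_add_left scaleC_scaleC
    scaleC_of_real prod_eq_iff)

text \<open>With \<open>u = s + \<i> s'\<close> and \<open>v = s - \<i> s'\<close>, both \<open>u + v = 2 s\<close> and \<open>\<i> (u - v) = - 2 s'\<close> are multiples of
  \<open>s\<close> and \<open>s'\<close>; so this is the complexification of the real subspace \<open>S\<close>, embedded in the direct sum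
  of the space and its conjugate. It is also the kernel of the natural complex linear map from that
  direct sum onto the complexification of the quotient by \<open>S\<close>. The description by conditions shows
  that it is closed if \<open>S\<close> is.\<close>

definition conj_pairs :: "'a::complex_banach set \<Rightarrow> ('a \<times> 'a) set"
  where "conj_pairs S = {(u, v). u + v \<in> S \<and> \<i> *\<^sub>C (u - v) \<in> S}"

lemma
  assumes S: "subspace S"
  shows subspace_conj_pairs: "module.subspace conj_pair_scale (conj_pairs S)"
    and closed_conj_pairs: "closed S \<Longrightarrow> closed (conj_pairs S)"
proof -
  interpret complex_structure "conj_pair_scale :: complex \<Rightarrow> 'a \<times> 'a \<Rightarrow> _"
    by (rule complex_structure_conj_pair)
  interpret Y: complex_structure "scaleC :: complex \<Rightarrow> 'a \<Rightarrow> 'a"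
    by (rule complex_structure_scaleC)
  have i: "conj_pair_scale \<i> x \<in> conj_pairs S" if x: "x \<in> conj_pairs S" for x
  proof -
    have "- (fst x + snd x) \<in> S"
      using x S by (intro subspace_neg) (auto simp: conj_pairs_def)
    then show ?thesis
      using x by (auto simp: conj_pairs_def conj_pair_scale_def minus_scaleC scaleC_add_right ii_scaleC)
  qed
  have "subspace (conj_pairs S)"
    unfolding subspace_def
  proof (intro conjI ballI allI)
    show "0 \<in> conj_pairs S"
      using S by (simp add: conj_pairs_def zero_prod_def minus_scaleC subspace_0)
  next
    fix x y
    assume "x \<in> conj_pairs S" "y \<in> conj_pairs S"
    then have "(fst x + snd x) + (fst y + snd y) \<in> S"
      "\<i> *\<^sub>C (fst x - snd x) + \<i> *\<^sub>C (fst y - snd y) \<in> S"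
      using S by (auto simp: conj_pairs_def subspace_add)
    then show "x + y \<in> conj_pairs S"
      by (simp add: conj_pairs_def case_prod_beta scaleC_add_right minus_scaleC algebra_simps)
  next
    fix r x
    assume "x \<in> conj_pairs S"
    then have "r *\<^sub>R (fst x + snd x) \<in> S" "r *\<^sub>R (\<i> *\<^sub>C (fst x - snd x)) \<in> S"
      using S by (auto simp: conj_pairs_def subspace_scale)
    then show "r *\<^sub>R x \<in> conj_pairs S"
      by (simp add: conj_pairs_def case_prod_beta Y.scaleR_s scaleR_right_distrib scaleR_right_diff_distrib)
  qed
  with i show "C.subspace (conj_pairs S)"
    by (auto simp: subspace_complex_iff)
  assume cl: "closed S"
  have eq: "conj_pairs S = (\<lambda>x. fst x + snd x) -` S \<inter> (\<lambda>x. \<i> *\<^sub>C (fst x - snd x)) -` S"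
    by (auto simp: conj_pairs_def)
  show "closed (conj_pairs S)"
    unfolding eq
    by (intro closed_Int continuous_closed_vimage cl continuous_intros
        bounded_linear.continuous[OF Y.bounded_linear_s])
qed

section \<open>Strictly singular operators\<close>

lemma (in complex_structure) subspace_closure_complex:
  assumes S: "C.subspace S"
  shows "C.subspace (closure S)"
proof (rule C.subspaceI)
  show "0 \<in> closure S"
    using C.subspace_0[OF S] closure_subset by blast
next
  fix x y
  assume "x \<in> closure S" "y \<in> closure S"
  then obtain u v where u: "\<And>n. u n \<in> S" "u \<longlonglongrightarrow> x" and v: "\<And>n. v n \<in> S" "v \<longlonglongrightarrow> y"
    unfolding closure_sequential by metis
  have "(\<lambda>n. u n + v n) \<longlonglongrightarrow> x + y"
    by (rule tendsto_add[OF u(2) v(2)])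
  then show "x + y \<in> closure S"
    unfolding closure_sequential using C.subspace_add[OF S] u(1) v(1)
    by (intro exI[of _ "\<lambda>n. u n + v n"]) simp
next
  fix c x
  assume "x \<in> closure S"
  then obtain u where u: "\<And>n. u n \<in> S" "u \<longlonglongrightarrow> x"
    unfolding closure_sequential by metis
  have "(\<lambda>n. s c (u n)) \<longlonglongrightarrow> s c x"
    by (rule bounded_linear.tendsto[OF bounded_linear_s u(2)])
  then show "s c x \<in> closure S"
    unfolding closure_sequential using C.subspace_scale[OF S] u(1)
    by (intro exI[of _ "\<lambda>n. s c (u n)"]) simp
qed

lemma (in complex_structure) linear_if_bounded_linear:
  assumes "bounded_linear P" "\<And>c x. P (s c x) = s c (P x)"
  shows "Vector_Spaces.linear s s P"
  using linear_complex_iff[OF complex_structure_axioms complex_structure_axioms, of P]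
    bounded_linear.linear[OF assms(1)] assms(2) by blast

text \<open>The subspace is the closure of the union of the ranges of an increasing sequence of projections \<open>P\<^sub>n\<close>
  of finite rank. The next range is obtained by adding a vector \<open>x\<close> of the kernel of \<open>P\<^sub>n\<close>:
  \<open>P\<^sub>n\<^sub>+\<^sub>1 v = P\<^sub>n v + g (v - P\<^sub>n v) x\<close>, where \<open>g\<close> is a functional with \<open>g x = 1\<close>. The norm of
  \<open>v \<mapsto> g (v - P\<^sub>n v) x\<close> is controlled by \<open>P\<^sub>n\<close> alone, so \<open>x\<close> can afterwards be chosen with
  \<open>A x\<close> so small that \<open>norm (A (P\<^sub>n v)) \<le> \<epsilon> (1 - 2\<^sup>-\<^sup>n) norm v\<close> persists.\<close>

lemma (in complex_structure) exists_subspace_with_small_norm: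
  fixes A :: "'a \<Rightarrow> 'b::real_normed_vector"
  assumes A: "bounded_linear A" and hom: "\<And>c x. norm (A (s c x)) = cmod c * norm (A x)"
    and D: "C.subspace D" "closed D" "\<not> finite_dim s D"
    and small: "\<And>N \<delta>. C.subspace N \<Longrightarrow> closed N \<Longrightarrow> N \<subseteq> D \<Longrightarrow> \<not> finite_dim s N \<Longrightarrow> \<delta> > 0 \<Longrightarrow>
      \<exists>x\<in>N. norm (A x) < \<delta> * norm x"
    and \<epsilon>: "\<epsilon> > 0"
  obtains M where "C.subspace M" "closed M" "M \<subseteq> D" "\<not> finite_dim s M"
    "\<And>x. x \<in> M \<Longrightarrow> norm (A x) \<le> \<epsilon> * norm x"
proof -
  interpret A: bounded_linear A by (rule A)
  define good where "good n P \<longleftrightarrow> bounded_linear P \<and> (\<forall>c x. P (s c x) = s c (P x)) \<and>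
    (\<forall>x. P (P x) = P x) \<and> range P \<subseteq> D \<and> (\<exists>B. finite B \<and> range P \<subseteq> C.span B) \<and>
    (\<forall>v. norm (A (P v)) \<le> \<epsilon> * (1 - (1/2)^n) * norm v)" for n and P :: "'a \<Rightarrow> 'a"
  define ext where "ext P P' \<longleftrightarrow> (\<forall>x. P' (P x) = P x) \<and> (\<exists>x. P' x = x \<and> P x \<noteq> x)"
    for P P' :: "'a \<Rightarrow> 'a"
  have step: "\<exists>P'. good (Suc n) P' \<and> ext P P'" if P: "good n P" for P n
  proof -
    have Pl: "bounded_linear P" and Ps: "\<And>c x. P (s c x) = s c (P x)"
      and PP: "\<And>x. P (P x) = P x" and PD: "\<And>x. P x \<in> D"
      and Psmall: "\<And>v. norm (A (P v)) \<le> \<epsilon> * (1 - (1/2)^n) * norm v"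
      using P by (auto simp: good_def)
    obtain B where B: "finite B" "\<And>x. P x \<in> C.span B"
      using P unfolding good_def by (metis rangeI subsetD)
    interpret P: bounded_linear P by (rule Pl)
    define N where "N = D \<inter> {x. P x = 0}"
    have subN: "C.subspace N"
      using D(1) by (auto simp: N_def C.subspace_def P.zero P.add Ps)
    have clN: "closed N"
      unfolding N_def by (intro closed_Int D closed_Collect_eq P.continuous_on continuous_on_id continuous_on_const)
    have infN: "\<not> finite_dim s N"
    proof
      assume "finite_dim s N"
      then obtain B' where B': "finite B'" "C.span B' = N"
        by (auto simp: finite_dim_def)
      have "D \<subseteq> C.span (B' \<union> B)"
      proof
        fix x
        assume x: "x \<in> D"
        have "x - P x \<in> C.span B'"
          unfolding B' N_def using x PD PP C.subspace_diff[OF D(1)] by (simp add: P.diff)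
        then have "(x - P x) + P x \<in> C.span (B' \<union> B)"
          using B(2)[of x] C.span_mono[of B' "B' \<union> B"] C.span_mono[of B "B' \<union> B"]
          by (intro C.span_add) auto
        then show "x \<in> C.span (B' \<union> B)"
          by simp
      qed
      then have "finite_dim s D"
        using B(1) B'(1) by (intro C.finite_dimI[OF D(1)]) auto
      with D(3) show False
        by blast
    qed
    obtain K where K: "K > 0" "\<And>x. norm (P x) \<le> norm x * K"
      using P.pos_bounded by blast
    \<comment> \<open>For \<open>g\<close> below, \<open>v \<mapsto> g (v - P v)\<close> has norm at most \<open>2 (1 + K) / norm x\<close>.\<close>
    define \<delta> where "\<delta> = \<epsilon> * (1/2)^(Suc n) / (2 * (1 + K))"
    have "\<delta> > 0"
      using \<epsilon> K by (simp add: \<delta>_def)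
    then obtain x where x: "x \<in> N" "norm (A x) < \<delta> * norm x"
      using small[OF subN clN _ infN] by (auto simp: N_def)
    then have x0: "x \<noteq> 0"
      by auto
    have Px: "P x = 0" and xD: "x \<in> D"
      using x by (auto simp: N_def)
    obtain g where g: "bounded_linear g" "\<And>c v. g (s c v) = c * g v" "g x = 1"
      "\<And>v. cmod (g v) \<le> 2 * norm v / norm x"
      by (rule complex_coordinate_functional[OF x0]) blast
    interpret g: bounded_linear g by (rule g(1))
    define P' where "P' v = P v + s (g (v - P v)) x" for v
    have P'x: "P' x = x"
      using of_real[of 1 x] by (simp add: P'_def Px g)
    have P'P: "P' (P v) = P v" for v
      by (simp add: P'_def PP g.zero)
    have "bounded_linear (\<lambda>v. v - P v)"
      by (intro bounded_linear_sub bounded_linear_ident Pl)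
    then have "bounded_linear P'"
      unfolding P'_def
      by (intro bounded_linear_add Pl bounded_linear_compose[OF bounded_linear_s_left]
          bounded_linear_compose[OF g(1)])
    then interpret P': bounded_linear P' .
    have P's: "P' (s c v) = s c (P' v)" for c v
    proof -
      have "s c v - P (s c v) = s c (v - P v)"
        by (simp add: Ps C.scale_right_diff_distrib)
      then show ?thesis
        by (simp add: P'_def g(2) Ps add_right)
    qed
    have P'P': "P' (P' v) = P' v" for v
      using P'P P'x by (simp add: P'_def[of v] P'.add P's)
    have P'D: "P' v \<in> D" for v
      unfolding P'_def by (intro C.subspace_add[OF D(1)] C.subspace_scale[OF D(1)] PD xD)
    have P'B: "P' v \<in> C.span (insert x B)" for v
      unfolding P'_def using B(2)[of v] C.span_mono[of B "insert x B"]
      by (intro C.span_add C.span_scale) (auto intro: C.span_base)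
    have "norm (A (P' v)) \<le> \<epsilon> * (1 - (1/2)^(Suc n)) * norm v" for v
    proof -
      have "norm (v - P v) \<le> (1 + K) * norm v"
        using norm_triangle_ineq4[of v "P v"] K(2)[of v] by (simp add: algebra_simps)
      then have "cmod (g (v - P v)) \<le> 2 * ((1 + K) * norm v) / norm x"
        using g(4)[of "v - P v"] x0 by (smt (verit) divide_right_mono norm_ge_zero)
      then have "cmod (g (v - P v)) * norm (A x) \<le>
          (2 * ((1 + K) * norm v) / norm x) * (\<delta> * norm x)"
        using x(2) K by (intro mult_mono) auto
      also have "\<dots> = \<epsilon> * (1/2)^(Suc n) * norm v"
      proof -
        have "(2 * ((1 + K) * norm v) / norm x) * (\<delta> * norm x) = (2 * (1 + K)) * \<delta> * norm v"
          using x0 by simp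
        moreover have "(2 * (1 + K)) * \<delta> = \<epsilon> * (1/2)^(Suc n)"
          unfolding \<delta>_def times_divide_eq_right
          by (rule nonzero_mult_div_cancel_left) (use K in simp)
        ultimately show ?thesis
          by simp
      qed
      finally have "norm (A (s (g (v - P v)) x)) \<le> \<epsilon> * (1/2)^(Suc n) * norm v"
        by (simp add: hom)
      moreover have "norm (A (P' v)) \<le> norm (A (P v)) + norm (A (s (g (v - P v)) x))"
        unfolding P'_def A.add by (rule norm_triangle_ineq)
      ultimately have "norm (A (P' v)) \<le>
          \<epsilon> * (1 - (1/2)^n) * norm v + \<epsilon> * (1/2)^(Suc n) * norm v"
        using Psmall[of v] by linarith
      also have "\<dots> = \<epsilon> * (1 - (1/2)^(Suc n)) * norm v"
        by (simp add: algebra_simps)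
      finally show ?thesis .
    qed
    then have "good (Suc n) P'"
      unfolding good_def using \<open>bounded_linear P'\<close> P's P'P' P'D P'B B(1)
      by (auto intro!: exI[of _ "insert x B"])
    moreover have "ext P P'"
      unfolding ext_def using P'P P'x Px x0 by metis
    ultimately show ?thesis
      by blast
  qed
  have good0: "good 0 (\<lambda>x. 0)"
    unfolding good_def using C.subspace_0[OF D(1)]
    by (auto simp: bounded_linear_zero A.zero intro!: exI[of _ "{}"])
  obtain Q where "\<And>n. good n (Q n) \<and> ext (Q n) (Q (Suc n))"
    using dependent_nat_choice[of good "\<lambda>n. ext"] good0 step by metis
  then have good: "good n (Q n)" and ext: "ext (Q n) (Q (Suc n))" for n
    by auto
  have Ql: "bounded_linear (Q n)" and Qs: "Q n (s c x) = s c (Q n x)"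
    and QQ: "Q n (Q n x) = Q n x" and QD: "Q n x \<in> D"
    and Qsmall: "norm (A (Q n x)) \<le> \<epsilon> * (1 - (1/2)^n) * norm x" for n c x
    using good[of n] by (auto simp: good_def)
  have chain: "Q (Suc n) (Q n x) = Q n x" and strict: "\<exists>x. Q (Suc n) x = x \<and> Q n x \<noteq> x" for n x
    using ext[of n] by (auto simp: ext_def)
  have chain_le: "Q m (Q n x) = Q n x" if "n \<le> m" for n m x
    using that
  proof (induction m rule: dec_induct)
    case base
    show ?case
      by (rule QQ)
  next
    case (step k)
    then show ?case
      using chain[of k "Q n x"] by simp
  qed
  define R where "R = (\<Union>n. range (Q n))"
  have R_iff: "x \<in> R \<longleftrightarrow> (\<exists>n. Q n x = x)" for x
    unfolding R_def using QQ by (auto simp: image_iff) metis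
  have subR: "C.subspace R"
  proof (rule C.subspaceI)
    show "0 \<in> R"
      using linear_0[OF bounded_linear.linear[OF Ql]] by (auto simp: R_iff)
  next
    fix x y
    assume "x \<in> R" "y \<in> R"
    then obtain m n where "Q m x = x" "Q n y = y"
      by (auto simp: R_iff)
    then have "Q (max m n) x = x" "Q (max m n) y = y"
      using chain_le[of m "max m n" x] chain_le[of n "max m n" y] by simp_all
    then have "Q (max m n) (x + y) = x + y"
      by (simp add: linear_add[OF bounded_linear.linear[OF Ql]])
    then show "x + y \<in> R"
      by (auto simp: R_iff)
  next
    fix c x
    assume "x \<in> R"
    then show "s c x \<in> R"
      by (auto simp: R_iff Qs)
  qed
  define M where "M = closure R"
  have "C.subspace M" "closed M"
    unfolding M_def using subspace_closure_complex[OF subR] by auto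
  moreover have "M \<subseteq> D"
    unfolding M_def by (rule closure_minimal) (use QD D(2) in \<open>auto simp: R_def\<close>)
  moreover have "norm (A x) \<le> \<epsilon> * norm x" if "x \<in> M" for x
  proof -
    have "closed {x. norm (A x) \<le> \<epsilon> * norm x}"
      by (intro closed_Collect_le continuous_intros A.continuous_on continuous_on_id)
    moreover have "norm (A x) \<le> \<epsilon> * norm x" if "x \<in> R" for x
    proof -
      obtain n where "Q n x = x"
        using \<open>x \<in> R\<close> by (auto simp: R_iff)
      then have "norm (A x) \<le> (1 - (1/2)^n) * (\<epsilon> * norm x)"
        using Qsmall[of n x] by (simp add: mult_ac)
      also have "\<dots> \<le> 1 * (\<epsilon> * norm x)"
        using \<epsilon> by (intro mult_right_mono) auto
      finally show ?thesis
        by simp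
    qed
    ultimately show ?thesis
      using closure_minimal[of R "{x. norm (A x) \<le> \<epsilon> * norm x}"] that
      unfolding M_def by blast
  qed
  moreover have "\<not> finite_dim s M"
  proof
    assume "finite_dim s M"
    then obtain B where B: "finite B" "C.span B = M"
      by (auto simp: finite_dim_def)
    obtain C where C: "C \<subseteq> range (Q (Suc (card B)))" "C.independent C" "card C = Suc (card B)"
      using C.independent_in_projection_chain[of Q "Suc (card B)"] chain strict QQ
        linear_if_bounded_linear[OF Ql Qs] by blast
    have "C \<subseteq> C.span B"
      unfolding B M_def using C(1) closure_subset by (fastforce simp: R_def)
    then have "card C \<le> card B"
      using C.independent_span_bound[OF B(1) C(2)] by blast
    with C(3) show False
      by simp
  qed
  ultimately show ?thesis
    using that by blast
qed

text \<open>Continuity of the inverse at the single point \<open>0\<close> gives a lower bound on small vectors, and hence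
  on all vectors by homogeneity.\<close>

lemma homeomorphism_on_subspace_iff:
  assumes T: "bounded_linear T" and S: "subspace S"
  shows "(\<exists>g. homeomorphism S (T ` S) T g) \<longleftrightarrow> (\<exists>c>0. \<forall>x\<in>S. c * norm x \<le> norm (T x))"
proof
  interpret T: bounded_linear T by (rule T)
  {
    assume "\<exists>g. homeomorphism S (T ` S) T g"
    then obtain g where g: "continuous_on (T ` S) g" "\<And>x. x \<in> S \<Longrightarrow> g (T x) = x"
      by (auto simp: homeomorphism_def)
    have "0 \<in> T ` S"
      using S by (metis T.zero image_eqI subspace_0)
    moreover have g0: "g 0 = 0"
      using g(2)[of 0] S by (simp add: T.zero subspace_0)
    ultimately obtain d where d: "d > 0" "\<And>y. y \<in> T ` S \<Longrightarrow> norm y < d \<Longrightarrow> norm (g y) < 1"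
      using g(1)[unfolded continuous_on_iff, rule_format, of 0 1] by auto
    have "(d / 2) * norm x \<le> norm (T x)" if x: "x \<in> S" for x
    proof (rule ccontr)
      assume "\<not> ?thesis"
      then have lt: "norm (T x) < (d / 2) * norm x"
        by simp
      then have x0: "norm x > 0"
        by (metis mult_zero_right norm_not_less_zero zero_less_norm_iff norm_eq_zero)
      define z where "z = (1 / norm x) *\<^sub>R x"
      have z: "z \<in> S" "norm z = 1"
        using x S x0 by (simp_all add: z_def subspace_scale)
      have "norm (T z) = norm (T x) / norm x"
        using x0 by (simp add: z_def T.scaleR)
      also have "\<dots> < d"
      proof -
        have "0 < d * norm x"
          using d(1) x0 by (rule mult_pos_pos)
        then have "norm (T x) < d * norm x"
          using lt by simp
        then show ?thesis
          using x0 by (simp add: field_simps)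
      qed
      finally have "norm (g (T z)) < 1"
        using d(2) z by blast
      then show False
        using g(2) z by simp
    qed
    then show "\<exists>c>0. \<forall>x\<in>S. c * norm x \<le> norm (T x)"
      using d(1) by (intro exI[of _ "d / 2"]) auto
  }
  assume "\<exists>c>0. \<forall>x\<in>S. c * norm x \<le> norm (T x)"
  then obtain c where c: "c > 0" "\<And>x. x \<in> S \<Longrightarrow> c * norm x \<le> norm (T x)"
    by blast
  have lip: "norm (x - y) \<le> norm (T x - T y) / c" if "x \<in> S" "y \<in> S" for x y
    using c(2)[of "x - y"] c(1) subspace_diff[OF S that] by (simp add: T.diff field_simps)
  have inj: "inj_on T S"
    using lip by (intro inj_onI) fastforce
  have inv: "inv_into S T (T x) = x" if "x \<in> S" for x
    by (rule inv_into_f_f[OF inj that])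
  have "continuous_on (T ` S) (inv_into S T)"
    unfolding continuous_on_iff
  proof (intro ballI allI impI)
    fix y and e :: real
    assume y: "y \<in> T ` S" and e: "e > 0"
    have "dist (inv_into S T y') (inv_into S T y) < e" if y': "y' \<in> T ` S" "dist y' y < e * c" for y'
    proof -
      obtain x x' where xx: "x \<in> S" "y = T x" "x' \<in> S" "y' = T x'"
        using y y'(1) by blast
      have "norm (x' - x) \<le> norm (T x' - T x) / c"
        by (rule lip) (use xx in auto)
      also have "\<dots> < e"
        using y'(2) c(1) by (simp add: xx dist_norm field_simps)
      finally show ?thesis
        by (simp add: xx inv dist_norm)
    qed
    then show "\<exists>d>0. \<forall>x'\<in>T ` S. dist x' y < d \<longrightarrow> dist (inv_into S T x') (inv_into S T y) < e"
      using e c(1) by (intro exI[of _ "e * c"]) auto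
  qed
  then have "homeomorphism S (T ` S) T (inv_into S T)"
    using inv T.continuous_on[OF continuous_on_id] by (simp add: homeomorphism_def image_image)
  then show "\<exists>g. homeomorphism S (T ` S) T g"
    by blast
qed

lemma finite_dim_if_inj_image:
  assumes f: "linear f" "inj_on f M" and M: "subspace M" and fin: "finite_dim scaleR (f ` M)"
  shows "finite_dim scaleR M"
proof -
  obtain B where B: "finite B" "span B = f ` M"
    using fin by (auto simp: finite_dim_scaleR_iff)
  obtain C where C: "C \<subseteq> M" "independent C" "M \<subseteq> span C"
    by (rule maximal_independent_subset)
  have sp: "span C = M"
    using C M span_minimal by blast
  then have "independent (f ` C)"
    using linear_independent_injective_image[OF f(1) C(2)] f(2) by simp
  moreover have "f ` C \<subseteq> span B"
    using B C by blast
  ultimately have "finite (f ` C)"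
    using independent_span_bound[OF B(1)] by blast
  moreover have "inj_on f C"
    using f(2) C(1) inj_on_subset by blast
  ultimately have "finite C"
    using finite_imageD by blast
  with sp show ?thesis
    by (auto simp: finite_dim_scaleR_iff)
qed

lemma finite_dim_image:
  assumes "linear f" "finite_dim scaleR M"
  shows "finite_dim scaleR (f ` M)"
proof -
  obtain B where "finite B" "span B = M"
    using assms(2) by (auto simp: finite_dim_scaleR_iff)
  then have "finite (f ` B)" "span (f ` B) = f ` M"
    using linear_span_image[OF assms(1)] by auto
  then show ?thesis
    unfolding finite_dim_scaleR_iff by blast
qed

lemma strictly_singular_scaleC_iff:
  assumes "bounded_op scaleC scaleC T"
  shows "strictly_singular scaleC T \<longleftrightarrow>
    (\<forall>S. subspace S \<and> (\<forall>x\<in>S. \<i> *\<^sub>C x \<in> S) \<and> closed S \<and> \<not> finite_dim scaleR S \<longrightarrow>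
      \<not> (\<exists>c>0. \<forall>x\<in>S. c * norm x \<le> norm (T x)))"
proof -
  interpret complex_structure "scaleC :: complex \<Rightarrow> 'a \<Rightarrow> 'a"
    by (rule complex_structure_scaleC)
  have "bounded_linear T"
    using assms by (simp add: bounded_op_complex_iff complex_structure_scaleC)
  then have eq: "(C.subspace S \<and> closed S \<and> \<not> finite_dim scaleC S \<longrightarrow>
      \<not> (\<exists>g. homeomorphism S (T ` S) T g)) \<longleftrightarrow>
    (subspace S \<and> (\<forall>x\<in>S. \<i> *\<^sub>C x \<in> S) \<and> closed S \<and> \<not> finite_dim scaleR S \<longrightarrow>
      \<not> (\<exists>c>0. \<forall>x\<in>S. c * norm x \<le> norm (T x)))" for S
  proof (cases "C.subspace S")
    case True
    then have "subspace S" "\<forall>x\<in>S. \<i> *\<^sub>C x \<in> S"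
      by (simp_all add: subspace_complex_iff)
    with True \<open>bounded_linear T\<close> show ?thesis
      by (simp add: finite_dim_complex_iff homeomorphism_on_subspace_iff)
  qed (auto simp: subspace_complex_iff)
  show ?thesis
    by (simp only: strictly_singular_def eq)
qed

lemma strictly_singular_scaleR_iff:
  assumes "bounded_linear T"
  shows "strictly_singular scaleR T \<longleftrightarrow>
    (\<forall>S. subspace S \<and> closed S \<and> \<not> finite_dim scaleR S \<longrightarrow>
      \<not> (\<exists>c>0. \<forall>x\<in>S. c * norm x \<le> norm (T x)))"
  unfolding strictly_singular_def subspace_raw_def[symmetric]
  using homeomorphism_on_subspace_iff[OF assms] by blast

text \<open>If \<open>T \<circ> p\<close> were bounded below on \<open>M\<close>, then so would be \<open>p\<close>; it would map \<open>M\<close> isomorphically onto a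
  closed complex subspace of infinite dimension on which \<open>T\<close> is bounded below. The complex structure
  is required of \<open>p ` M\<close> only, so that \<open>p\<close> may be the complex linear first or the antilinear second
  coordinate of pairs in a space and its conjugate.\<close>

lemma strictly_singular_compose_not_bounded_below:
  fixes p :: "'a::banach \<Rightarrow> 'b::complex_banach" and T :: "'b \<Rightarrow> 'c::complex_banach"
  assumes T: "bounded_op scaleC scaleC T" "strictly_singular scaleC T"
    and p: "bounded_linear p" and M: "subspace M" "closed M" "\<not> finite_dim scaleR M"
    and i: "\<And>x. x \<in> M \<Longrightarrow> \<i> *\<^sub>C p x \<in> p ` M" and c: "c > 0"
  shows "\<exists>x\<in>M. norm (T (p x)) < c * norm x"
proof (rule ccontr)
  interpret p: bounded_linear p by (rule p)
  have "bounded_linear T"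
    using T by (simp add: bounded_op_complex_iff complex_structure_scaleC)
  then interpret T: bounded_linear T .
  assume "\<not> ?thesis"
  then have below: "c * norm x \<le> norm (T (p x))" if "x \<in> M" for x
    using that by force
  obtain K where K: "K > 0" "\<And>y. norm (T y) \<le> norm y * K"
    using T.pos_bounded by blast
  have pbelow: "c / K * norm x \<le> norm (p x)" if "x \<in> M" for x
    using below[OF that] K(1) K(2)[of "p x"] by (simp add: field_simps)
  have "complete (p ` M)"
    by (rule complete_isometric_image[of "c / K"])
      (use M p pbelow c K in \<open>auto simp: complete_eq_closed\<close>)
  then have "closed (p ` M)"
    by (rule complete_imp_closed)
  moreover have "subspace (p ` M)"
    using M(1) p.linear by (simp add: linear_subspace_image)
  moreover have "inj_on p M"
  proof (rule inj_onI)
    fix x y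
    assume "x \<in> M" "y \<in> M" "p x = p y"
    then have "c / K * norm (x - y) \<le> 0"
      using pbelow[of "x - y"] subspace_diff[OF M(1)] by (simp add: p.diff)
    then have "norm (x - y) \<le> 0"
      using c K by (simp add: mult_le_0_iff divide_le_0_iff del: norm_le_zero_iff)
    then show "x = y"
      by simp
  qed
  then have "\<not> finite_dim scaleR (p ` M)"
    using finite_dim_if_inj_image[OF p.linear _ M(1)] M(3) by blast
  moreover obtain k where k: "k > 0" "\<And>x. norm (p x) \<le> norm x * k"
    using p.pos_bounded by blast
  then have "(c / k) * norm (p x) \<le> norm (T (p x))" if "x \<in> M" for x
  proof -
    have "(c / k) * norm (p x) \<le> (c / k) * (norm x * k)"
      using k c by (intro mult_left_mono) auto
    also have "\<dots> \<le> norm (T (p x))"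
      using below[OF that] k by simp
    finally show ?thesis .
  qed
  then have "\<exists>c>0. \<forall>y\<in>p ` M. c * norm y \<le> norm (T y)"
    using k c by (intro exI[of _ "c / k"]) auto
  ultimately show False
    using T(2) i unfolding strictly_singular_scaleC_iff[OF T(1)] by blast
qed

text \<open>On the pairs formed from \<open>S\<close>, the two coordinates of \<open>T \<oplus> T\<close> control \<open>T s\<close> and \<open>T s'\<close>, hence the
  norm of the pair. Both coordinates are strictly singular, and one of them can be made small on a
  subspace of infinite dimension, where the other one is then bounded below.\<close>

theorem strictly_singular_complex_iff_real:
  fixes T :: "'y::complex_banach \<Rightarrow> 'z::complex_banach"
  assumes T: "bounded_op scaleC scaleC T"
  shows "strictly_singular scaleC T \<longleftrightarrow> strictly_singular scaleR T"
proof
  have Tl: "bounded_linear T" and Ti: "T (\<i> *\<^sub>C x) = \<i> *\<^sub>C T x" for x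
    using T by (simp_all add: bounded_op_complex_iff complex_structure_scaleC)
  interpret T: bounded_linear T by (rule Tl)
  {
    assume "strictly_singular scaleR T"
    then show "strictly_singular scaleC T"
      unfolding strictly_singular_scaleC_iff[OF T] strictly_singular_scaleR_iff[OF Tl] by blast
  }
  assume ss: "strictly_singular scaleC T"
  interpret complex_structure "conj_pair_scale :: complex \<Rightarrow> 'y \<times> 'y \<Rightarrow> _"
    by (rule complex_structure_conj_pair)
  have False if S: "subspace S" "closed S" "\<not> finite_dim scaleR S"
    and c: "c > 0" "\<And>x. x \<in> S \<Longrightarrow> c * norm x \<le> norm (T x)" for S c
  proof -
    let ?D = "conj_pairs S"
    have Tsc: "T (a *\<^sub>C x) = a *\<^sub>C T x" for a x
      using T by (simp add: bounded_op_def Vector_Spaces.linear_def module_hom_def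
          module_hom_axioms_def)
    have D: "C.subspace ?D" "closed ?D"
      using subspace_conj_pairs[OF S(1)] closed_conj_pairs[OF S(1,2)] by auto
    have "\<not> finite_dim scaleR ?D"
    proof
      assume fin: "finite_dim scaleR ?D"
      have "linear (\<lambda>x::'y \<times> 'y. fst x + snd x)"
        by (intro bounded_linear.linear bounded_linear_intros)
      then have "finite_dim scaleR ((\<lambda>x. fst x + snd x) ` ?D)"
        using fin by (rule finite_dim_image)
      moreover have "(\<lambda>x. fst x + snd x) ` ?D = S"
      proof
        show "S \<subseteq> (\<lambda>x. fst x + snd x) ` ?D"
        proof
          fix y
          assume y: "y \<in> S"
          then have "((1/2) *\<^sub>R y, (1/2) *\<^sub>R y) \<in> ?D"
            using S(1) by (simp add: conj_pairs_def minus_scaleC subspace_0 flip: scaleR_left_distrib)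
          then show "y \<in> (\<lambda>x. fst x + snd x) ` ?D"
            by (rule rev_image_eqI) (simp flip: scaleR_left_distrib)
        qed
      qed (auto simp: conj_pairs_def)
      ultimately show False
        using S(3) by simp
    qed
    then have Dinf: "\<not> finite_dim conj_pair_scale ?D"
      using finite_dim_complex_iff[OF D(1)] by simp
    have small: "\<exists>x\<in>N. norm (T (fst x)) < \<delta> * norm x" "\<exists>x\<in>N. norm (T (snd x)) < \<delta> * norm x"
      if N: "C.subspace N" "closed N" "\<not> finite_dim conj_pair_scale N" and d: "\<delta> > 0" for N \<delta>
    proof -
      have N': "subspace N" "\<not> finite_dim scaleR N"
        using N finite_dim_complex_iff[OF N(1)] by (auto simp: subspace_complex_iff)
      \<comment> \<open>Multiplication of a pair by \<open>- \<i>\<close> multiplies its second coordinate by \<open>\<i>\<close>.\<close>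
      have "\<i> *\<^sub>C fst x \<in> fst ` N" "\<i> *\<^sub>C snd x \<in> snd ` N" if "x \<in> N" for x
        using C.subspace_scale[OF N(1) that, of \<i>] C.subspace_scale[OF N(1) that, of "- \<i>"]
        by (force simp: conj_pair_scale_def)+
      then show "\<exists>x\<in>N. norm (T (fst x)) < \<delta> * norm x" "\<exists>x\<in>N. norm (T (snd x)) < \<delta> * norm x"
        using strictly_singular_compose_not_bounded_below[OF T ss _ N'(1) N(2) N'(2) _ d]
          bounded_linear_fst bounded_linear_snd by blast+
    qed
    \<comment> \<open>As \<open>c norm x \<le> 2 (norm (T u) + norm (T v))\<close> for \<open>x = (u, v)\<close> in \<open>?D\<close>, the bound \<open>c / 4\<close>
      on the first coordinate absorbs half of the left hand side.\<close>
    obtain M where M: "C.subspace M" "closed M" "M \<subseteq> ?D" "\<not> finite_dim conj_pair_scale M"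
      and Msmall: "\<And>x. x \<in> M \<Longrightarrow> norm (T (fst x)) \<le> (c / 4) * norm x"
    proof (rule exists_subspace_with_small_norm[of "\<lambda>x. T (fst x)" ?D "c / 4"])
      show "bounded_linear (\<lambda>x. T (fst x))"
        by (rule bounded_linear_compose[OF Tl bounded_linear_fst])
      show "norm (T (fst (conj_pair_scale a x))) = cmod a * norm (T (fst x))" for a x
        by (simp add: conj_pair_scale_def Tsc norm_scaleC)
    qed (use D Dinf small c in auto)
    have "(c / 4) * norm x \<le> norm (T (snd x))" if x: "x \<in> M" for x
    proof -
      obtain u v where uv: "x = (u, v)" "u + v \<in> S" "\<i> *\<^sub>C (u - v) \<in> S"
        using x M(3) by (auto simp: conj_pairs_def)
      have 1: "c * norm (u + v) \<le> norm (T u) + norm (T v)"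
        using c(2)[OF uv(2)] norm_triangle_ineq[of "T u" "T v"] by (simp add: T.add)
      have 2: "c * norm (u - v) \<le> norm (T u) + norm (T v)"
        using c(2)[OF uv(3)] norm_triangle_ineq4[of "T u" "T v"]
        by (simp add: Ti T.diff norm_scaleC)
      have "2 * norm u \<le> norm (u + v) + norm (u - v)" "2 * norm v \<le> norm (u + v) + norm (u - v)"
        using norm_triangle_ineq[of "u + v" "u - v"] norm_triangle_ineq4[of "u + v" "u - v"]
        by (simp_all flip: scaleR_2)
      moreover have "norm x \<le> norm u + norm v"
        unfolding uv by (rule norm_Pair_le)
      ultimately have "norm x \<le> norm (u + v) + norm (u - v)"
        by linarith
      then have "c * norm x \<le> c * (norm (u + v) + norm (u - v))"
        using c by (intro mult_left_mono) auto
      also have "\<dots> \<le> 2 * (norm (T u) + norm (T v))"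
        using 1 2 by (simp add: distrib_left)
      also have "\<dots> \<le> (c / 2) * norm x + 2 * norm (T v)"
        using Msmall[OF x] by (simp add: uv(1))
      finally show ?thesis
        by (simp add: uv(1))
    qed
    then show False
      using small(2)[OF M(1,2,4), of "c / 4"] c by force
  qed
  then show "strictly_singular scaleR T"
    unfolding strictly_singular_scaleR_iff[OF Tl] by blast
qed

section \<open>Strictly cosingular operators\<close>

text \<open>For small \<open>\<eta>\<close>, the functional \<open>q z\<close>, the infimum of \<open>norm b + norm (z - A b - v) / \<eta>\<close> over all \<open>b\<close> and
  all \<open>v \<in> N\<close>, measures how well \<open>z\<close> is approximated by the range of \<open>A\<close> modulo \<open>N\<close>. If it were at most
  \<open>norm z / (4 \<eta>)\<close> everywhere, successive approximation would make \<open>A\<close> onto modulo \<open>N\<close>. So it is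
  large at some \<open>z\<close>, and a linear functional that is dominated by \<open>q\<close> and agrees with it at \<open>z\<close> is
  large at \<open>z\<close>, vanishes on \<open>N\<close> and is small on the range of \<open>A\<close>.\<close>

lemma functional_small_on_range:
  fixes A :: "'c::banach \<Rightarrow> 'a::real_normed_vector"
  assumes A: "bounded_linear A" and N: "subspace N" "closed N"
    and not_onto: "\<exists>z. \<forall>y. z - A y \<notin> N" and \<delta>: "\<delta> > 0"
  obtains f z where "bounded_linear f" "\<And>v. v \<in> N \<Longrightarrow> f v = 0" "\<And>v. \<bar>f v\<bar> \<le> 4 * norm v"
    "\<And>y. \<bar>f (A y)\<bar> \<le> \<delta> * norm y" "norm z < f z"
proof -
  interpret A: bounded_linear A by (rule A)
  define \<eta> where "\<eta> = \<delta> / 4"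
  have \<eta>: "\<eta> > 0"
    using \<delta> by (simp add: \<eta>_def)
  define a where "a z p = norm (fst p) + norm (z - A (fst p) - snd p) / \<eta>" for z and p :: "'c \<times> 'a"
  define q where "q z = (INF p\<in>UNIV \<times> N. a z p)" for z
  have N0: "0 \<in> N"
    using N by (simp add: subspace_0)
  have a0: "0 \<le> a z p" for z p
    using \<eta> by (simp add: a_def)
  then have bdd: "bdd_below (a z ` (UNIV \<times> N))" for z
    by (intro bdd_belowI2[where m = 0]) auto
  have le: "q z \<le> norm b + norm (z - A b - v) / \<eta>" if "v \<in> N" for z b v
    using cINF_lower[OF bdd, of "(b, v)" z] that by (simp add: q_def a_def)
  have ge: "c \<le> q z" if "\<And>b v. v \<in> N \<Longrightarrow> c \<le> norm b + norm (z - A b - v) / \<eta>" for c z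
    unfolding q_def using that N0 by (intro cINF_greatest) (auto simp: a_def)
  have q: "sublinear q"
  proof (rule sublinearI)
    fix x y
    have 1: "q (x + y) \<le> (norm b + norm (x - A b - v) / \<eta>) + (norm c + norm (y - A c - w) / \<eta>)"
      if "v \<in> N" "w \<in> N" for b v c w
    proof -
      have "x + y - A (b + c) - (v + w) = (x - A b - v) + (y - A c - w)"
        by (simp add: A.add)
      then have "norm (x + y - A (b + c) - (v + w)) / \<eta> \<le>
          (norm (x - A b - v) + norm (y - A c - w)) / \<eta>"
        using norm_triangle_ineq \<eta> by (metis divide_right_mono less_imp_le)
      then show ?thesis
        using le[of "v + w" "x + y" "b + c"] subspace_add[OF N(1) that] norm_triangle_ineq[of b c]
        by (simp add: add_divide_distrib)
    qed
    have "q (x + y) - (norm b + norm (x - A b - v) / \<eta>) \<le> q y" if "v \<in> N" for b v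
    proof (rule ge)
      fix c w
      assume "w \<in> N"
      show "q (x + y) - (norm b + norm (x - A b - v) / \<eta>) \<le> norm c + norm (y - A c - w) / \<eta>"
        using 1[OF that \<open>w \<in> N\<close>, of b c] by linarith
    qed
    then have "q (x + y) - q y \<le> norm b + norm (x - A b - v) / \<eta>" if "v \<in> N" for b v
      using that by (simp add: algebra_simps)
    then have "q (x + y) - q y \<le> q x"
      by (rule ge)
    then show "q (x + y) \<le> q x + q y"
      by simp
  next
    have "0 \<le> q 0"
      by (rule ge) (use \<eta> in simp)
    then show "q 0 = 0"
      using le[OF N0, of 0 0] by (simp add: A.zero)
  next
    fix r :: real and x
    assume r: "r > 0"
    have "(1 / r) * q (r *\<^sub>R x) \<le> q x"
    proof (rule ge)
      fix b v
      assume v: "v \<in> N"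
      have "r *\<^sub>R x - A (r *\<^sub>R b) - r *\<^sub>R v = r *\<^sub>R (x - A b - v)"
        by (simp add: A.scaleR algebra_simps)
      then have "norm (r *\<^sub>R x - A (r *\<^sub>R b) - r *\<^sub>R v) = r * norm (x - A b - v)"
        using r by (simp only: norm_scaleR abs_of_pos)
      then have "q (r *\<^sub>R x) \<le> r * (norm b + norm (x - A b - v) / \<eta>)"
        using le[OF subspace_scale[OF N(1) v, of r], of "r *\<^sub>R x" "r *\<^sub>R b"] r
        by (simp add: distrib_left)
      then show "(1 / r) * q (r *\<^sub>R x) \<le> norm b + norm (x - A b - v) / \<eta>"
        using r by (simp add: field_simps)
    qed
    then show "q (r *\<^sub>R x) \<le> r * q x"
      using r by (simp add: field_simps)
  qed
  have "\<exists>z. norm z / (4 * \<eta>) < q z"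
  proof (rule ccontr)
    assume "\<not> ?thesis"
    then have qle: "q z \<le> norm z / (4 * \<eta>)" for z
      by (meson not_le)
    have "\<exists>y\<in>UNIV. \<exists>m\<in>N. norm y \<le> 1 / (2 * \<eta>) * norm x \<and> norm (x - A y - m) \<le> norm x / 2" for x
    proof (cases "x = 0")
      case True
      then show ?thesis
        using N0 by (intro bexI[of _ 0]) (auto simp: A.zero)
    next
      case False
      then have "norm x / (4 * \<eta>) < norm x / (2 * \<eta>)"
        using \<eta> by (simp add: field_simps)
      then have "q x < norm x / (2 * \<eta>)"
        using qle[of x] by linarith
      then obtain b v where bv: "v \<in> N" "norm b + norm (x - A b - v) / \<eta> < norm x / (2 * \<eta>)"
        using ge[of "norm x / (2 * \<eta>)" x] by (meson not_le)
      have "norm b \<le> 1 / (2 * \<eta>) * norm x"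
      proof -
        have "0 \<le> norm (x - A b - v) / \<eta>"
          using \<eta> by simp
        then show ?thesis
          using bv(2) by simp
      qed
      moreover have "norm (x - A b - v) / \<eta> \<le> norm x / (2 * \<eta>)"
        using bv(2) norm_ge_zero[of b] by linarith
      then have "norm (x - A b - v) \<le> norm x / 2"
        using \<eta> by (simp add: field_simps)
      ultimately show ?thesis
        using bv(1) by blast
    qed
    then have "\<exists>y\<in>UNIV. z - A y \<in> N \<and> norm y \<le> 2 * (1 / (2 * \<eta>)) * norm z" for z
      by (intro onto_if_approximately_onto[OF A _ _ N(2,1)]) auto
    then show False
      using not_onto by blast
  qed
  then obtain z where z: "norm z / (4 * \<eta>) < q z"
    by blast
  obtain f where f: "linear f" "\<And>v. f v \<le> q v" "f z = q z"
    using Hahn_Banach_sublinear[OF q, of z] by blast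
  \<comment> \<open>Since \<open>\<delta> = 4 \<eta>\<close>, the factor \<open>\<delta>\<close> lifts the value \<open>q z > norm z / (4 \<eta>)\<close> above \<open>norm z\<close>.\<close>
  define g where "g v = \<delta> * f v" for v
  have fneg: "f (- v) = - f v" for v
    by (rule linear_neg[OF f(1)])
  have "f v \<le> norm v / \<eta>" for v
    using f(2)[of v] le[OF N0, of v 0] by (simp add: A.zero)
  from this[of v for v] this[of "- v" for v] have "\<bar>f v\<bar> \<le> norm v / \<eta>" for v
    by (simp add: fneg abs_le_iff)
  then have gb: "\<bar>g v\<bar> \<le> 4 * norm v" for v
    using \<delta> by (simp add: g_def \<eta>_def abs_mult field_simps)
  have "f (A y) \<le> norm y" for y
    using f(2)[of "A y"] le[OF N0, of "A y" y] by simp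
  from this[of y for y] this[of "- y" for y] have "\<bar>f (A y)\<bar> \<le> norm y" for y
    by (simp add: linear_neg[OF A.linear] fneg abs_le_iff)
  then have gA: "\<bar>g (A y)\<bar> \<le> \<delta> * norm y" for y
    using \<delta> by (simp add: g_def abs_mult)
  have "f v \<le> 0" if "v \<in> N" for v
    using f(2)[of v] le[OF that, of v 0] by (simp add: A.zero)
  then have gN: "g v = 0" if "v \<in> N" for v
    using that subspace_neg[OF N(1) that] fneg[of v] unfolding g_def
    by (metis antisym mult_zero_right neg_le_0_iff_le)
  have "bounded_linear g"
    by (rule bounded_linear_intro[where K = 4])
      (use gb in \<open>auto simp: g_def linear_add[OF f(1)] linear_scale[OF f(1)] distrib_left mult.commute\<close>)
  moreover have "norm z < g z"
    using z \<delta> by (simp add: g_def f(3) \<eta>_def field_simps)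
  ultimately show ?thesis
    using that gb gA gN by blast
qed

text \<open>The dual construction: \<open>M\<close> is the intersection of the kernels of an increasing sequence of
  projections \<open>P\<^sub>n\<close> of finite rank that vanish on \<open>K\<close>. As \<open>A\<close> is not onto modulo \<open>K + range P\<^sub>n\<close>,
  there is a functional \<open>g\<close> that vanishes on this subspace and for which \<open>g \<circ> A\<close> is as small as desired;
  put \<open>P\<^sub>n\<^sub>+\<^sub>1 v = P\<^sub>n v + g v w\<close> with \<open>w\<close> in the kernel of \<open>P\<^sub>n\<close> and \<open>g w = 1\<close>. The norm of \<open>w\<close> is
  controlled by \<open>P\<^sub>n\<close> alone. Then \<open>P\<^sub>n (A y)\<close> converges to a vector \<open>u\<close> of norm at most \<open>\<epsilon> norm y\<close>, and
  \<open>A y - u\<close> lies in all the kernels.\<close>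

lemma (in complex_structure) exists_subspace_approximating_range:
  fixes A :: "'c::banach \<Rightarrow> 'a" and s' :: "complex \<Rightarrow> 'c \<Rightarrow> 'c"
  assumes A: "bounded_linear A" and s': "complex_structure s'" and Ai: "\<And>y. A (s' \<i> y) = s \<i> (A y)"
    and K: "C.subspace K" "closed K" "\<not> finite_codim s K"
    and not_onto: "\<And>N. C.subspace N \<Longrightarrow> closed N \<Longrightarrow> K \<subseteq> N \<Longrightarrow> \<not> finite_codim s N \<Longrightarrow>
      \<exists>z. \<forall>y. z - A y \<notin> N"
    and \<epsilon>: "\<epsilon> > 0"
  obtains M where "C.subspace M" "closed M" "K \<subseteq> M" "\<not> finite_codim s M"
    "\<And>y. \<exists>m\<in>M. norm (A y - m) \<le> \<epsilon> * norm y"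
proof -
  interpret A: bounded_linear A by (rule A)
  interpret S': complex_structure s' by (rule s')
  define good where "good n P \<longleftrightarrow> bounded_linear P \<and> (\<forall>c x. P (s c x) = s c (P x)) \<and>
    (\<forall>x. P (P x) = P x) \<and> (\<forall>k\<in>K. P k = 0) \<and> (\<exists>B. finite B \<and> range P \<subseteq> C.span B) \<and>
    (\<forall>y. norm (P (A y)) \<le> \<epsilon> * (1 - (1/2)^n) * norm y)" for n and P :: "'a \<Rightarrow> 'a"
  define ext where "ext n P P' \<longleftrightarrow> (\<forall>x. P' (P x) = P x) \<and> (\<forall>x. P (P' x) = P x) \<and>
    (\<exists>x. P' x = x \<and> P x \<noteq> x) \<and> (\<forall>y. norm (P' (A y) - P (A y)) \<le> \<epsilon> * (1/2)^(Suc n) * norm y)"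
    for n and P P' :: "'a \<Rightarrow> 'a"
  have step: "\<exists>P'. good (Suc n) P' \<and> ext n P P'" if P: "good n P" for P n
  proof -
    have Pl: "bounded_linear P" and Ps: "\<And>c x. P (s c x) = s c (P x)"
      and PP: "\<And>x. P (P x) = P x" and PK: "\<And>k. k \<in> K \<Longrightarrow> P k = 0"
      and Psmall: "\<And>y. norm (P (A y)) \<le> \<epsilon> * (1 - (1/2)^n) * norm y"
      using P by (auto simp: good_def)
    obtain B where B: "finite B" "\<And>x. P x \<in> C.span B"
      using P unfolding good_def by (metis rangeI subsetD)
    interpret P: bounded_linear P by (rule Pl)
    have sdiff: "s c v - P (s c v) = s c (v - P v)" for c v
      by (simp add: Ps C.scale_right_diff_distrib)
    \<comment> \<open>This is \<open>K + range P\<close>, written as the preimage of a closed set.\<close>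
    define N where "N = {x. x - P x \<in> K}"
    have subN: "C.subspace N"
    proof (rule C.subspaceI)
      show "0 \<in> N"
        using C.subspace_0[OF K(1)] by (simp add: N_def P.zero)
    next
      fix x y
      assume "x \<in> N" "y \<in> N"
      then have "(x - P x) + (y - P y) \<in> K"
        by (auto simp: N_def intro: C.subspace_add[OF K(1)])
      then show "x + y \<in> N"
        by (simp add: N_def P.add algebra_simps)
    next
      fix c x
      assume "x \<in> N"
      then show "s c x \<in> N"
        unfolding N_def mem_Collect_eq sdiff by (rule C.subspace_scale[OF K(1)])
    qed
    have N_eq: "N = (\<lambda>x. x - P x) -` K"
      by (auto simp: N_def)
    have clN: "closed N"
      unfolding N_eq
      by (intro continuous_closed_vimage K(2) continuous_intros P.continuous)
    have KN: "K \<subseteq> N"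
      by (auto simp: N_def PK)
    have infN: "\<not> finite_codim s N"
    proof
      assume "finite_codim s N"
      then obtain B' where B': "finite B'" "\<And>z. \<exists>x\<in>N. \<exists>y\<in>C.span B'. z = x + y"
        by (auto simp: finite_codim_iff)
      have "\<exists>x\<in>K. \<exists>y\<in>C.span (B \<union> B'). z = x + y" for z
      proof -
        obtain x y where xy: "x \<in> N" "y \<in> C.span B'" "z = x + y"
          using B'(2) by blast
        have "P x + y \<in> C.span (B \<union> B')"
          using B(2)[of x] xy(2) C.span_mono[of B' "B \<union> B'"] C.span_mono[of B "B \<union> B'"]
          by (intro C.span_add) auto
        moreover have "z = (x - P x) + (P x + y)"
          by (simp add: xy(3))
        ultimately show ?thesis
          using xy(1) unfolding N_def by blast
      qed
      then have "finite_codim s K"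
        using B(1) B'(1) unfolding finite_codim_iff by (intro exI[of _ "B \<union> B'"]) auto
      with K(3) show False
        by blast
    qed
    obtain k where k: "k > 0" "\<And>x. norm (P x) \<le> norm x * k"
      using P.pos_bounded by blast
    \<comment> \<open>Below, \<open>g \<circ> A\<close> has norm at most \<open>2 \<delta>\<close> and \<open>w\<close> has norm at most \<open>1 + k\<close>.\<close>
    define \<delta> where "\<delta> = \<epsilon> * (1/2)^(Suc n) / (2 * (1 + k))"
    have \<delta>: "\<delta> > 0"
      using \<epsilon> k by (simp add: \<delta>_def)
    have "subspace N"
      using subN by (simp add: subspace_complex_iff)
    then obtain f z where f: "bounded_linear f" "\<And>v. v \<in> N \<Longrightarrow> f v = 0" "\<And>v. \<bar>f v\<bar> \<le> 4 * norm v"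
      "\<And>y. \<bar>f (A y)\<bar> \<le> \<delta> * norm y" "norm z < f z"
      using functional_small_on_range[OF A _ clN not_onto[OF subN clN KN infN] \<delta>] by blast
    obtain g where g: "bounded_linear g" "\<And>c v. g (s c v) = c * g v"
      and Reg: "\<And>v. Re (g v) = f v" and Img: "\<And>v. Im (g v) = - f (s \<i> v)"
      by (rule complex_functional_of_real[OF f(1,3)]) blast
    interpret g: bounded_linear g by (rule g(1))
    have gN: "g v = 0" if "v \<in> N" for v
      using f(2)[OF that] f(2)[of "s \<i> v"] that subN
      by (simp add: complex_eq_iff Reg Img subspace_complex_iff)
    have gA: "cmod (g (A y)) \<le> 2 * \<delta> * norm y" for y
      using cmod_le[of "g (A y)"] f(4)[of y] f(4)[of "s' \<i> y"]
      by (simp add: Reg Img Ai S'.norm_s)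
    have gz: "norm z < cmod (g z)"
      using f(5) complex_Re_le_cmod[of "g z"] by (simp add: Reg)
    then have gz0: "cmod (g z) > 0"
      by (rule le_less_trans[OF norm_ge_zero])
    define x where "x = s (1 / g z) z"
    have gx: "g x = 1"
      using gz0 by (simp add: x_def g(2))
    have nx: "norm x \<le> 1"
      using gz gz0 by (simp add: x_def norm_s norm_divide field_simps)
    have gP: "g (P v) = 0" for v
      using gN[of "P v"] C.subspace_0[OF K(1)] by (simp add: N_def PP)
    define w where "w = x - P x"
    have gw: "g w = 1"
      by (simp add: w_def g.diff gP gx)
    have Pw: "P w = 0"
      by (simp add: w_def P.diff PP)
    have nw: "norm w \<le> 1 + k"
    proof -
      have "norm (P x) \<le> k"
        using k(2)[of x] mult_right_mono[OF nx, of k] k(1) by linarith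
      then show ?thesis
        using norm_triangle_ineq4[of x "P x"] nx by (simp add: w_def)
    qed
    define P' where "P' v = P v + s (g v) w" for v
    have P'w: "P' w = w"
      using of_real[of 1 w] by (simp add: P'_def Pw gw)
    have P'P: "P' (P v) = P v" for v
      by (simp add: P'_def PP gP)
    have PP': "P (P' v) = P v" for v
      by (simp add: P'_def P.add PP Ps Pw)
    have "bounded_linear P'"
      unfolding P'_def
      by (intro bounded_linear_add Pl bounded_linear_compose[OF bounded_linear_s_left g(1)])
    then interpret P': bounded_linear P' .
    have P's: "P' (s c v) = s c (P' v)" for c v
      by (simp add: P'_def g(2) Ps add_right)
    have P'P': "P' (P' v) = P' v" for v
      using P'P P'w by (simp add: P'_def[of v] P'.add P's)
    have P'K: "P' v = 0" if "v \<in> K" for v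
      using that KN gN PK by (auto simp: P'_def)
    have P'B: "P' v \<in> C.span (insert w B)" for v
      unfolding P'_def using B(2)[of v] C.span_mono[of B "insert w B"]
      by (intro C.span_add C.span_scale) (auto intro: C.span_base)
    have incr: "norm (P' (A y) - P (A y)) \<le> \<epsilon> * (1/2)^(Suc n) * norm y" for y
    proof -
      have "norm (P' (A y) - P (A y)) = cmod (g (A y)) * norm w"
        by (simp add: P'_def norm_s)
      also have "\<dots> \<le> (2 * \<delta> * norm y) * (1 + k)"
        using gA nw \<delta> by (intro mult_mono) auto
      also have "\<dots> = ((2 * (1 + k)) * \<delta>) * norm y"
        by simp
      also have "(2 * (1 + k)) * \<delta> = \<epsilon> * (1/2)^(Suc n)"
        unfolding \<delta>_def times_divide_eq_right
        by (rule nonzero_mult_div_cancel_left) (use k in simp)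
      finally show ?thesis .
    qed
    have "norm (P' (A y)) \<le> \<epsilon> * (1 - (1/2)^(Suc n)) * norm y" for y
    proof -
      have "norm (P' (A y)) \<le> norm (P (A y)) + norm (P' (A y) - P (A y))"
        using norm_triangle_ineq[of "P (A y)" "P' (A y) - P (A y)"] by simp
      also have "\<dots> \<le> \<epsilon> * (1 - (1/2)^n) * norm y + \<epsilon> * (1/2)^(Suc n) * norm y"
        by (rule add_mono[OF Psmall incr])
      also have "\<dots> = \<epsilon> * (1 - (1/2)^(Suc n)) * norm y"
        by (simp add: algebra_simps)
      finally show ?thesis .
    qed
    then have "good (Suc n) P'"
      unfolding good_def using \<open>bounded_linear P'\<close> P's P'P' P'K P'B B(1)
      by (auto intro!: exI[of _ "insert w B"])
    moreover have "w \<noteq> 0"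
      using gw g.zero by auto
    then have "ext n P P'"
      unfolding ext_def using P'P PP' P'w Pw incr by metis
    ultimately show ?thesis
      by blast
  qed
  have good0: "good 0 (\<lambda>x. 0)"
    unfolding good_def
    by (auto simp: bounded_linear_zero A.zero intro!: exI[of _ "{}"])
  obtain Q where "\<And>n. good n (Q n) \<and> ext n (Q n) (Q (Suc n))"
    using dependent_nat_choice[of good ext] good0 step by metis
  then have good: "good n (Q n)" and ext: "ext n (Q n) (Q (Suc n))" for n
    by auto
  have Ql: "bounded_linear (Q n)" and Qs: "Q n (s c x) = s c (Q n x)"
    and QQ: "Q n (Q n x) = Q n x" and QK: "x \<in> K \<Longrightarrow> Q n x = 0"
    and Qsmall: "norm (Q n (A y)) \<le> \<epsilon> * (1 - (1/2)^n) * norm y" for n c x y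
    using good[of n] by (auto simp: good_def)
  have up: "Q (Suc n) (Q n x) = Q n x" and down: "Q n (Q (Suc n) x) = Q n x"
    and strict: "\<exists>x. Q (Suc n) x = x \<and> Q n x \<noteq> x"
    and incr: "norm (Q (Suc n) (A y) - Q n (A y)) \<le> \<epsilon> * (1/2)^(Suc n) * norm y" for n x y
    using ext[of n] by (auto simp: ext_def)
  have down_le: "Q m (Q n x) = Q m x" if "m \<le> n" for m n x
    using that
  proof (induction n arbitrary: x rule: dec_induct)
    case base
    show ?case
      by (rule QQ)
  next
    case (step n)
    then show ?case
      by (metis down)
  qed
  define M where "M = (\<Inter>n. {x. Q n x = 0})"
  have Qlin: "Q n 0 = 0" "Q n (x + y) = Q n x + Q n y" "Q n (x - y) = Q n x - Q n y" for n x y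
    using bounded_linear.linear[OF Ql] by (simp_all add: linear_0 linear_add linear_diff)
  have "C.subspace M"
    by (auto simp: M_def C.subspace_def Qlin Qs)
  moreover have "closed M"
    unfolding M_def
    by (intro closed_INT ballI closed_Collect_eq continuous_on_const
        bounded_linear.continuous_on[OF Ql] continuous_on_id)
  moreover have "K \<subseteq> M"
    by (auto simp: M_def QK)
  moreover have "\<exists>m\<in>M. norm (A y - m) \<le> \<epsilon> * norm y" for y
  proof -
    have "summable (\<lambda>n. Q (Suc n) (A y) - Q n (A y))"
    proof (rule summable_comparison_test)
      show "\<exists>N. \<forall>n\<ge>N. norm (Q (Suc n) (A y) - Q n (A y)) \<le> (\<epsilon> * norm y) * (1/2)^(Suc n)"
        using incr by (simp add: mult_ac)
      show "summable (\<lambda>n. (\<epsilon> * norm y) * (1/2)^(Suc n))"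
        by (intro summable_mult) (simp add: summable_geometric)
    qed
    then have "(\<lambda>n. Q n (A y) - Q 0 (A y)) \<longlonglongrightarrow> (\<Sum>n. Q (Suc n) (A y) - Q n (A y))"
      using summable_LIMSEQ sum_lessThan_telescope[of "\<lambda>n. Q n (A y)"] by fastforce
    from tendsto_add[OF this tendsto_const[of "Q 0 (A y)"]]
    obtain w where w: "(\<lambda>n. Q n (A y)) \<longlonglongrightarrow> w"
      by auto
    have "norm (Q n (A y)) \<le> \<epsilon> * norm y" for n
    proof -
      have "(1 - (1/2)^n) * (\<epsilon> * norm y) \<le> 1 * (\<epsilon> * norm y)"
        using \<epsilon> by (intro mult_right_mono) auto
      then show ?thesis
        using Qsmall[of n y] by (simp add: mult_ac)
    qed
    then have "norm w \<le> \<epsilon> * norm y"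
      by (intro Lim_norm_ubound[OF _ w]) auto
    moreover have "Q m w = Q m (A y)" for m
    proof (rule LIMSEQ_unique)
      show "(\<lambda>n. Q m (Q n (A y))) \<longlonglongrightarrow> Q m w"
        by (rule bounded_linear.tendsto[OF Ql w])
      have "\<forall>\<^sub>F n in sequentially. Q m (Q n (A y)) = Q m (A y)"
        using eventually_ge_at_top[of m] by eventually_elim (rule down_le)
      then show "(\<lambda>n. Q m (Q n (A y))) \<longlonglongrightarrow> Q m (A y)"
        by (rule tendsto_eventually)
    qed
    then have "A y - w \<in> M"
      by (simp add: M_def Qlin)
    ultimately show ?thesis
      by (intro bexI[of _ "A y - w"]) auto
  qed
  moreover have "\<not> finite_codim s M"
  proof
    assume "finite_codim s M"
    then obtain B where B: "finite B" "\<And>z. \<exists>x\<in>M. \<exists>y\<in>C.span B. z = x + y"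
      by (auto simp: finite_codim_iff)
    let ?n = "Suc (card B)"
    obtain C where C: "C \<subseteq> range (Q ?n)" "C.independent C" "card C = ?n"
      using C.independent_in_projection_chain[of Q ?n] up strict QQ
        linear_if_bounded_linear[OF Ql Qs] by blast
    interpret Qn: Vector_Spaces.linear s s "Q ?n"
      by (rule linear_if_bounded_linear[OF Ql Qs])
    have "range (Q ?n) \<subseteq> C.span (Q ?n ` B)"
    proof
      fix v
      assume "v \<in> range (Q ?n)"
      then obtain z where z: "v = Q ?n z"
        by blast
      obtain x y where "x \<in> M" "y \<in> C.span B" "z = x + y"
        using B(2) by blast
      then have "v = Q ?n y" "y \<in> C.span B"
        using z by (simp_all add: M_def Qlin)
      then show "v \<in> C.span (Q ?n ` B)"
        by (simp add: Qn.span_image)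
    qed
    then have "card C \<le> card (Q ?n ` B)"
      using C.independent_span_bound[of "Q ?n ` B" C] C B(1) by auto
    then show False
      using C(3) card_image_le[OF B(1), of "Q ?n"] by simp
  qed
  ultimately show ?thesis
    using that by blast
qed

lemma quotient_map_onto_iff:
  fixes T :: "'a \<Rightarrow> 'b::real_vector"
  assumes Z: "subspace Z"
  shows "range (\<lambda>x. quotient_map Z (T x)) = range (quotient_map Z) \<longleftrightarrow> (\<forall>z. \<exists>x. z - T x \<in> Z)"
proof -
  have eq: "quotient_map Z x = quotient_map Z y \<longleftrightarrow> x - y \<in> Z" for x y
  proof
    assume "quotient_map Z x = quotient_map Z y"
    moreover have "x \<in> quotient_map Z x"
      unfolding quotient_map_def using subspace_0[OF Z] by force
    ultimately obtain z where "z \<in> Z" "x = y + z"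
      by (auto simp: quotient_map_def)
    then show "x - y \<in> Z"
      by simp
  next
    assume xy: "x - y \<in> Z"
    have "quotient_map Z a \<subseteq> quotient_map Z b" if "a - b \<in> Z" for a b
    proof
      fix v
      assume "v \<in> quotient_map Z a"
      then obtain z where "z \<in> Z" "v = a + z"
        by (auto simp: quotient_map_def)
      then have "v = b + ((a - b) + z)" "(a - b) + z \<in> Z"
        using that by (simp_all add: subspace_add[OF Z])
      then show "v \<in> quotient_map Z b"
        unfolding quotient_map_def by blast
    qed
    from this[OF xy] this[of y x] show "quotient_map Z x = quotient_map Z y"
      using subspace_neg[OF Z xy] by auto
  qed
  have "range (\<lambda>x. quotient_map Z (T x)) = range (quotient_map Z) \<longleftrightarrow>
      (\<forall>z. \<exists>x. quotient_map Z z = quotient_map Z (T x))"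
    by (auto simp: set_eq_iff image_iff)
  then show ?thesis
    by (simp add: eq)
qed

lemma strictly_cosingular_scaleC_iff:
  fixes T :: "'a::real_normed_vector \<Rightarrow> 'b::complex_banach"
  shows "strictly_cosingular scaleC T \<longleftrightarrow>
    (\<forall>Z. subspace Z \<and> (\<forall>z\<in>Z. \<i> *\<^sub>C z \<in> Z) \<and> closed Z \<and> \<not> finite_codim scaleR Z \<longrightarrow>
      (\<exists>z. \<forall>x. z - T x \<notin> Z))"
proof -
  interpret complex_structure "scaleC :: complex \<Rightarrow> 'b \<Rightarrow> 'b"
    by (rule complex_structure_scaleC)
  have eq: "(C.subspace Z \<and> closed Z \<and> \<not> finite_codim scaleC Z \<longrightarrow>
      range (\<lambda>x. quotient_map Z (T x)) \<noteq> range (quotient_map Z)) \<longleftrightarrow>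
    (subspace Z \<and> (\<forall>z\<in>Z. \<i> *\<^sub>C z \<in> Z) \<and> closed Z \<and> \<not> finite_codim scaleR Z \<longrightarrow>
      (\<exists>z. \<forall>x. z - T x \<notin> Z))" for Z
    using quotient_map_onto_iff[of Z T]
    by (cases "subspace Z") (simp_all add: subspace_complex_iff finite_codim_complex_iff)
  show ?thesis
    by (simp only: strictly_cosingular_def eq)
qed

lemma strictly_cosingular_scaleR_iff:
  fixes T :: "'a::real_normed_vector \<Rightarrow> 'b::real_normed_vector"
  shows "strictly_cosingular scaleR T \<longleftrightarrow>
    (\<forall>Z. subspace Z \<and> closed Z \<and> \<not> finite_codim scaleR Z \<longrightarrow> (\<exists>z. \<forall>x. z - T x \<notin> Z))"
proof -
  have eq: "(subspace Z \<and> closed Z \<and> \<not> finite_codim scaleR Z \<longrightarrow>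
      range (\<lambda>x. quotient_map Z (T x)) \<noteq> range (quotient_map Z)) \<longleftrightarrow>
    (subspace Z \<and> closed Z \<and> \<not> finite_codim scaleR Z \<longrightarrow> (\<exists>z. \<forall>x. z - T x \<notin> Z))" for Z
    using quotient_map_onto_iff[of Z T] by (cases "subspace Z") simp_all
  show ?thesis
    by (simp only: strictly_cosingular_def subspace_raw_def[symmetric] eq)
qed

text \<open>If \<open>j \<circ> T\<close> were onto modulo \<open>N\<close>, then \<open>T\<close> would be onto modulo the complex subspace \<open>j -` N\<close>, which
  would therefore have finite codimension; and since all vectors are of the form \<open>j (T y)\<close> modulo
  \<open>N\<close>, so would \<open>N\<close>. Here \<open>j\<close> will be the embedding of a space as the first or, antilinearly, as the
  second summand of pairs.\<close>

lemma strictly_cosingular_not_onto_modulo: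
  fixes T :: "'y::real_normed_vector \<Rightarrow> 'z::complex_banach"
    and j :: "'z \<Rightarrow> 'x::real_normed_vector"
  assumes T: "strictly_cosingular scaleC T"
    and j: "bounded_linear j" and N: "subspace N" "closed N" "\<not> finite_codim scaleR N"
    and i: "\<And>z. j z \<in> N \<Longrightarrow> j (\<i> *\<^sub>C z) \<in> N"
  shows "\<exists>w. \<forall>y. w - j (T y) \<notin> N"
proof (rule ccontr)
  interpret j: bounded_linear j by (rule j)
  assume "\<not> ?thesis"
  then have onto: "\<exists>y. w - j (T y) \<in> N" for w
    by blast
  define Z where "Z = j -` N"
  have "subspace Z"
    unfolding Z_def by (rule linear_subspace_vimage[OF j.linear N(1)])
  moreover have "closed Z"
    unfolding Z_def by (intro continuous_closed_vimage N(2) j.continuous continuous_ident)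
  moreover have "\<i> *\<^sub>C z \<in> Z" if "z \<in> Z" for z
    using that i by (simp add: Z_def)
  moreover have onto_Z: "\<exists>y. z - T y \<in> Z" for z
    using onto[of "j z"] by (simp add: Z_def j.diff)
  ultimately have "finite_codim scaleR Z"
    using T unfolding strictly_cosingular_scaleC_iff by metis
  then obtain B where B: "finite B" "\<And>z. \<exists>x\<in>Z. \<exists>b\<in>span B. z = x + b"
    by (auto simp: finite_codim_scaleR_iff)
  have "\<exists>n\<in>N. \<exists>b\<in>span (j ` B). w = n + b" for w
  proof -
    obtain y where y: "w - j (T y) \<in> N"
      using onto by blast
    obtain x b where xb: "x \<in> Z" "b \<in> span B" "T y = x + b"
      using B(2) by blast
    have "(w - j (T y)) + j x \<in> N"
      using y xb(1) by (auto simp: Z_def intro: subspace_add[OF N(1)])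
    moreover have "j b \<in> span (j ` B)"
      using xb(2) by (simp add: linear_span_image[OF j.linear])
    moreover have "w = ((w - j (T y)) + j x) + j b"
      by (simp add: xb(3) j.add)
    ultimately show ?thesis
      by blast
  qed
  then have "finite_codim scaleR N"
    using B(1) unfolding finite_codim_scaleR_iff by (intro exI[of _ "j ` B"]) auto
  with N(3) show False
    by blast
qed

text \<open>If \<open>T\<close> is onto modulo the real subspace \<open>W\<close>, then \<open>T \<oplus> T\<close> is onto modulo the pairs formed from
  \<open>W\<close>. The open mapping theorem bounds the preimages, so that once the range of the first coordinate
  is close enough to a larger subspace \<open>M\<close>, the second coordinate is approximately onto modulo
  \<open>M\<close>, hence onto.\<close>

theorem strictly_cosingular_complex_iff_real:
  fixes T :: "'y::complex_banach \<Rightarrow> 'z::complex_banach"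
  assumes T: "bounded_op scaleC scaleC T"
  shows "strictly_cosingular scaleC T \<longleftrightarrow> strictly_cosingular scaleR T"
proof
  {
    assume "strictly_cosingular scaleR T"
    then show "strictly_cosingular scaleC T"
      unfolding strictly_cosingular_scaleC_iff strictly_cosingular_scaleR_iff by blast
  }
  assume sc: "strictly_cosingular scaleC T"
  have Tl: "bounded_linear T" and Ti: "T (\<i> *\<^sub>C x) = \<i> *\<^sub>C T x" for x
    using T by (simp_all add: bounded_op_complex_iff complex_structure_scaleC)
  interpret T: bounded_linear T by (rule Tl)
  interpret complex_structure "conj_pair_scale :: complex \<Rightarrow> 'z \<times> 'z \<Rightarrow> _"
    by (rule complex_structure_conj_pair)
  have False if W: "subspace W" "closed W" "\<not> finite_codim scaleR W"
    and onto: "\<And>z. \<exists>y. z - T y \<in> W" for W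
  proof -
    let ?K = "conj_pairs W"
    have K: "C.subspace ?K" "closed ?K"
      using subspace_conj_pairs[OF W(1)] closed_conj_pairs[OF W(1,2)] by auto
    have Kinf: "\<not> finite_codim conj_pair_scale ?K"
      unfolding finite_codim_complex_iff
    proof
      assume "finite_codim scaleR ?K"
      then obtain B where B: "finite B" "\<And>z. \<exists>x\<in>?K. \<exists>b\<in>span B. z = x + b"
        by (auto simp: finite_codim_scaleR_iff)
      define h where "h x = fst x + snd x" for x :: "'z \<times> 'z"
      have h: "linear h"
        unfolding h_def by (intro bounded_linear.linear bounded_linear_intros)
      have "\<exists>x\<in>W. \<exists>b\<in>span (h ` B). z = x + b" for z
      proof -
        obtain x b where xb: "x \<in> ?K" "b \<in> span B" "(z, 0) = x + b"
          using B(2) by blast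
        have "h x \<in> W"
          using xb(1) by (auto simp: conj_pairs_def h_def)
        moreover have "h b \<in> span (h ` B)"
          using xb(2) by (simp add: linear_span_image[OF h])
        moreover have "z = h x + h b"
          unfolding linear_add[OF h, symmetric] xb(3)[symmetric] by (simp add: h_def)
        ultimately show ?thesis
          by blast
      qed
      then have "finite_codim scaleR W"
        using B(1) unfolding finite_codim_scaleR_iff by (intro exI[of _ "h ` B"]) auto
      with W(3) show False
        by blast
    qed
    have not_onto: "\<exists>w. \<forall>y. w - (T y, 0) \<notin> N" "\<exists>w. \<forall>y. w - (0, T y) \<notin> N"
      if N: "C.subspace N" "closed N" "\<not> finite_codim conj_pair_scale N" for N
    proof -
      have N': "subspace N" "\<not> finite_codim scaleR N"
        using N by (simp_all add: subspace_complex_iff finite_codim_complex_iff)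
      have "bounded_linear (\<lambda>z::'z. (z, 0::'z))" "bounded_linear (\<lambda>z::'z. (0::'z, z))"
        by (intro bounded_linear_Pair bounded_linear_ident bounded_linear_zero)+
      moreover have "(\<i> *\<^sub>C z, 0) \<in> N" if "(z, 0) \<in> N" for z
        using C.subspace_scale[OF N(1) that, of \<i>] by (simp add: conj_pair_scale_def minus_scaleC)
      moreover have "(0, \<i> *\<^sub>C z) \<in> N" if "(0, z) \<in> N" for z
        using C.subspace_scale[OF N(1) that, of "- \<i>"] by (simp add: conj_pair_scale_def minus_scaleC)
      ultimately show "\<exists>w. \<forall>y. w - (T y, 0) \<notin> N" "\<exists>w. \<forall>y. w - (0, T y) \<notin> N"
        using strictly_cosingular_not_onto_modulo[OF sc _ N'(1) N(2) N'(2)] by blast+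
    qed
    define f where "f p = (T (fst (fst p)), T (snd (fst p))) + snd p"
      for p :: "('y \<times> 'y) \<times> ('z \<times> 'z)"
    define D :: "(('y \<times> 'y) \<times> ('z \<times> 'z)) set" where "D = UNIV \<times> ?K"
    have f: "bounded_linear f"
      unfolding f_def
      by (intro bounded_linear_add bounded_linear_Pair bounded_linear_compose[OF Tl]
          bounded_linear_fst_comp bounded_linear_snd_comp bounded_linear_intros)
    have D: "closed D" "subspace D"
      unfolding D_def using K by (auto simp: closed_Times subspace_Times subspace_complex_iff)
    have "f ` D = UNIV"
    proof -
      have "w \<in> f ` D" for w
      proof -
        obtain u v where uv: "w = (u, v)"
          by (cases w)
        obtain a b where a: "(u + v) - T a \<in> W" and b: "\<i> *\<^sub>C (u - v) - T b \<in> W"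
          using onto by metis
        \<comment> \<open>The solution of \<open>y + y' = a\<close> and \<open>\<i> (y - y') = b\<close>.\<close>
        define y where "y = (1/2) *\<^sub>R (a - \<i> *\<^sub>C b)"
        define y' where "y' = (1/2) *\<^sub>R (a + \<i> *\<^sub>C b)"
        have ya: "y + y' = a" "y - y' = - (\<i> *\<^sub>C b)"
          by (simp_all add: y_def y'_def algebra_simps flip: scaleR_left_distrib)
        have "(u - T y) + (v - T y') = (u + v) - T a"
          by (simp add: ya(1)[symmetric] T.add)
        moreover have "\<i> *\<^sub>C ((u - T y) - (v - T y')) = \<i> *\<^sub>C (u - v) - T b"
        proof -
          have "T b = \<i> *\<^sub>C T (y - y')"
            by (simp add: ya(2) linear_neg[OF T.linear] Ti minus_scaleC ii_scaleC)
          then show ?thesis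
            by (simp add: T.diff minus_scaleC scaleC_add_right algebra_simps)
        qed
        ultimately have "(u - T y, v - T y') \<in> ?K"
          using a b by (simp only: conj_pairs_def mem_Collect_eq case_prod_conv)
        then have "((y, y'), (u - T y, v - T y')) \<in> D"
          by (simp add: D_def)
        then show ?thesis
          by (rule rev_image_eqI) (simp add: f_def uv)
      qed
      then show ?thesis
        by blast
    qed
    then obtain L where L: "L \<ge> 0" "\<And>w. \<exists>p\<in>D. f p = w \<and> norm p \<le> L * norm w"
      using open_mapping[OF f D] by blast
    \<comment> \<open>With \<open>\<epsilon> L \<le> 1 / 2\<close>, neglecting the first coordinate costs at most half of the norm.\<close>
    define \<epsilon> where "\<epsilon> = 1 / (2 * (L + 1))"
    have \<epsilon>: "\<epsilon> > 0" "\<epsilon> * L \<le> 1 / 2"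
      using L(1) by (simp_all add: \<epsilon>_def field_simps)
    obtain M where M: "C.subspace M" "closed M" "?K \<subseteq> M" "\<not> finite_codim conj_pair_scale M"
      and approx: "\<And>y. \<exists>m\<in>M. norm ((T y, 0) - m) \<le> \<epsilon> * norm y"
    proof (rule exists_subspace_approximating_range[of "\<lambda>y. (T y, 0)" scaleC ?K \<epsilon>])
      show "bounded_linear (\<lambda>y. (T y, 0::'z))"
        by (intro bounded_linear_Pair Tl bounded_linear_zero)
      show "(T (\<i> *\<^sub>C y), 0) = conj_pair_scale \<i> (T y, 0)" for y
        by (simp add: conj_pair_scale_def Ti minus_scaleC)
    qed (use K Kinf not_onto \<epsilon> complex_structure_scaleC in auto)
    have M': "subspace M"
      using M(1) by (simp add: subspace_complex_iff)
    have "\<exists>y\<in>UNIV. \<exists>m\<in>M. norm y \<le> L * norm w \<and> norm (w - (0, T y) - m) \<le> norm w / 2" for w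
    proof -
      obtain y y' k where k: "k \<in> ?K" "(T y, T y') + k = w" "norm ((y, y'), k) \<le> L * norm w"
        using L(2)[of w] by (auto simp: D_def f_def)
      have "norm y \<le> norm (y, y')" "norm y' \<le> norm (y, y')" "norm (y, y') \<le> norm ((y, y'), k)"
        using norm_fst_le[of y y'] norm_snd_le[of y' y] norm_fst_le[of "(y, y')" k] by auto
      then have y: "norm y \<le> L * norm w" "norm y' \<le> L * norm w"
        using k(3) by linarith+
      obtain m where m: "m \<in> M" "norm ((T y, 0) - m) \<le> \<epsilon> * norm y"
        using approx by blast
      have eq: "w - (0, T y') - (m + k) = (T y, 0) - m"
        by (simp add: k(2)[symmetric] prod_eq_iff)
      have "\<epsilon> * norm y \<le> norm w / 2"
      proof -
        have "\<epsilon> * norm y \<le> \<epsilon> * (L * norm w)"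
          using y(1) \<epsilon>(1) by (intro mult_left_mono) auto
        also have "\<dots> \<le> (1 / 2) * norm w"
          using mult_right_mono[OF \<epsilon>(2) norm_ge_zero[of w]] by (simp add: mult.assoc)
        finally show ?thesis
          by simp
      qed
      then have "norm (w - (0, T y') - (m + k)) \<le> norm w / 2"
        unfolding eq using m(2) by linarith
      moreover have "m + k \<in> M"
        using m(1) k(1) M(3) M' by (intro subspace_add) auto
      ultimately show ?thesis
        using y(2) by (intro bexI[of _ y'] bexI[of _ "m + k"]) auto
    qed
    then have "\<exists>y\<in>UNIV. w - (0, T y) \<in> M \<and> norm y \<le> 2 * L * norm w" for w
      by (intro onto_if_approximately_onto[OF _ _ _ M(2) M'] bounded_linear_Pair Tl
          bounded_linear_zero) auto
    then show False
      using not_onto(2)[OF M(1,2,4)] by blast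
  qed
  then show "strictly_cosingular scaleR T"
    unfolding strictly_cosingular_scaleR_iff by blast
qed

section \<open>Inessential operators\<close>

text \<open>Equality modulo maps of finite rank. It is a congruence for composition with linear maps, and
  Fredholm operators are the bounded operators that are invertible with respect to it.\<close>

definition ess_eq :: "('a \<Rightarrow> 'b::real_normed_vector) \<Rightarrow> ('a \<Rightarrow> 'b) \<Rightarrow> bool"
  where "ess_eq f g \<longleftrightarrow> (\<exists>B. finite B \<and> (\<forall>x. f x - g x \<in> span B))"

lemma ess_eq_trans [trans]:
  assumes "ess_eq f g" "ess_eq g h"
  shows "ess_eq f h"
proof -
  obtain B C where B: "finite B" "\<And>x. f x - g x \<in> span B" and C: "finite C" "\<And>x. g x - h x \<in> span C"
    using assms by (auto simp: ess_eq_def)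
  have "(f x - g x) + (g x - h x) \<in> span (B \<union> C)" for x
    using B(2)[of x] C(2)[of x] span_mono[of B "B \<union> C"] span_mono[of C "B \<union> C"]
    by (intro span_add) auto
  then show ?thesis
    using B(1) C(1) unfolding ess_eq_def by (intro exI[of _ "B \<union> C"]) simp
qed

lemma ess_eq_compose_left:
  assumes h: "linear h" and "ess_eq f g"
  shows "ess_eq (\<lambda>x. h (f x)) (\<lambda>x. h (g x))"
proof -
  obtain B where B: "finite B" "\<And>x. f x - g x \<in> span B"
    using assms by (auto simp: ess_eq_def)
  then have "h (f x) - h (g x) \<in> span (h ` B)" for x
    by (simp add: linear_diff[OF h, symmetric] linear_span_image[OF h])
  then show ?thesis
    using B(1) unfolding ess_eq_def by blast
qed

lemma ess_eq_compose_right: "ess_eq f g \<Longrightarrow> ess_eq (\<lambda>x. f (h x)) (\<lambda>x. g (h x))"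
  by (auto simp: ess_eq_def)

text \<open>The vectors of \<open>B\<close> are considered in turn, and a vector is discarded if it lies in the sum of \<open>R\<close> and
  the span of the vectors kept so far.\<close>

lemma finite_complement:
  fixes R :: "'a::real_vector set"
  assumes R: "subspace R" and B: "finite B"
  shows "\<exists>C. finite C \<and> R \<inter> span C = {0} \<and> (\<forall>x\<in>span B. \<exists>r\<in>R. \<exists>c\<in>span C. x = r + c)"
  using B
proof (induction B)
  case empty
  show ?case
    using subspace_0[OF R] by (intro exI[of _ "{}"]) auto
next
  case (insert b B)
  then obtain C where C: "finite C" "R \<inter> span C = {0}"
    and sum: "\<forall>x\<in>span B. \<exists>r\<in>R. \<exists>c\<in>span C. x = r + c"
    by auto
  show ?case
  proof (cases "\<exists>r\<in>R. \<exists>c\<in>span C. b = r + c")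
    case True
    then obtain r c where rc: "r \<in> R" "c \<in> span C" "b = r + c"
      by blast
    have "\<exists>r\<in>R. \<exists>c\<in>span C. x = r + c" if x: "x \<in> span (insert b B)" for x
    proof -
      obtain k where "x - k *\<^sub>R b \<in> span B"
        using x span_breakdown_eq by blast
      then obtain r' c' where rc': "r' \<in> R" "c' \<in> span C" "x - k *\<^sub>R b = r' + c'"
        using bspec[OF sum, of "x - k *\<^sub>R b"] by blast
      then have "x = (r' + k *\<^sub>R r) + (c' + k *\<^sub>R c)"
        by (simp add: rc(3) algebra_simps)
      moreover have "r' + k *\<^sub>R r \<in> R" "c' + k *\<^sub>R c \<in> span C"
        using rc rc' R by (auto intro: subspace_add subspace_scale span_add span_scale)
      ultimately show ?thesis
        by blast
    qed
    with C show ?thesis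
      by (intro exI[of _ C]) auto
  next
    case False
    have "r = 0" if r: "r \<in> R" "r \<in> span (insert b C)" for r
    proof -
      obtain k where k: "r - k *\<^sub>R b \<in> span C"
        using r span_breakdown_eq by blast
      have "k = 0"
      proof (rule ccontr)
        assume "k \<noteq> 0"
        then have "b = (1 / k) *\<^sub>R r + - ((1 / k) *\<^sub>R (r - k *\<^sub>R b))"
          by (simp add: scaleR_right_diff_distrib)
        moreover have "(1 / k) *\<^sub>R r \<in> R" "- ((1 / k) *\<^sub>R (r - k *\<^sub>R b)) \<in> span C"
          using r(1) k R by (auto intro: subspace_scale span_neg span_scale)
        ultimately show False
          using False by blast
      qed
      then show ?thesis
        using k r C(2) by auto
    qed
    then have "R \<inter> span (insert b C) = {0}"
      using subspace_0[OF R] span_zero by auto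
    moreover have "\<exists>r\<in>R. \<exists>c\<in>span (insert b C). x = r + c" if x: "x \<in> span (insert b B)" for x
    proof -
      obtain k where "x - k *\<^sub>R b \<in> span B"
        using x span_breakdown_eq by blast
      then obtain r' c' where rc': "r' \<in> R" "c' \<in> span C" "x - k *\<^sub>R b = r' + c'"
        using bspec[OF sum, of "x - k *\<^sub>R b"] by blast
      then have "x = r' + (c' + k *\<^sub>R b)"
        by (simp add: algebra_simps)
      moreover have "c' + k *\<^sub>R b \<in> span (insert b C)"
        using rc'(2) span_mono[of C "insert b C"] by (intro span_add span_scale) (auto intro: span_base)
      ultimately show ?thesis
        using rc'(1) by blast
    qed
    ultimately show ?thesis
      using C(1) by (intro exI[of _ "insert b C"]) auto
  qed
qed

lemma bounded_inverse:
  fixes f :: "'a::banach \<Rightarrow> 'b::banach"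
  assumes f: "bounded_linear f" and D: "closed D" "subspace D"
    and bij: "inj_on f D" "f ` D = UNIV"
  obtains g where "bounded_linear g" "\<And>y. g y \<in> D" "\<And>y. f (g y) = y" "\<And>x. x \<in> D \<Longrightarrow> g (f x) = x"
proof -
  interpret f: bounded_linear f by (rule f)
  define g where "g = inv_into D f"
  have gD: "g y \<in> D" and fg: "f (g y) = y" for y
    using bij(2) by (simp_all add: g_def inv_into_into f_inv_into_f)
  have gf: "g (f x) = x" if "x \<in> D" for x
    using that bij(1) by (simp add: g_def)
  obtain L where L: "\<And>y. \<exists>x\<in>D. f x = y \<and> norm x \<le> L * norm y"
    using open_mapping[OF f D bij(2)] by blast
  have "norm (g y) \<le> norm y * L" for y
    using L[of y] gf by (auto simp: mult.commute)
  moreover have "g (x + y) = g x + g y" for x y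
    using gf[OF subspace_add[OF D(2) gD[of x] gD[of y]]] by (simp add: f.add fg)
  moreover have "g (r *\<^sub>R x) = r *\<^sub>R g x" for r x
    using gf[OF subspace_scale[OF D(2) gD[of x], of r]] by (simp add: f.scaleR fg)
  ultimately have "bounded_linear g"
    by (intro bounded_linear_intro[where K = L])
  then show ?thesis
    using that gD fg gf by blast
qed

text \<open>Let \<open>P\<close> be a projection onto the kernel of \<open>S\<close> and let \<open>C\<close> span a complement of the range. The map
  \<open>(m, c) \<mapsto> S m + c\<close> is a bijection on the product of the kernel of \<open>P\<close> and the span of \<open>C\<close>, and its
  bounded inverse has the parametrix as its first component. The range of \<open>S\<close> is the zero set of
  the second component; it is therefore closed.\<close>

lemma parametrix_exists:
  fixes S :: "'a::banach \<Rightarrow> 'b::banach"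
  assumes S: "bounded_linear S" and ker: "finite_dim scaleR {x. S x = 0}"
    and ran: "finite_codim scaleR (range S)"
  obtains W where "bounded_linear W" "ess_eq (\<lambda>x. W (S x)) (\<lambda>x. x)" "ess_eq (\<lambda>y. S (W y)) (\<lambda>y. y)"
    "closed (range S)"
proof -
  interpret S: bounded_linear S by (rule S)
  obtain B where B: "finite B" "span B = {x. S x = 0}"
    using ker by (auto simp: finite_dim_scaleR_iff)
  obtain P where P: "bounded_linear P" "\<And>x. P x \<in> span B" "\<And>x. x \<in> span B \<Longrightarrow> P x = x"
    using finite_dim_projection[OF B(1)] by (metis rangeI subsetD)
  interpret P: bounded_linear P by (rule P(1))
  obtain B' where B': "finite B'" "\<And>z. \<exists>x\<in>range S. \<exists>y\<in>span B'. z = x + y"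
    using ran by (auto simp: finite_codim_scaleR_iff)
  have subR: "subspace (range S)"
    by (rule linear_subspace_image[OF S.linear subspace_UNIV])
  obtain C where C: "finite C" "range S \<inter> span C = {0}"
    "\<And>x. x \<in> span B' \<Longrightarrow> \<exists>r\<in>range S. \<exists>c\<in>span C. x = r + c"
    using finite_complement[OF subR B'(1)] by blast
  obtain Q where Q: "bounded_linear Q" "\<And>x. Q x \<in> span C" "\<And>x. x \<in> span C \<Longrightarrow> Q x = x"
    using finite_dim_projection[OF C(1)] by (metis rangeI subsetD)
  define D where "D = {x. P x = 0} \<times> span C"
  define f where "f p = S (fst p) + snd p" for p :: "'a \<times> 'b"
  have "closed {x. P x = 0}"
    by (intro closed_Collect_eq P.continuous_on continuous_on_id continuous_on_const)
  moreover have "span C = {x. Q x = x}"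
    using Q(2,3) by (auto, metis)
  then have "closed (span C)"
    by (simp add: closed_Collect_eq bounded_linear.continuous_on[OF Q(1) continuous_on_id]
        continuous_on_id)
  ultimately have clD: "closed D"
    unfolding D_def by (rule closed_Times)
  have "subspace {x. P x = 0}"
    by (auto simp: subspace_def P.zero P.add P.scaleR)
  then have subD: "subspace D"
    unfolding D_def by (intro subspace_Times subspace_span)
  have f: "bounded_linear f"
    unfolding f_def
    by (intro bounded_linear_add bounded_linear_compose[OF S] bounded_linear_intros)
  have PP: "P (x - P x) = 0" for x
    by (simp add: P.diff P(2,3))
  have SP: "S (P x) = 0" for x
    using P(2) B(2) by blast
  have "inj_on f D"
  proof (rule inj_onI)
    fix p p'
    assume "p \<in> D" "p' \<in> D" "f p = f p'"
    then have d: "p - p' \<in> D" "f (p - p') = 0"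
      using subspace_diff[OF subD] by (auto simp: linear_diff[OF bounded_linear.linear[OF f]])
    obtain m c where mc: "p - p' = (m, c)"
      by (cases "p - p'")
    have m: "P m = 0" "c \<in> span C" "S m + c = 0"
      using d by (auto simp: mc D_def f_def)
    then have "c = S (- m)"
      by (simp add: linear_neg[OF S.linear] add_eq_0_iff)
    then have "c = 0"
      using C(2) m(2) by blast
    with m have "S m = 0"
      by simp
    then have "m = 0"
      using P(3)[of m] m(1) B(2) by simp
    with \<open>c = 0\<close> mc show "p = p'"
      by (simp add: zero_prod_def[symmetric])
  qed
  moreover have "f ` D = UNIV"
  proof -
    have "z \<in> f ` D" for z
    proof -
      obtain x y where "y \<in> span B'" "z = S x + y"
        using B'(2)[of z] by blast
      moreover obtain x' c where "c \<in> span C" "y = S x' + c"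
        using C(3)[OF \<open>y \<in> span B'\<close>] by blast
      ultimately have "z = f ((x + x') - P (x + x'), c)" "((x + x') - P (x + x'), c) \<in> D"
        by (simp_all add: f_def D_def PP S.diff SP S.add)
      then show ?thesis
        by blast
    qed
    then show ?thesis
      by blast
  qed
  ultimately obtain g where g: "bounded_linear g" "\<And>y. g y \<in> D" "\<And>y. f (g y) = y"
    "\<And>p. p \<in> D \<Longrightarrow> g (f p) = p"
    using bounded_inverse[OF f clD subD] by blast
  have gS: "g (S x) = (x - P x, 0)" for x
    using g(4)[of "(x - P x, 0)"] by (simp add: D_def PP span_zero f_def S.diff SP)
  have Sg: "S (fst (g y)) = y - snd (g y)" for y
    using g(3)[of y] by (simp add: f_def algebra_simps)
  show ?thesis
  proof
    show "bounded_linear (\<lambda>y. fst (g y))"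
      by (rule bounded_linear_compose[OF bounded_linear_fst g(1)])
    show "ess_eq (\<lambda>x. fst (g (S x))) (\<lambda>x. x)"
      unfolding ess_eq_def using B(1) P(2) by (intro exI[of _ B]) (auto simp: gS intro: span_neg)
    show "ess_eq (\<lambda>y. S (fst (g y))) (\<lambda>y. y)"
      unfolding ess_eq_def
    proof (intro exI[of _ C] conjI allI C(1))
      fix y
      have "snd (g y) \<in> span C"
        using g(2)[of y] by (auto simp: D_def mem_Times_iff)
      then show "S (fst (g y)) - y \<in> span C"
        by (simp add: Sg span_neg)
    qed
    have "range S = {y. snd (g y) = 0}"
    proof
      show "{y. snd (g y) = 0} \<subseteq> range S"
      proof
        fix y
        assume "y \<in> {y. snd (g y) = 0}"
        then have "y = S (fst (g y))"
          by (simp add: Sg)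
        then show "y \<in> range S"
          by (rule range_eqI)
      qed
    qed (auto simp: gS)
    moreover have "closed {y. snd (g y) = 0}"
      by (intro closed_Collect_eq continuous_on_const continuous_on_snd
          bounded_linear.continuous_on[OF g(1)] continuous_on_id)
    ultimately show "closed (range S)"
      by simp
  qed
qed

text \<open>A left inverse confines the kernel to a finite-dimensional space, and a right inverse makes the range
  finite-codimensional; the range is then closed by the existence of a parametrix.\<close>

lemma fredholm_if_essentially_invertible:
  fixes A :: "'a::banach \<Rightarrow> 'b::banach"
  assumes A: "bounded_linear A" and L: "linear L" "ess_eq (\<lambda>x. L (A x)) (\<lambda>x. x)"
    and R: "ess_eq (\<lambda>y. A (R y)) (\<lambda>y. y)"
  shows "fredholm scaleR scaleR A"
proof -
  interpret A: bounded_linear A by (rule A)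
  obtain B where B: "finite B" "\<And>x. L (A x) - x \<in> span B"
    using L(2) by (auto simp: ess_eq_def)
  have "x \<in> span B" if "A x = 0" for x
    using B(2)[of x] that span_neg[of "- x" B] by (simp add: linear_0[OF L(1)])
  moreover have "subspace {x. A x = 0}"
    by (auto simp: subspace_def A.zero A.add A.scaleR)
  ultimately have ker: "finite_dim scaleR {x. A x = 0}"
    using B(1) by (intro finite_dim_scaleRI) auto
  obtain C where C: "finite C" "\<And>y. A (R y) - y \<in> span C"
    using R by (auto simp: ess_eq_def)
  have "\<exists>x\<in>range A. \<exists>y\<in>span C. z = x + y" for z
  proof (intro bexI)
    show "z = A (R z) + - (A (R z) - z)"
      by simp
  qed (use C(2) span_neg in blast)+
  then have ran: "finite_codim scaleR (range A)"
    using C(1) by (auto simp: finite_codim_scaleR_iff)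
  have "closed (range A)"
    using parametrix_exists[OF A ker ran] by blast
  then show ?thesis
    using A ker ran by (simp add: fredholm_def bounded_op_scaleR)
qed

text \<open>The kernel and the range are complex subspaces, whose dimension or codimension is finite over \<open>\<complex>\<close>
  and over \<open>\<real>\<close> simultaneously.\<close>

lemma fredholm_complex_iff_real:
  fixes S :: "'a::complex_banach \<Rightarrow> 'b::complex_banach"
  assumes S: "bounded_op scaleC scaleC S"
  shows "fredholm scaleC scaleC S \<longleftrightarrow> fredholm scaleR scaleR S"
proof -
  interpret a: complex_structure "scaleC :: complex \<Rightarrow> 'a \<Rightarrow> 'a"
    by (rule complex_structure_scaleC)
  interpret b: complex_structure "scaleC :: complex \<Rightarrow> 'b \<Rightarrow> 'b"
    by (rule complex_structure_scaleC)
  have Sl: "bounded_linear S" and Si: "S (\<i> *\<^sub>C x) = \<i> *\<^sub>C S x" for x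
    using S by (simp_all add: bounded_op_complex_iff complex_structure_scaleC)
  interpret S: bounded_linear S by (rule Sl)
  have "a.C.subspace {x. S x = 0}"
    unfolding a.subspace_complex_iff
    by (auto simp: subspace_def S.zero S.add S.scaleR Si)
  then show ?thesis
    using S Sl by (simp add: fredholm_def bounded_op_scaleR a.finite_dim_complex_iff
        b.finite_codim_complex_iff)
qed

definition linear_part :: "('a::complex_banach \<Rightarrow> 'b::complex_banach) \<Rightarrow> 'a \<Rightarrow> 'b"
  where "linear_part f x = (1 / 2) *\<^sub>R (f x - \<i> *\<^sub>C f (\<i> *\<^sub>C x))"

definition antilinear_part :: "('a::complex_banach \<Rightarrow> 'b::complex_banach) \<Rightarrow> 'a \<Rightarrow> 'b"
  where "antilinear_part f x = (1 / 2) *\<^sub>R (f x + \<i> *\<^sub>C f (\<i> *\<^sub>C x))"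

lemma linear_part_add_antilinear_part: "linear_part f x + antilinear_part f x = f x"
  by (simp add: linear_part_def antilinear_part_def flip: scaleR_right_distrib scaleR_2)

lemma
  assumes f: "bounded_linear f"
  shows bounded_linear_linear_part: "bounded_linear (linear_part f)"
    and bounded_linear_antilinear_part: "bounded_linear (antilinear_part f)"
    and linear_part_i: "linear_part f (\<i> *\<^sub>C x) = \<i> *\<^sub>C linear_part f x"
    and antilinear_part_i: "antilinear_part f (\<i> *\<^sub>C x) = - (\<i> *\<^sub>C antilinear_part f x)"
proof -
  have "bounded_linear (\<lambda>x. \<i> *\<^sub>C f (\<i> *\<^sub>C x))"
    by (rule bounded_linear_compose[OF bounded_linear_scaleC
          bounded_linear_compose[OF f bounded_linear_scaleC]])
  then show "bounded_linear (linear_part f)" "bounded_linear (antilinear_part f)"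
    unfolding linear_part_def[abs_def] antilinear_part_def[abs_def]
    by (intro bounded_linear_compose[OF bounded_linear_scaleR_right] bounded_linear_add
        bounded_linear_sub f; assumption)+
  have "f (- x) = - f x" for x
    by (rule linear_neg[OF bounded_linear.linear[OF f]])
  then show "linear_part f (\<i> *\<^sub>C x) = \<i> *\<^sub>C linear_part f x"
    "antilinear_part f (\<i> *\<^sub>C x) = - (\<i> *\<^sub>C antilinear_part f x)"
    by (simp_all add: linear_part_def antilinear_part_def scaleC_scaleR minus_scaleC
        scaleC_add_right ii_scaleC algebra_simps)
qed

text \<open>It follows that the linear part of a real parametrix of a complex operator is a parametrix too:
  taking linear parts commutes with composition with complex operators.\<close>

lemma ess_eq_linear_part_ident:
  assumes "ess_eq f (\<lambda>x. x)"
  shows "ess_eq (linear_part f) (\<lambda>x. x)"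
proof -
  interpret complex_structure "scaleC :: complex \<Rightarrow> 'a \<Rightarrow> 'a"
    by (rule complex_structure_scaleC)
  obtain B where B: "finite B" "\<And>x. f x - x \<in> span B"
    using assms by (auto simp: ess_eq_def)
  obtain B' where B': "finite B'" "C.span B = span B'"
    using finite_span_complex[OF B(1)] by blast
  have "linear_part f x - x \<in> span B'" for x
  proof -
    have "linear_part f x - x =
        (1 / 2) *\<^sub>R ((f x - x) - \<i> *\<^sub>C (f (\<i> *\<^sub>C x) - \<i> *\<^sub>C x))"
      by (simp add: linear_part_def minus_scaleC ii_scaleC algebra_simps flip: scaleR_left_distrib)
    moreover have "f z - z \<in> C.span B" for z
      using B(2) span_subset_complex[of B] by blast
    then have "(f x - x) - \<i> *\<^sub>C (f (\<i> *\<^sub>C x) - \<i> *\<^sub>C x) \<in> C.span B"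
      by (intro C.span_diff[where x = "f x - x"] C.span_scale)
    ultimately show ?thesis
      by (simp add: B'(2) span_scale)
  qed
  then show ?thesis
    using B'(1) unfolding ess_eq_def by blast
qed

text \<open>Modulo finite rank, \<open>1 - U T\<close> is \<open>S (1 - R)\<close> with \<open>S = 1 - U\<^sub>0 T\<close> Fredholm, and \<open>R = W\<^sub>0 U\<^sub>1 T\<close> antilinear,
  where \<open>W\<^sub>0\<close> is a complex linear parametrix of \<open>S\<close>. As \<open>R\<^sup>2\<close> has the form \<open>U' T\<close> with \<open>U'\<close> complex
  linear, \<open>1 - R\<^sup>2\<close> is Fredholm; as it is a multiple of \<open>1 - R\<close> from the left and from the right,
  \<open>1 - R\<close> is invertible modulo finite rank.\<close>

theorem inessential_complex_iff_real:
  fixes T :: "'y::complex_banach \<Rightarrow> 'z::complex_banach"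
  assumes T: "bounded_op scaleC scaleC T"
  shows "inessential scaleC scaleC T \<longleftrightarrow> inessential scaleR scaleR T"
proof
  have Tl: "bounded_linear T" and Ti: "T (\<i> *\<^sub>C x) = \<i> *\<^sub>C T x" for x
    using T by (simp_all add: bounded_op_complex_iff complex_structure_scaleC)
  interpret T: bounded_linear T by (rule Tl)
  have op_iff: "bounded_op scaleC scaleC f \<longleftrightarrow>
      bounded_linear f \<and> (\<forall>x. f (\<i> *\<^sub>C x) = \<i> *\<^sub>C f x)"
    for f :: "'p::complex_banach \<Rightarrow> 'q::complex_banach"
    by (simp add: bounded_op_complex_iff complex_structure_scaleC)
  have id_minus: "bounded_op scaleC scaleC (\<lambda>x. x - U (T x))"
    if "bounded_op scaleC scaleC U" for U
    using that unfolding op_iff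
    by (auto intro!: bounded_linear_sub bounded_linear_ident bounded_linear_compose[OF _ Tl]
        simp: Ti minus_scaleC)
  {
    assume "inessential scaleR scaleR T"
    then show "inessential scaleC scaleC T"
      unfolding inessential_def
      using fredholm_complex_iff_real[OF id_minus] by (auto simp: op_iff bounded_op_scaleR)
  }
  assume iness: "inessential scaleC scaleC T"
  have parametrix: "\<exists>W. bounded_linear W \<and> ess_eq (\<lambda>x. W (x - U (T x))) (\<lambda>x. x) \<and>
      ess_eq (\<lambda>y. W y - U (T (W y))) (\<lambda>y. y)"
    if U: "bounded_op scaleC scaleC U" for U
  proof -
    have "fredholm scaleC scaleC (\<lambda>x. x - U (T x))"
      using iness U by (simp add: inessential_def)
    then have "fredholm scaleR scaleR (\<lambda>x. x - U (T x))"
      using fredholm_complex_iff_real[OF id_minus[OF U]] by simp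
    then obtain W where "bounded_linear W" "ess_eq (\<lambda>x. W (x - U (T x))) (\<lambda>x. x)"
      "ess_eq (\<lambda>y. W y - U (T (W y))) (\<lambda>y. y)"
      unfolding fredholm_def bounded_op_scaleR by (blast elim: parametrix_exists)
    then show ?thesis
      by blast
  qed
  have "fredholm scaleR scaleR (\<lambda>x. x - U (T x))" if U: "bounded_linear U" for U
  proof -
    define U0 where "U0 = linear_part U"
    define U1 where "U1 = antilinear_part U"
    have U0: "bounded_op scaleC scaleC U0"
      unfolding op_iff U0_def
      using bounded_linear_linear_part[OF U] linear_part_i[OF U] by blast
    have U1: "bounded_linear U1" "U1 (\<i> *\<^sub>C x) = - (\<i> *\<^sub>C U1 x)" for x
      unfolding U1_def
      using bounded_linear_antilinear_part[OF U] antilinear_part_i[OF U] by auto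
    define S where "S x = x - U0 (T x)" for x
    have "bounded_op scaleC scaleC S"
      unfolding S_def by (rule id_minus[OF U0])
    then have S: "bounded_linear S" "S (\<i> *\<^sub>C x) = \<i> *\<^sub>C S x" for x
      by (auto simp: op_iff)
    obtain W where W: "bounded_linear W" "ess_eq (\<lambda>x. W (S x)) (\<lambda>x. x)"
      "ess_eq (\<lambda>y. S (W y)) (\<lambda>y. y)"
      using parametrix[OF U0] unfolding S_def by blast
    define W0 where "W0 = linear_part W"
    have W0: "bounded_linear W0" "W0 (\<i> *\<^sub>C x) = \<i> *\<^sub>C W0 x" for x
      unfolding W0_def
      using bounded_linear_linear_part[OF W(1)] linear_part_i[OF W(1)] by auto
    have "S (W0 y) = linear_part (\<lambda>y. S (W y)) y" for y
      by (simp add: W0_def linear_part_def S(2)[symmetric]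
          linear_diff[OF bounded_linear.linear[OF S(1)]]
          linear_scale[OF bounded_linear.linear[OF S(1)]])
    then have SW0: "ess_eq (\<lambda>y. S (W0 y)) (\<lambda>y. y)"
      using ess_eq_linear_part_ident[OF W(3)] by (simp add: ess_eq_def)
    define R where "R x = W0 (U1 (T x))" for x
    have R: "bounded_linear R"
      unfolding R_def by (intro bounded_linear_compose[OF W0(1)] bounded_linear_compose[OF U1(1)] Tl)
    have "bounded_op scaleC scaleC (\<lambda>z. W0 (U1 (T (W0 (U1 z)))))"
      unfolding op_iff
    proof (intro conjI allI)
      show "bounded_linear (\<lambda>z. W0 (U1 (T (W0 (U1 z)))))"
        by (intro bounded_linear_compose[OF W0(1)] bounded_linear_compose[OF U1(1)]
            bounded_linear_compose[OF Tl] U1(1))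
      show "W0 (U1 (T (W0 (U1 (\<i> *\<^sub>C z))))) = \<i> *\<^sub>C W0 (U1 (T (W0 (U1 z))))" for z
        by (simp add: U1(2) W0(2) Ti linear_neg[OF bounded_linear.linear[OF W0(1)]]
            linear_neg[OF bounded_linear.linear[OF U1(1)]] linear_neg[OF T.linear])
    qed
    from parametrix[OF this] obtain W2 where W2: "bounded_linear W2"
      "ess_eq (\<lambda>x. W2 (x - R (R x))) (\<lambda>x. x)"
      "ess_eq (\<lambda>y. W2 y - R (R (W2 y))) (\<lambda>y. y)"
      unfolding R_def by blast
    have lins: "linear S" "linear W" "linear W2" "linear R"
      using S(1) W(1) W2(1) R by (simp_all add: bounded_linear.linear)
    let ?A = "\<lambda>x. x - U (T x)"
    have A: "ess_eq ?A (\<lambda>x. S (x - R x))"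
    proof -
      have "?A x - S (x - R x) = S (W0 (U1 (T x))) - U1 (T x)" for x
        using linear_part_add_antilinear_part[of U "T x"]
        by (simp add: linear_diff[OF lins(1)] R_def[symmetric])
          (simp add: S_def U0_def U1_def R_def algebra_simps)
      then show ?thesis
        using SW0 by (auto simp: ess_eq_def)
    qed
    \<comment> \<open>Left and right inverses of \<open>S (1 - R)\<close> are \<open>W\<^sub>2 (1 + R) W\<close> and \<open>(1 + R) W\<^sub>2 W\<close>.\<close>
    define L where "L y = W2 (W y + R (W y))" for y
    have "linear L"
      unfolding L_def by (intro linear_compose[unfolded comp_def, OF _ lins(3)] linear_compose_add
          linear_compose[unfolded comp_def, OF lins(2) lins(4)] lins)
    have "ess_eq (\<lambda>x. L (?A x)) (\<lambda>x. L (S (x - R x)))"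
      by (rule ess_eq_compose_left[OF \<open>linear L\<close> A])
    also have "ess_eq (\<lambda>x. L (S (x - R x))) (\<lambda>x. W2 ((x - R x) + R (x - R x)))"
      unfolding L_def
    proof (rule ess_eq_compose_left[OF lins(3)])
      have "linear (\<lambda>x. x + R x)"
        by (intro linear_compose_add linear_ident lins)
      from ess_eq_compose_left[OF this ess_eq_compose_right[OF W(2), of "\<lambda>x. x - R x"]]
      show "ess_eq (\<lambda>x. W (S (x - R x)) + R (W (S (x - R x)))) (\<lambda>x. (x - R x) + R (x - R x))" .
    qed
    also have "ess_eq (\<lambda>x. W2 ((x - R x) + R (x - R x))) (\<lambda>x. x)"
      using W2(2) by (simp add: linear_diff[OF lins(4)])
    finally have left: "ess_eq (\<lambda>x. L (?A x)) (\<lambda>x. x)" .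
    define V where "V y = W2 (W y) + R (W2 (W y))" for y
    have "ess_eq (\<lambda>y. ?A (V y)) (\<lambda>y. S (V y - R (V y)))"
      by (rule ess_eq_compose_right[OF A])
    also have "ess_eq (\<lambda>y. S (V y - R (V y))) (\<lambda>y. S (W y))"
    proof -
      have "V y - R (V y) = W2 (W y) - R (R (W2 (W y)))" for y
        by (simp add: V_def linear_add[OF lins(4)])
      then show ?thesis
        using ess_eq_compose_left[OF lins(1) ess_eq_compose_right[OF W2(3), of W]] by simp
    qed
    also have "ess_eq (\<lambda>y. S (W y)) (\<lambda>y. y)"
      by (rule W(3))
    finally have right: "ess_eq (\<lambda>y. ?A (V y)) (\<lambda>y. y)" .
    have "bounded_linear ?A"
      by (intro bounded_linear_sub bounded_linear_ident bounded_linear_compose[OF U Tl])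
    then show ?thesis
      by (rule fredholm_if_essentially_invertible[OF _ \<open>linear L\<close> left right])
  qed
  then show "inessential scaleR scaleR T"
    by (simp add: inessential_def bounded_op_scaleR)
qed

section \<open>Factorization through a space ideal\<close>

context banach_space
begin

lemma vnorm_zero: "vnorm V (vzero V) = 0"
  using norm_eq_zero zero_closed by simp

lemma scale_zero_left: "x \<in> vcarrier V \<Longrightarrow> vscale V 0 x = vzero V"
  using norm_eq_zero[OF scale_closed, of x 0] norm_scale[of x 0] by simp

lemma add_minus: "x \<in> vcarrier V \<Longrightarrow> vadd V x (vscale V (- 1) x) = vzero V"
  using scale_add_left[of x 1 "- 1"] by (simp add: scale_one scale_zero_left)

lemma vnorm_nonneg: "x \<in> vcarrier V \<Longrightarrow> 0 \<le> vnorm V x"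
  using norm_triangle[OF _ scale_closed, of x x "- 1"] norm_scale[of x "- 1"]
  by (simp add: add_minus vnorm_zero)

lemma vdist_nonneg: "x \<in> vcarrier V \<Longrightarrow> y \<in> vcarrier V \<Longrightarrow> 0 \<le> vdist V x y"
  by (simp add: vdist_def vnorm_nonneg add_closed scale_closed)

lemma add_swap:
  assumes "a \<in> vcarrier V" "b \<in> vcarrier V" "c \<in> vcarrier V" "d \<in> vcarrier V"
  shows "vadd V (vadd V a b) (vadd V c d) = vadd V (vadd V a c) (vadd V b d)"
proof -
  have "vadd V (vadd V a b) (vadd V c d) = vadd V a (vadd V (vadd V b c) d)"
    using assms by (simp add: add_assoc add_closed)
  also have "vadd V b c = vadd V c b"
    using assms by (simp add: add_commute)
  also have "vadd V a (vadd V (vadd V c b) d) = vadd V (vadd V a c) (vadd V b d)"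
    using assms by (simp add: add_assoc add_closed)
  finally show ?thesis .
qed

end

lemma nspace_op_bound_nonneg:
  assumes "banach_space V" "nspace_op V W f"
  obtains K where "K \<ge> 0" "\<And>x. x \<in> vcarrier V \<Longrightarrow> vnorm W (f x) \<le> vnorm V x * K"
proof -
  interpret banach_space V by (rule assms)
  obtain K where K: "\<And>x. x \<in> vcarrier V \<Longrightarrow> vnorm W (f x) \<le> vnorm V x * K"
    using assms(2) unfolding nspace_op_def by blast
  have "vnorm W (f x) \<le> vnorm V x * max K 0" if "x \<in> vcarrier V" for x
    using K[OF that] vnorm_nonneg[OF that] by (meson max.cobounded1 mult_left_mono order_trans)
  then show ?thesis
    using that[of "max K 0"] by simp
qed

lemma nspace_op_compose:
  assumes "banach_space V" "banach_space W" and f: "nspace_op V W f" and g: "nspace_op W X g"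
  shows "nspace_op V X (g \<circ> f)"
proof -
  obtain K where K: "\<And>x. x \<in> vcarrier V \<Longrightarrow> vnorm W (f x) \<le> vnorm V x * K"
    using nspace_op_bound_nonneg[OF assms(1) f] by blast
  obtain L where L: "L \<ge> 0" "\<And>x. x \<in> vcarrier W \<Longrightarrow> vnorm X (g x) \<le> vnorm W x * L"
    using nspace_op_bound_nonneg[OF assms(2) g] by blast
  have "vnorm X (g (f x)) \<le> vnorm V x * (K * L)" if x: "x \<in> vcarrier V" for x
  proof -
    have "vnorm X (g (f x)) \<le> vnorm W (f x) * L"
      using f x by (intro L) (simp add: nspace_op_def)
    also have "\<dots> \<le> (vnorm V x * K) * L"
      by (rule mult_right_mono[OF K[OF x] L(1)])
    finally show ?thesis
      by (simp add: mult.assoc)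
  qed
  then show ?thesis
    using f g by (auto simp: nspace_op_def intro!: exI[of _ "K * L"])
qed

lemma factors_through_isomorphic:
  assumes "factors_through V s1 s2 T" "nspace_isomorphic W V"
    and "banach_space V" "banach_space W" "banach_space (space_of s1)"
  shows "factors_through W s1 s2 T"
proof -
  obtain f g where f: "nspace_op W V f" and g: "nspace_op V W g"
    and fg: "\<And>y. y \<in> vcarrier V \<Longrightarrow> f (g y) = y"
    using assms(2) by (auto simp: nspace_isomorphic_def)
  obtain P Q where PQ: "nspace_op (space_of s1) V P" "nspace_op V (space_of s2) Q" "T = Q \<circ> P"
    using assms(1) by (auto simp: factors_through_def)
  have "P x \<in> vcarrier V" for x
    using PQ(1) by (simp add: nspace_op_def space_of_def)
  then have "T = (Q \<circ> f) \<circ> (g \<circ> P)"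
    by (simp add: PQ(3) fg fun_eq_iff)
  moreover have "nspace_op (space_of s1) W (g \<circ> P)"
    by (rule nspace_op_compose[OF assms(5,3) PQ(1) g])
  moreover have "nspace_op W (space_of s2) (Q \<circ> f)"
    by (rule nspace_op_compose[OF assms(4,3) f PQ(2)])
  ultimately show ?thesis
    unfolding factors_through_def by blast
qed

lemma banach_space_conj_space:
  assumes "banach_space V"
  shows "banach_space (conj_space V)"
proof -
  interpret banach_space V by (rule assms)
  have dist: "vdist (conj_space V) = vdist V"
    by (simp add: fun_eq_iff vdist_def conj_space_def)
  have rules: "vcarrier (conj_space V) = vcarrier V" "vadd (conj_space V) = vadd V"
    "vzero (conj_space V) = vzero V" "vscale (conj_space V) = (\<lambda>c. vscale V (cnj c))"
    "vnorm (conj_space V) = vnorm V"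
    by (simp_all add: conj_space_def)
  show ?thesis
  proof
    fix \<sigma> :: "nat \<Rightarrow> 'a"
    assume "\<And>n. \<sigma> n \<in> vcarrier (conj_space V)"
      and "\<And>e. e > 0 \<Longrightarrow> \<exists>N. \<forall>m\<ge>N. \<forall>n\<ge>N. vdist (conj_space V) (\<sigma> m) (\<sigma> n) < e"
    then show "\<exists>x\<in>vcarrier (conj_space V). (\<lambda>n. vdist (conj_space V) (\<sigma> n) x) \<longlonglongrightarrow> 0"
      unfolding rules dist by (rule complete)
  qed (auto simp: rules zero_closed add_closed scale_closed add_assoc add_zero add_inverse
      scale_add_right scale_add_left scale_scale scale_one norm_eq_zero norm_triangle norm_scale
      intro: add_commute)
qed

lemma banach_space_direct_sum:
  fixes V :: "('k::real_normed_field, 'a) nspace" and W :: "('k, 'b) nspace"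
  assumes "banach_space V" "banach_space W"
  shows "banach_space (direct_sum V W)"
proof -
  interpret V: banach_space V by (rule assms)
  interpret W: banach_space W by (rule assms)
  let ?D = "direct_sum V W"
  have carrier: "p \<in> vcarrier ?D \<longleftrightarrow> fst p \<in> vcarrier V \<and> snd p \<in> vcarrier W" for p
    by (simp add: direct_sum_def mem_Times_iff)
  have add: "vadd ?D p q = (vadd V (fst p) (fst q), vadd W (snd p) (snd q))" for p q
    by (simp add: direct_sum_def case_prod_beta)
  have scale: "vscale ?D c p = (vscale V c (fst p), vscale W c (snd p))" for c p
    by (simp add: direct_sum_def case_prod_beta)
  have zero: "vzero ?D = (vzero V, vzero W)"
    by (simp add: direct_sum_def)
  have nrm: "vnorm ?D p = vnorm V (fst p) + vnorm W (snd p)" for p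
    by (simp add: direct_sum_def case_prod_beta)
  have dist: "vdist ?D p q = vdist V (fst p) (fst q) + vdist W (snd p) (snd q)" for p q
    by (simp add: vdist_def add scale nrm)
  note rules = carrier add scale zero nrm
  show ?thesis
  proof
    fix x
    assume x: "x \<in> vcarrier ?D"
    then obtain a b where "a \<in> vcarrier V" "vadd V a (fst x) = vzero V"
      "b \<in> vcarrier W" "vadd W b (snd x) = vzero W"
      using V.add_inverse W.add_inverse by (meson carrier)
    then show "\<exists>y\<in>vcarrier ?D. vadd ?D y x = vzero ?D"
      by (intro bexI[of _ "(a, b)"]) (simp_all add: rules)
    show "vnorm ?D x = 0 \<longleftrightarrow> x = vzero ?D"
      using x V.vnorm_nonneg[of "fst x"] W.vnorm_nonneg[of "snd x"]
      by (auto simp: rules add_nonneg_eq_0_iff V.norm_eq_zero W.norm_eq_zero prod_eq_iff)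
  next
    fix x y
    assume "x \<in> vcarrier ?D" "y \<in> vcarrier ?D"
    then show "vnorm ?D (vadd ?D x y) \<le> vnorm ?D x + vnorm ?D y"
      using V.norm_triangle[of "fst x" "fst y"] W.norm_triangle[of "snd x" "snd y"]
      by (simp add: rules)
  next
    fix \<sigma> :: "nat \<Rightarrow> 'a \<times> 'b"
    assume mem: "\<And>n. \<sigma> n \<in> vcarrier ?D"
      and Cauchy: "\<And>e. e > 0 \<Longrightarrow> \<exists>N. \<forall>m\<ge>N. \<forall>n\<ge>N. vdist ?D (\<sigma> m) (\<sigma> n) < e"
    have memV: "fst (\<sigma> n) \<in> vcarrier V" and memW: "snd (\<sigma> n) \<in> vcarrier W" for n
      using mem[of n] by (simp_all add: carrier)
    have le: "vdist V (fst (\<sigma> m)) (fst (\<sigma> n)) \<le> vdist ?D (\<sigma> m) (\<sigma> n)"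
      "vdist W (snd (\<sigma> m)) (snd (\<sigma> n)) \<le> vdist ?D (\<sigma> m) (\<sigma> n)" for m n
      using V.vdist_nonneg[OF memV memV, of m n] W.vdist_nonneg[OF memW memW, of m n]
      by (simp_all add: dist)
    obtain a where a: "a \<in> vcarrier V" "(\<lambda>n. vdist V (fst (\<sigma> n)) a) \<longlonglongrightarrow> 0"
      using V.complete[of "\<lambda>n. fst (\<sigma> n)"] memV Cauchy le(1) by (meson le_less_trans)
    obtain b where b: "b \<in> vcarrier W" "(\<lambda>n. vdist W (snd (\<sigma> n)) b) \<longlonglongrightarrow> 0"
      using W.complete[of "\<lambda>n. snd (\<sigma> n)"] memW Cauchy le(2) by (meson le_less_trans)
    have "(\<lambda>n. vdist ?D (\<sigma> n) (a, b)) \<longlonglongrightarrow> 0"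
      using tendsto_add[OF a(2) b(2)] by (simp add: dist)
    then show "\<exists>x\<in>vcarrier ?D. (\<lambda>n. vdist ?D (\<sigma> n) x) \<longlonglongrightarrow> 0"
      using a(1) b(1) by (intro bexI[of _ "(a, b)"]) (simp_all add: carrier)
  qed (auto simp: rules V.zero_closed W.zero_closed V.add_closed W.add_closed V.scale_closed
      W.scale_closed V.add_assoc W.add_assoc V.add_zero W.add_zero
      V.scale_add_right W.scale_add_right V.scale_add_left W.scale_add_left V.scale_scale
      W.scale_scale V.scale_one W.scale_one V.norm_scale W.norm_scale distrib_left intro: V.add_commute W.add_commute)
qed

text \<open>The structure of \<open>V\<close> carried over along an injective map \<open>\<phi>\<close>. It moves direct sums, which live in
  a product type, back into the universe of the space ideal.\<close>

definition transport :: "('a \<Rightarrow> 'b) \<Rightarrow> ('k, 'a) nspace \<Rightarrow> ('k, 'b) nspace"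
  where "transport \<phi> V = (let \<psi> = inv_into (vcarrier V) \<phi> in \<lparr>
    vcarrier = \<phi> ` vcarrier V,
    vadd = (\<lambda>x y. \<phi> (vadd V (\<psi> x) (\<psi> y))),
    vzero = \<phi> (vzero V),
    vscale = (\<lambda>c x. \<phi> (vscale V c (\<psi> x))),
    vnorm = (\<lambda>x. vnorm V (\<psi> x))\<rparr>)"

lemma
  fixes V :: "('k::real_normed_field, 'a) nspace"
  assumes "banach_space V" and inj: "inj_on \<phi> (vcarrier V)"
  shows banach_space_transport: "banach_space (transport \<phi> V)"
    and nspace_isomorphic_transport: "nspace_isomorphic (transport \<phi> V) V"
proof -
  interpret banach_space V by (rule assms)
  let ?W = "transport \<phi> V"
  define \<psi> where "\<psi> = inv_into (vcarrier V) \<phi>"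
  have \<psi>: "\<psi> (\<phi> x) = x" if "x \<in> vcarrier V" for x
    using that inj by (simp add: \<psi>_def)
  have rules: "vcarrier ?W = \<phi> ` vcarrier V" "vadd ?W x y = \<phi> (vadd V (\<psi> x) (\<psi> y))"
    "vzero ?W = \<phi> (vzero V)" "vscale ?W c x = \<phi> (vscale V c (\<psi> x))" "vnorm ?W x = vnorm V (\<psi> x)"
    for x y c
    by (simp_all add: transport_def \<psi>_def Let_def)
  have dist: "vdist ?W (\<phi> x) (\<phi> y) = vdist V x y" if "x \<in> vcarrier V" "y \<in> vcarrier V" for x y
    using that by (simp add: vdist_def rules \<psi> scale_closed add_closed)
  note closed = zero_closed add_closed scale_closed
  show "banach_space ?W"
  proof
    fix x
    assume "x \<in> vcarrier ?W"
    then obtain a where a: "a \<in> vcarrier V" "x = \<phi> a"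
      by (auto simp: rules)
    then obtain b where "b \<in> vcarrier V" "vadd V b a = vzero V"
      using add_inverse by blast
    with a show "\<exists>y\<in>vcarrier ?W. vadd ?W y x = vzero ?W"
      by (intro bexI[of _ "\<phi> b"]) (simp_all add: rules \<psi>)
    show "vnorm ?W x = 0 \<longleftrightarrow> x = vzero ?W"
      using a inj zero_closed by (auto simp: rules \<psi> norm_eq_zero dest: inj_onD)
  next
    fix \<sigma> :: "nat \<Rightarrow> 'b"
    assume mem: "\<And>n. \<sigma> n \<in> vcarrier ?W"
      and Cauchy: "\<And>e. e > 0 \<Longrightarrow> \<exists>N. \<forall>m\<ge>N. \<forall>n\<ge>N. vdist ?W (\<sigma> m) (\<sigma> n) < e"
    have "\<exists>a. a \<in> vcarrier V \<and> \<sigma> n = \<phi> a" for n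
      using mem[of n] by (auto simp: rules)
    then obtain \<tau> where \<tau>: "\<And>n. \<tau> n \<in> vcarrier V" "\<And>n. \<sigma> n = \<phi> (\<tau> n)"
      by metis
    obtain a where a: "a \<in> vcarrier V" "(\<lambda>n. vdist V (\<tau> n) a) \<longlonglongrightarrow> 0"
      using complete[of \<tau>] \<tau>(1) Cauchy by (auto simp: \<tau> dist)
    then show "\<exists>x\<in>vcarrier ?W. (\<lambda>n. vdist ?W (\<sigma> n) x) \<longlonglongrightarrow> 0"
      by (intro bexI[of _ "\<phi> a"]) (simp_all add: rules(1) \<tau> dist)
  qed (auto simp: rules \<psi> closed add_assoc add_zero scale_add_right scale_add_left scale_scale
      scale_one norm_triangle norm_scale intro!: arg_cong[where f = \<phi>] add_commute)
  have "nspace_op ?W V \<psi>" "nspace_op V ?W \<phi>"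
    unfolding nspace_op_def by (auto simp: rules \<psi> closed intro!: exI[of _ 1])
  then show "nspace_isomorphic ?W V"
    unfolding nspace_isomorphic_def using \<psi> by (intro exI[of _ \<psi>] exI[of _ \<phi>]) (auto simp: rules)
qed

text \<open>A nonzero space contains the multiples of a nonzero vector, so its carrier is infinite and
  equinumerous with its square.\<close>

lemma (in banach_space) inj_on_carrier_square:
  obtains \<phi> :: "'a \<times> 'a \<Rightarrow> 'a" where "inj_on \<phi> (vcarrier V \<times> vcarrier V)"
proof (cases "vcarrier V = {vzero V}")
  case True
  then show ?thesis
    using that[of "\<lambda>_. vzero V"] by simp
next
  case False
  then obtain x where x: "x \<in> vcarrier V" "x \<noteq> vzero V"
    using zero_closed by blast
  have "inj (\<lambda>n. vscale V (of_nat n) x)"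
  proof (rule injI)
    fix m n :: nat
    assume "vscale V (of_nat m) x = vscale V (of_nat n) x"
    from arg_cong[OF this, of "vnorm V"]
    have "real m * vnorm V x = real n * vnorm V x"
      by (simp add: norm_scale x)
    then show "m = n"
      using x norm_eq_zero by simp
  qed
  then have "infinite (range (\<lambda>n. vscale V (of_nat n) x))"
    using range_inj_infinite by blast
  then have "infinite (vcarrier V)"
    using scale_closed[OF x(1)] by (meson finite_subset image_subsetI)
  then have "\<exists>\<phi>. bij_betw \<phi> (vcarrier V \<times> vcarrier V) (vcarrier V)"
    using card_of_Times_same_infinite card_of_ordIso by blast
  then show ?thesis
    using that bij_betw_imp_inj_on by blast
qed

lemma nspace_op_into_complexI:
  fixes X :: "(complex, 'u) nspace" and f :: "'y::complex_banach \<Rightarrow> 'u"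
  assumes "banach_space X" and f: "nspace_op (space_of scaleR) (real_space X) f"
    and i: "\<And>y. f (\<i> *\<^sub>C y) = vscale X \<i> (f y)"
  shows "nspace_op (space_of scaleC) X f"
proof -
  interpret X: banach_space X by (rule assms)
  have mem: "f y \<in> vcarrier X" and add: "f (y + z) = vadd X (f y) (f z)"
    and scale: "f (r *\<^sub>R y) = vscale X (complex_of_real r) (f y)" for y z r
    using f by (auto simp: nspace_op_def space_of_def real_space_def)
  have "f (c *\<^sub>C y) = vscale X c (f y)" for c y
  proof -
    have "f (c *\<^sub>C y) = f (Re c *\<^sub>R y + Im c *\<^sub>R (\<i> *\<^sub>C y))"
      using complex_structure.decompose[OF complex_structure_scaleC, of c y] by simp
    also have "\<dots> = vscale X (complex_of_real (Re c) + complex_of_real (Im c) * \<i>) (f y)"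
      by (simp add: add scale i X.scale_scale X.scale_add_left mem)
    also have "complex_of_real (Re c) + complex_of_real (Im c) * \<i> = c"
      by (simp add: complex_eq_iff)
    finally show ?thesis .
  qed
  then show ?thesis
    using f by (simp add: nspace_op_def space_of_def real_space_def)
qed

lemma nspace_op_from_complexI:
  fixes X :: "(complex, 'u) nspace" and f :: "'u \<Rightarrow> 'z::complex_banach"
  assumes "banach_space X" and f: "nspace_op (real_space X) (space_of scaleR) f"
    and i: "\<And>x. x \<in> vcarrier X \<Longrightarrow> f (vscale X \<i> x) = \<i> *\<^sub>C f x"
  shows "nspace_op X (space_of scaleC) f"
proof -
  interpret X: banach_space X by (rule assms)
  have add: "x \<in> vcarrier X \<Longrightarrow> y \<in> vcarrier X \<Longrightarrow> f (vadd X x y) = f x + f y"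
    and scale: "x \<in> vcarrier X \<Longrightarrow> f (vscale X (complex_of_real r) x) = r *\<^sub>R f x" for x y r
    using f by (auto simp: nspace_op_def space_of_def real_space_def)
  have "f (vscale X c x) = c *\<^sub>C f x" if x: "x \<in> vcarrier X" for c x
  proof -
    have "c = complex_of_real (Re c) + complex_of_real (Im c) * \<i>"
      by (simp add: complex_eq_iff)
    then have "vscale X c x =
        vadd X (vscale X (complex_of_real (Re c)) x) (vscale X (complex_of_real (Im c)) (vscale X \<i> x))"
      using X.scale_add_left[OF x] by (metis X.scale_scale[OF x])
    then have "f (vscale X c x) = Re c *\<^sub>R f x + Im c *\<^sub>R (\<i> *\<^sub>C f x)"
      using x by (simp add: add scale i X.scale_closed)
    then show ?thesis
      using complex_structure.decompose[OF complex_structure_scaleC, of c "f x"] by simp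
  qed
  then show ?thesis
    using f by (simp add: nspace_op_def space_of_def real_space_def)
qed

text \<open>For \<open>k = - \<i>\<close> the map \<open>g\<close> is twice the complex linear part of \<open>f\<close>, for \<open>k = \<i>\<close> twice its antilinear
  part. The condition on \<open>k\<close> covers both.\<close>

lemma nspace_op_twist_into:
  fixes X :: "(complex, 'u) nspace" and f :: "'y::complex_banach \<Rightarrow> 'u"
  assumes "banach_space X" and f: "nspace_op (space_of scaleR) (real_space X) f"
    and k: "k * k = - 1"
  defines "g \<equiv> \<lambda>y. vadd X (f y) (vscale X k (f (\<i> *\<^sub>C y)))"
  shows "nspace_op (space_of scaleR) (real_space X) g"
    and "g (\<i> *\<^sub>C y) = vscale X (- k) (g y)"
proof -
  interpret X: banach_space X by (rule assms)
  have mem: "f y \<in> vcarrier X" and add: "f (y + z) = vadd X (f y) (f z)"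
    and scale: "f (r *\<^sub>R y) = vscale X (complex_of_real r) (f y)" for y z r
    using f by (auto simp: nspace_op_def space_of_def real_space_def)
  note closed = mem X.scale_closed X.add_closed
  have "cmod k * cmod k = 1"
    using k by (metis norm_minus_cancel norm_mult norm_one)
  then have k1: "cmod k = 1"
    by (metis abs_1 abs_norm_cancel real_sqrt_abs2 real_sqrt_one)
  obtain K where K: "\<And>y. vnorm X (f y) \<le> norm y * K"
    using f by (auto simp: nspace_op_def space_of_def real_space_def)
  have "vnorm X (g y) \<le> norm y * (2 * K)" for y
    using X.norm_triangle[of "f y" "vscale X k (f (\<i> *\<^sub>C y))"] K[of y] K[of "\<i> *\<^sub>C y"]
    by (simp add: g_def closed X.norm_scale k1 norm_scaleC)
  moreover have "g (y + z) = vadd X (g y) (g z)" for y z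
    unfolding g_def by (simp add: scaleC_add_right add X.scale_add_right X.add_swap closed)
  moreover have "g (r *\<^sub>R y) = vscale X (complex_of_real r) (g y)" for r y
    using complex_structure.scaleR_s[OF complex_structure_scaleC, of r \<i> y, symmetric]
    by (simp add: g_def scale X.scale_add_right X.scale_scale closed mult.commute)
  ultimately show "nspace_op (space_of scaleR) (real_space X) g"
    using closed by (auto simp: nspace_op_def space_of_def real_space_def g_def)
  have "f (\<i> *\<^sub>C \<i> *\<^sub>C y) = vscale X (- 1) (f y)"
    using complex_structure.i_i[OF complex_structure_scaleC, of y] scale[of "- 1" y] by simp
  then show "g (\<i> *\<^sub>C y) = vscale X (- k) (g y)"
    by (simp add: g_def X.scale_add_right X.scale_scale closed k X.scale_one)
      (simp add: X.add_commute closed)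
qed

text \<open>The counterpart for operators that start in a record space: twice the linear part for \<open>k = - \<i>\<close> and
  twice the antilinear part for \<open>k = \<i>\<close>.\<close>

lemma nspace_op_twist_from:
  fixes X :: "(complex, 'u) nspace" and f :: "'u \<Rightarrow> 'z::complex_banach"
  assumes "banach_space X" and f: "nspace_op (real_space X) (space_of scaleR) f"
    and k: "k * k = - 1"
  defines "g \<equiv> \<lambda>x. f x + k *\<^sub>C f (vscale X \<i> x)"
  shows "nspace_op (real_space X) (space_of scaleR) g"
    and "x \<in> vcarrier X \<Longrightarrow> g (vscale X \<i> x) = (- k) *\<^sub>C g x"
proof -
  interpret X: banach_space X by (rule assms)
  interpret Z: complex_structure "scaleC :: complex \<Rightarrow> 'z \<Rightarrow> 'z"
    by (rule complex_structure_scaleC)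
  have add: "x \<in> vcarrier X \<Longrightarrow> y \<in> vcarrier X \<Longrightarrow> f (vadd X x y) = f x + f y"
    and scale: "x \<in> vcarrier X \<Longrightarrow> f (vscale X (complex_of_real r) x) = r *\<^sub>R f x" for x y r
    using f by (auto simp: nspace_op_def space_of_def real_space_def)
  note closed = X.scale_closed X.add_closed
  have "cmod k * cmod k = 1"
    using k by (metis norm_minus_cancel norm_mult norm_one)
  then have k1: "cmod k = 1"
    by (metis abs_1 abs_norm_cancel real_sqrt_abs2 real_sqrt_one)
  obtain K where K: "\<And>x. x \<in> vcarrier X \<Longrightarrow> norm (f x) \<le> vnorm X x * K"
    using f unfolding nspace_op_def space_of_def real_space_def by (simp, blast)
  have "norm (g x) \<le> vnorm X x * (2 * K)" if "x \<in> vcarrier X" for x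
    using norm_triangle_ineq[of "f x" "k *\<^sub>C f (vscale X \<i> x)"] K[OF that]
      K[OF X.scale_closed[OF that], of \<i>] that
    by (simp add: g_def norm_scaleC k1 X.norm_scale)
  moreover have "g (vadd X x y) = g x + g y" if "x \<in> vcarrier X" "y \<in> vcarrier X" for x y
    using that by (simp add: g_def add X.scale_add_right closed scaleC_add_right)
  moreover have "g (vscale X (complex_of_real r) x) = r *\<^sub>R g x" if x: "x \<in> vcarrier X" for r x
  proof -
    have "vscale X \<i> (vscale X (complex_of_real r) x) = vscale X (complex_of_real r) (vscale X \<i> x)"
      using x by (simp add: X.scale_scale mult.commute)
    then show ?thesis
      using x by (simp add: g_def scale closed scaleR_right_distrib Z.scaleR_s)
  qed
  ultimately show "nspace_op (real_space X) (space_of scaleR) g"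
    by (auto simp: nspace_op_def space_of_def real_space_def)
  assume x: "x \<in> vcarrier X"
  have "f (vscale X \<i> (vscale X \<i> x)) = - f x"
    using scale[OF x, of "- 1"] x by (simp add: X.scale_scale)
  then show "g (vscale X \<i> x) = (- k) *\<^sub>C g x"
    by (simp add: g_def scaleC_add_right scaleC_scaleC k)
qed

text \<open>In \<open>Q \<circ> P = (Q\<^sub>0 + Q\<^sub>1) \<circ> (P\<^sub>0 + P\<^sub>1)\<close>, with linear parts \<open>Q\<^sub>0\<close>, \<open>P\<^sub>0\<close> and antilinear parts \<open>Q\<^sub>1\<close>, \<open>P\<^sub>1\<close>,
  the mixed terms are antilinear, so that the complex linear \<open>T\<close> is \<open>Q\<^sub>0 P\<^sub>0 + Q\<^sub>1 P\<^sub>1\<close>. Here \<open>P\<^sub>1\<close> and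
  \<open>Q\<^sub>1\<close> are complex linear into and out of the conjugate space.\<close>

lemma factors_through_direct_sum_conj:
  fixes T :: "'y::complex_banach \<Rightarrow> 'z::complex_banach" and X :: "(complex, 'u) nspace"
  assumes T: "bounded_op scaleC scaleC T" and "banach_space X"
    and fac: "factors_through (real_space X) scaleR scaleR T"
  shows "factors_through (direct_sum X (conj_space X)) scaleC scaleC T"
proof -
  interpret X: banach_space X by (rule assms)
  have conjX: "banach_space (conj_space X)"
    by (rule banach_space_conj_space[OF assms(2)])
  obtain P Q where P: "nspace_op (space_of scaleR) (real_space X) P"
    and Q: "nspace_op (real_space X) (space_of scaleR) Q" and TQP: "T = Q \<circ> P"
    using fac by (auto simp: factors_through_def)
  define P0 where "P0 y = vadd X (P y) (vscale X (- \<i>) (P (\<i> *\<^sub>C y)))" for y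
  define P1 where "P1 y = vadd X (P y) (vscale X \<i> (P (\<i> *\<^sub>C y)))" for y
  define Q0 where "Q0 x = Q x + (- \<i>) *\<^sub>C Q (vscale X \<i> x)" for x
  define Q1 where "Q1 x = Q x + \<i> *\<^sub>C Q (vscale X \<i> x)" for x
  have conj_real: "real_space (conj_space X) = real_space X"
    by (simp add: real_space_def conj_space_def)
  have P0: "nspace_op (space_of scaleC) X P0"
    using nspace_op_twist_into[OF assms(2) P, of "- \<i>"] unfolding P0_def
    by (intro nspace_op_into_complexI[OF assms(2)]) auto
  have P1: "nspace_op (space_of scaleC) (conj_space X) P1"
    using nspace_op_twist_into[OF assms(2) P, of \<i>] unfolding P1_def
    by (intro nspace_op_into_complexI[OF conjX]) (auto simp: conj_real, auto simp: conj_space_def)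
  have Q0: "nspace_op X (space_of scaleC) Q0"
    using nspace_op_twist_from[OF assms(2) Q, of "- \<i>"] unfolding Q0_def
    by (intro nspace_op_from_complexI[OF assms(2)]) auto
  have "nspace_op (real_space X) (space_of scaleR) Q1"
    and Q1i: "x \<in> vcarrier X \<Longrightarrow> Q1 (vscale X \<i> x) = (- \<i>) *\<^sub>C Q1 x" for x
    using nspace_op_twist_from[OF assms(2) Q, of \<i>] unfolding Q1_def by auto
  then have Q1: "nspace_op (conj_space X) (space_of scaleC) Q1"
  proof (intro nspace_op_from_complexI[OF conjX])
    fix x
    assume "x \<in> vcarrier (conj_space X)"
    then have x: "x \<in> vcarrier X"
      by (simp add: conj_space_def)
    have "Q1 x = Q1 (vscale X \<i> (vscale X (- \<i>) x))"
      using x by (simp add: X.scale_scale X.scale_one)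
    also have "\<dots> = (- \<i>) *\<^sub>C Q1 (vscale X (- \<i>) x)"
      by (rule Q1i[OF X.scale_closed[OF x]])
    finally have "\<i> *\<^sub>C Q1 x = (\<i> * - \<i>) *\<^sub>C Q1 (vscale X (- \<i>) x)"
      by (simp only: scaleC_scaleC)
    then show "Q1 (vscale (conj_space X) \<i> x) = \<i> *\<^sub>C Q1 x"
      using scaleC_of_real[of 1 "Q1 (vscale X (- \<i>) x)"] by (simp add: conj_space_def)
  qed (simp add: conj_real)
  have sum_eq: "Q0 (P0 y) + Q1 (P1 y) = 4 *\<^sub>R T y" for y
  proof -
    have mem: "P y \<in> vcarrier X" for y
      using P by (auto simp: nspace_op_def space_of_def real_space_def)
    have add: "x \<in> vcarrier X \<Longrightarrow> y \<in> vcarrier X \<Longrightarrow> Q (vadd X x y) = Q x + Q y"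
      and scale: "x \<in> vcarrier X \<Longrightarrow> Q (vscale X (complex_of_real r) x) = r *\<^sub>R Q x" for x y r
      using Q by (auto simp: nspace_op_def space_of_def real_space_def)
    have neg: "Q (vscale X (- c) x) = - Q (vscale X c x)" if "x \<in> vcarrier X" for c x
      using scale[OF X.scale_closed[OF that], of "- 1" c] that by (simp add: X.scale_scale)
    have one: "vscale X 1 (P x) = P x" for x
      by (simp add: X.scale_one mem)
    have iT: "Q (P (\<i> *\<^sub>C y)) = \<i> *\<^sub>C Q (P y)"
      using T by (simp add: bounded_op_complex_iff complex_structure_scaleC TQP)
    have 1: "Q (P0 y) = Q (P y) - Q (vscale X \<i> (P (\<i> *\<^sub>C y)))"
      "Q (P1 y) = Q (P y) + Q (vscale X \<i> (P (\<i> *\<^sub>C y)))"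
      by (simp_all add: P0_def P1_def add neg mem X.scale_closed)
    have 2: "Q (vscale X \<i> (P0 y)) = Q (vscale X \<i> (P y)) + Q (P (\<i> *\<^sub>C y))"
      "Q (vscale X \<i> (P1 y)) = Q (vscale X \<i> (P y)) - Q (P (\<i> *\<^sub>C y))"
      by (simp_all add: P0_def P1_def add neg mem one X.scale_closed X.scale_add_right X.scale_scale)
    have "Q0 (P0 y) + Q1 (P1 y) = 2 *\<^sub>R Q (P y) - 2 *\<^sub>R (\<i> *\<^sub>C Q (P (\<i> *\<^sub>C y)))"
      by (simp add: Q0_def Q1_def 1 2 minus_scaleC scaleC_add_right scaleR_2)
    also have "\<dots> = 2 *\<^sub>R Q (P y) + 2 *\<^sub>R Q (P y)"
      by (simp add: iT ii_scaleC)
    finally show ?thesis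
      by (simp add: TQP flip: scaleR_left_distrib)
  qed
  define Pd where "Pd y = (P0 y, P1 y)" for y
  \<comment> \<open>Linear and antilinear parts have been doubled in both factors, hence the factor \<open>1 / 4\<close>.\<close>
  define Qd where "Qd p = (1 / 4) *\<^sub>R (Q0 (fst p) + Q1 (snd p))" for p
  let ?D = "direct_sum X (conj_space X)"
  obtain K0 where K0: "\<And>y. vnorm X (P0 y) \<le> norm y * K0"
    using P0 by (auto simp: nspace_op_def space_of_def)
  obtain K1 where K1: "\<And>y. vnorm (conj_space X) (P1 y) \<le> norm y * K1"
    using P1 by (auto simp: nspace_op_def space_of_def)
  have "vnorm ?D (Pd y) \<le> norm y * (K0 + K1)" for y
    using add_mono[OF K0[of y] K1[of y]] by (simp add: Pd_def direct_sum_def distrib_left)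
  then have Pd: "nspace_op (space_of scaleC) ?D Pd"
    using P0 P1 by (auto simp: nspace_op_def space_of_def direct_sum_def Pd_def)
  obtain L0 where L0: "L0 \<ge> 0" "\<And>x. x \<in> vcarrier X \<Longrightarrow> norm (Q0 x) \<le> vnorm X x * L0"
    using nspace_op_bound_nonneg[OF assms(2) Q0] by (auto simp: space_of_def)
  obtain L1 where L1: "L1 \<ge> 0" "\<And>x. x \<in> vcarrier X \<Longrightarrow> norm (Q1 x) \<le> vnorm X x * L1"
    using nspace_op_bound_nonneg[OF conjX Q1] by (auto simp: space_of_def conj_space_def)
  have Qd_bound: "norm (Qd p) \<le> vnorm ?D p * (L0 + L1)" if pD: "p \<in> vcarrier ?D" for p
  proof -
    obtain a b where p: "p = (a, b)" and ab: "a \<in> vcarrier X" "b \<in> vcarrier X"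
      using pD by (auto simp: direct_sum_def conj_space_def)
    have nonneg: "0 \<le> vnorm X a" "0 \<le> vnorm X b"
      using ab X.vnorm_nonneg by auto
    have "norm (Q0 a + Q1 b) \<le> vnorm X a * L0 + vnorm X b * L1"
      using norm_triangle_ineq[of "Q0 a" "Q1 b"] L0(2)[OF ab(1)] L1(2)[OF ab(2)] by linarith
    also have "\<dots> \<le> (vnorm X a + vnorm X b) * (L0 + L1)"
      using nonneg L0(1) L1(1) by (simp add: algebra_simps)
    finally have le: "norm (Q0 a + Q1 b) \<le> (vnorm X a + vnorm X b) * (L0 + L1)" .
    show ?thesis
      using le order_trans[OF norm_ge_zero le]
      by (simp add: Qd_def p direct_sum_def conj_space_def)
  qed
  have "nspace_op ?D (space_of scaleC) Qd"
    unfolding nspace_op_def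
  proof (intro conjI ballI allI)
    fix p q c
    assume p: "p \<in> vcarrier ?D"
    show "Qd (vscale ?D c p) = vscale (space_of scaleC) c (Qd p)"
      using p Q0 Q1 by (auto simp: nspace_op_def space_of_def direct_sum_def Qd_def scaleC_scaleR
          scaleC_add_right)
    assume q: "q \<in> vcarrier ?D"
    show "Qd (vadd ?D p q) = vadd (space_of scaleC) (Qd p) (Qd q)"
      using p q Q0 Q1 by (auto simp: nspace_op_def space_of_def direct_sum_def Qd_def algebra_simps)
  next
    show "\<exists>K. \<forall>p\<in>vcarrier ?D. vnorm (space_of scaleC) (Qd p) \<le> vnorm ?D p * K"
    proof (intro exI ballI)
      fix p
      assume "p \<in> vcarrier ?D"
      from Qd_bound[OF this]
      show "vnorm (space_of scaleC) (Qd p) \<le> vnorm ?D p * (L0 + L1)"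
        by (simp add: space_of_def)
    qed
  qed (simp add: space_of_def)
  moreover have "T = Qd \<circ> Pd"
    by (simp add: fun_eq_iff Qd_def Pd_def sum_eq)
  ultimately show ?thesis
    using Pd unfolding factors_through_def by blast
qed

lemma factors_through_real_space:
  fixes T :: "'y::complex_banach \<Rightarrow> 'z::complex_banach"
  assumes "factors_through X scaleC scaleC T"
  shows "factors_through (real_space X) scaleR scaleR T"
proof -
  obtain P Q where PQ: "nspace_op (space_of scaleC) X P" "nspace_op X (space_of scaleC) Q" "T = Q \<circ> P"
    using assms by (auto simp: factors_through_def)
  have "nspace_op (space_of scaleR) (real_space X) P" "nspace_op (real_space X) (space_of scaleR) Q"
    using PQ(1,2) by (simp_all add: nspace_op_def space_of_def real_space_def flip: scaleC_of_real)
  with PQ(3) show ?thesis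
    unfolding factors_through_def by blast
qed

theorem ideal_factorable_complex_iff_real:
  fixes T :: "'y::complex_banach \<Rightarrow> 'z::complex_banach" and A :: "(complex, 'u) nspace set"
  assumes T: "bounded_op scaleC scaleC T" and A: "complex_space_ideal A" "self_conjugate A"
  shows "(\<exists>X\<in>A. factors_through X scaleC scaleC T) \<longleftrightarrow>
    (\<exists>X\<in>A. factors_through (real_space X) scaleR scaleR T)"
proof
  assume "\<exists>X\<in>A. factors_through (real_space X) scaleR scaleR T"
  then obtain X where X: "X \<in> A" "factors_through (real_space X) scaleR scaleR T"
    by blast
  have bX: "banach_space X"
    using A(1) X(1) unfolding complex_space_ideal_def by (elim conjE) (rule bspec)
  then have conjX: "conj_space X \<in> A"
    using A(2) X(1) by (simp add: self_conjugate_def)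
  let ?D = "direct_sum X (conj_space X)"
  have bD: "banach_space ?D"
    by (rule banach_space_direct_sum[OF bX banach_space_conj_space[OF bX]])
  obtain \<phi> :: "'u \<times> 'u \<Rightarrow> 'u" where "inj_on \<phi> (vcarrier X \<times> vcarrier X)"
    by (rule banach_space.inj_on_carrier_square[OF bX])
  then have "inj_on \<phi> (vcarrier ?D)"
    by (simp add: direct_sum_def conj_space_def)
  note W = banach_space_transport[OF bD this] nspace_isomorphic_transport[OF bD this]
  have "\<forall>X\<in>A. \<forall>Y\<in>A. \<forall>W. banach_space W \<and> nspace_isomorphic W (direct_sum X Y) \<longrightarrow> W \<in> A"
    using A(1) unfolding complex_space_ideal_def by (elim conjE)
  then have "transport \<phi> ?D \<in> A"
    using X(1) conjX W by blast
  moreover have "factors_through (transport \<phi> ?D) scaleC scaleC T"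
    by (rule factors_through_isomorphic[OF factors_through_direct_sum_conj[OF T bX X(2)]
          W(2) bD W(1) banach_space_space_of_scaleC])
  ultimately show "\<exists>X\<in>A. factors_through X scaleC scaleC T"
    by blast
qed (use factors_through_real_space in blast)

theorem theorem1p3:
  fixes T :: "'y::complex_banach \<Rightarrow> 'z::complex_banach"
  assumes "bounded_op scaleC scaleC T"
  shows "(inessential scaleC scaleC T \<longleftrightarrow> inessential scaleR scaleR T) \<and>
    (strictly_singular scaleC T \<longleftrightarrow> strictly_singular scaleR T) \<and>
    (strictly_cosingular scaleC T \<longleftrightarrow> strictly_cosingular scaleR T) \<and>
    (\<forall>A :: (complex, 'u) nspace set. complex_space_ideal A \<and> self_conjugate A \<longrightarrow>
      ((\<exists>X\<in>A. factors_through X scaleC scaleC T) \<longleftrightarrow>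
       (\<exists>X\<in>A. factors_through (real_space X) scaleR scaleR T)))"
  using inessential_complex_iff_real[OF assms] strictly_singular_complex_iff_real[OF assms]
    strictly_cosingular_complex_iff_real[OF assms] ideal_factorable_complex_iff_real[OF assms]
  by blast

end
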